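(* For every fixed number $t$ of robot types, the problem $\mathrm{OPG}_{LR}$ (Optimal Perimeter Guarding with Limited Resources) can be solved exactly by a pseudo-polynomial time algorithm, i.e., an algorithm whose running time is polynomial in the input size and in the magnitudes of the numerical input data (here in particular the robot numbers $n_1,\dots,n_t$).
   Context: Regions and perimeters. There are $m$ pairwise disjoint regions $R_1,\dots,R_m\subset\mathbb R^2$, each homeomorphic to the closed unit disc, with boundary $\partial R_i$ a closed curve of finite length. For each $i$, a nonempty set $P_i\subset\partial R_i$ is given which must be guarded; $P_i$ is either all of $\partial R_i$ or a union of finitely many disjoint closed arcs. The maximal connected components of $P_i$ are called segments and those of $\partial R_i\setminus P_i$ are called gaps. The perimeter set is $\mathcal P=\{P_1,\dots,P_m\}$. For complexity purposes an instance is specified by giving, for each $i$, the cyclic sequence of the lengths of the segments and gaps along $\partial R_i$ (nonnegative rational numbers), since the problem depends only on these data; the output is the optimal value and corresponding arcs (or a report that no cover exists). Covers. Each robot $j$ is assigned a connected closed subset (arc) $C_j$ of some single $\partial R_i$; two such sets may share at most endpoints. $\mathcal C=\{C_j\}$ is a cover of $\mathcal P$ if $\bigcup_i P_i\subset\bigcup_j C_j$ (gaps may, but need not, be covered). $\mathrm{len}(C_j)$ denotes the length of $C_j$. Problem $\mathrm{OPG}_{LR}$. The input consists of the perimeter data above, together with $t$ types of robots: for each type $1\le\tau\le t$, a number $n_\tau$ of available robots and a capability $a_\tau\in\mathbb Z^+$. Let $n=n_1+\dots+n_t$ and let $\tau_j$ be the type of robot $j$, $1\le j\le n$. The task is to find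 a cover $\mathcal C=\{C_1,\dots,C_n\}$ of $\mathcal P$, with $C_j$ assigned to robot $j$, minimizing $\max_{1\le j\le n}\mathrm{len}(C_j)/a_{\tau_j}$. *)

theory Defs
  imports
    "HOL-Analysis.Analysis"
    "HOL-Computational_Algebra.Polynomial"
    "HOL-Library.Log_Nat"
begin

section \<open>Model of computation\<close>

text \<open>
  The libraries provide no machine model with a time measure, so one is fixed here. Programs act on
  binary trees whose leaves are natural numbers; this is the one-variable WHILE language on trees of
  Jones (``Computability and Complexity from a Programming Perspective''), with numbers as leaves.
  Building a node copies two pointers and costs one unit. Arithmetic is charged by the logarithmic
  cost criterion of Aho, Hopcroft and Ullman, i.e. by the number of bits of the operands.
  Subtraction is truncated and division is integer division. Up to a polynomial this time measure
  agrees with that of Turing machines: trees are kept as pointer structures with sharing, and every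
  number ever stored has at most as many bits as the input plus the time already spent, up to a
  constant that depends on the program.
\<close>

datatype val = Atom nat | Node val val

datatype arith_op = Plus | Minus | Times | Quot

primrec arith :: "arith_op \<Rightarrow> nat \<Rightarrow> nat \<Rightarrow> nat" where
  "arith Plus a b = a + b"
| "arith Minus a b = a - b"
| "arith Times a b = a * b"
| "arith Quot a b = a div b"

datatype prog =
    ID
  | LIT nat
  | LEFT
  | RIGHT
  | ARITH arith_op
  | NODE prog prog
  | SEQ prog prog
  | COND prog prog prog
  | LOOP prog prog

definition bits :: "nat \<Rightarrow> nat" where
  "bits n = Suc (floorlog 2 n)"

text \<open>
  \<open>runs p x y c\<close>: program \<open>p\<close>, started on \<open>x\<close>, halts with result \<open>y\<close> after time \<open>c\<close>.
  As a truth value, \<open>Atom 0\<close> is false and everything else is true.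
\<close>

inductive runs :: "prog \<Rightarrow> val \<Rightarrow> val \<Rightarrow> nat \<Rightarrow> bool" where
  run_id: "runs ID x x 1"
| run_lit: "runs (LIT n) x (Atom n) 1"
| run_left: "runs LEFT (Node x y) x 1"
| run_right: "runs RIGHT (Node x y) y 1"
| run_arith: "runs (ARITH f) (Node (Atom a) (Atom b)) (Atom (arith f a b)) (1 + bits a + bits b)"
| run_node: "runs p x y c \<Longrightarrow> runs q x z d \<Longrightarrow> runs (NODE p q) x (Node y z) (1 + c + d)"
| run_seq: "runs p x y c \<Longrightarrow> runs q y z d \<Longrightarrow> runs (SEQ p q) x z (1 + c + d)"
| run_cond_true: "runs b x t c \<Longrightarrow> t \<noteq> Atom 0 \<Longrightarrow> runs p x y d \<Longrightarrow> runs (COND b p q) x y (1 + c + d)"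
| run_cond_false: "runs b x (Atom 0) c \<Longrightarrow> runs q x y d \<Longrightarrow> runs (COND b p q) x y (1 + c + d)"
| run_loop_exit: "runs b x (Atom 0) c \<Longrightarrow> runs (LOOP b p) x x (1 + c)"
| run_loop_step: "runs b x t c \<Longrightarrow> t \<noteq> Atom 0 \<Longrightarrow> runs p x y d \<Longrightarrow> runs (LOOP b p) y z e
    \<Longrightarrow> runs (LOOP b p) x z (1 + c + d + e)"

inductive_cases runs_idE: "runs ID x y c"
inductive_cases runs_litE: "runs (LIT n) x y c"
inductive_cases runs_leftE: "runs LEFT x y c"
inductive_cases runs_rightE: "runs RIGHT x y c"
inductive_cases runs_arithE: "runs (ARITH f) x y c"
inductive_cases runs_nodeE: "runs (NODE p q) x y c"
inductive_cases runs_seqE: "runs (SEQ p q) x y c"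
inductive_cases runs_condE: "runs (COND b p q) x y c"
inductive_cases runs_loopE: "runs (LOOP b p) x y c"

lemma runs_deterministic:
  "runs p x y c \<Longrightarrow> runs p x y' c' \<Longrightarrow> y' = y \<and> c' = c"
proof (induction arbitrary: y' c' rule: runs.induct)
  case (run_node p x y c q z d)
  from run_node.prems show ?case
    by (rule runs_nodeE) (auto dest: run_node.IH)
next
  case (run_seq p x y c q z d)
  from run_seq.prems show ?case
    by (rule runs_seqE) (auto dest!: run_seq.IH(1) dest: run_seq.IH(2))
next
  case (run_cond_true b x t c p y d q)
  from run_cond_true.prems show ?case
    by (rule runs_condE) (use run_cond_true.hyps in \<open>auto dest!: run_cond_true.IH\<close>)
next
  case (run_cond_false b x c q y d p)
  from run_cond_false.prems show ?case
    by (rule runs_condE) (auto dest!: run_cond_false.IH)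
next
  case (run_loop_exit b x c p)
  from run_loop_exit.prems show ?case
    by (rule runs_loopE) (auto dest!: run_loop_exit.IH)
next
  case (run_loop_step b x t c p y d z e)
  from run_loop_step.prems show ?case
    by (rule runs_loopE)
      (use run_loop_step.hyps in \<open>auto dest!: run_loop_step.IH(1) run_loop_step.IH(2) dest: run_loop_step.IH(3)\<close>)
qed (auto elim: runs_idE runs_litE runs_leftE runs_rightE runs_arithE)

primrec val_size :: "val \<Rightarrow> nat" where
  "val_size (Atom n) = bits n"
| "val_size (Node x y) = 1 + val_size x + val_size y"

primrec max_atom :: "val \<Rightarrow> nat" where
  "max_atom (Atom n) = n"
| "max_atom (Node x y) = max (max_atom x) (max_atom y)"

text \<open>
  A search problem is given by the set of its (encoded) inputs and by the relation between inputs
  and admissible outputs. As in Garey and Johnson, pseudo-polynomial means polynomial in the length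
  of the input and in the largest number that occurs in it.
\<close>

definition pseudo_polynomial_time_solvable :: "val set \<Rightarrow> (val \<Rightarrow> val \<Rightarrow> bool) \<Rightarrow> bool" where
  "pseudo_polynomial_time_solvable Inputs Sol \<longleftrightarrow>
    (\<exists>(p :: prog) (q :: nat poly). \<forall>v \<in> Inputs. \<exists>w c.
       runs p v w c \<and> Sol v w \<and> c \<le> poly q (val_size v + max_atom v))"

section \<open>Encoding of data as trees\<close>

definition nat_code :: "nat \<Rightarrow> val \<Rightarrow> bool" where
  "nat_code n v \<longleftrightarrow> v = Atom n"

text \<open>Only nonnegative rationals have a code; fractions need not be in lowest terms.\<close>

definition frac_code :: "real \<Rightarrow> val \<Rightarrow> bool" where
  "frac_code x v \<longleftrightarrow> (\<exists>a b. b > 0 \<and> x = real a / real b \<and> v = Node (Atom a) (Atom b))"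

definition pair_code :: "('a \<Rightarrow> val \<Rightarrow> bool) \<Rightarrow> ('b \<Rightarrow> val \<Rightarrow> bool) \<Rightarrow> 'a \<times> 'b \<Rightarrow> val \<Rightarrow> bool" where
  "pair_code A B p v \<longleftrightarrow> (\<exists>x y. v = Node x y \<and> A (fst p) x \<and> B (snd p) y)"

primrec list_code :: "('a \<Rightarrow> val \<Rightarrow> bool) \<Rightarrow> 'a list \<Rightarrow> val \<Rightarrow> bool" where
  "list_code A [] v \<longleftrightarrow> v = Atom 0"
| "list_code A (a # as) v \<longleftrightarrow> (\<exists>x y. v = Node x y \<and> A a x \<and> list_code A as y)"

primrec option_code :: "('a \<Rightarrow> val \<Rightarrow> bool) \<Rightarrow> 'a option \<Rightarrow> val \<Rightarrow> bool" where
  "option_code A None v \<longleftrightarrow> v = Atom 0"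
| "option_code A (Some a) v \<longleftrightarrow> v \<noteq> Atom 0 \<and> A a v"

section \<open>Instances and their geometric realisations\<close>

text \<open>
  The data of one perimeter is the cyclic list of pairs (segment length, length of the gap that
  follows it). The case of a perimeter that is guarded entirely, which has one segment and no gap,
  is written \<open>[(L, 0)]\<close>. A robot type is a pair (number of robots, capability).
\<close>

type_synonym perimeter = "(real \<times> real) list"

record opg_instance =
  perimeters :: "perimeter list"
  robot_types :: "(nat \<times> nat) list"

definition valid_perimeter :: "perimeter \<Rightarrow> bool" where
  "valid_perimeter xs \<longleftrightarrow>
     (\<exists>L. 0 < L \<and> L \<in> \<rat> \<and> xs = [(L, 0)]) \<or>
     (xs \<noteq> [] \<and> (\<forall>(s, g) \<in> set xs. 0 \<le> s \<and> s \<in> \<rat> \<and> 0 < g \<and> g \<in> \<rat>))"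

definition valid_instance :: "opg_instance \<Rightarrow> bool" where
  "valid_instance I \<longleftrightarrow> perimeters I \<noteq> [] \<and> (\<forall>xs \<in> set (perimeters I). valid_perimeter xs) \<and>
     (\<forall>(n, a) \<in> set (robot_types I). 0 < a)"

definition instance_code :: "opg_instance \<Rightarrow> val \<Rightarrow> bool" where
  "instance_code I v \<longleftrightarrow>
     pair_code (list_code (list_code (pair_code frac_code frac_code)))
       (list_code (pair_code nat_code nat_code)) (perimeters I, robot_types I) v"

definition num_regions :: "opg_instance \<Rightarrow> nat" where
  "num_regions I = length (perimeters I)"

definition perimeter_length :: "perimeter \<Rightarrow> real" where
  "perimeter_length xs = (\<Sum>(s, g) \<leftarrow> xs. s + g)"

definition boundary_length :: "opg_instance \<Rightarrow> nat \<Rightarrow> real" where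
  "boundary_length I i = perimeter_length (perimeters I ! i)"

definition curve_length :: "(real \<Rightarrow> real^2) \<Rightarrow> real \<Rightarrow> real \<Rightarrow> ennreal" where
  "curve_length \<gamma> a b = (SUP ts \<in> {ts. sorted ts \<and> set ts \<subseteq> {a..b}}.
     \<Sum>k < length ts - 1. ennreal (dist (\<gamma> (ts ! k)) (\<gamma> (ts ! Suc k))))"

text \<open>
  \<open>\<gamma>\<close> is the \<open>L\<close>-periodic parametrisation by arc length of the simple closed curve \<open>B\<close>. Every simple
  closed curve of finite length \<open>L\<close> has one, for each choice of base point and orientation.
\<close>

definition arc_length_parametrisation :: "(real^2) set \<Rightarrow> real \<Rightarrow> (real \<Rightarrow> real^2) \<Rightarrow> bool" where
  "arc_length_parametrisation B L \<gamma> \<longleftrightarrow>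
     0 < L \<and> continuous_on UNIV \<gamma> \<and> range \<gamma> = B \<and>
     (\<forall>x y. \<gamma> x = \<gamma> y \<longleftrightarrow> (\<exists>k :: int. y = x + of_int k * L)) \<and>
     (\<forall>a b. a \<le> b \<longrightarrow> curve_length \<gamma> a b = ennreal (b - a))"

text \<open>
  The regions \<open>R i\<close>, \<open>i < m\<close>. The point \<open>\<gamma> i 0\<close> is the beginning of the segment listed first.
\<close>

definition realises :: "opg_instance \<Rightarrow> (nat \<Rightarrow> (real^2) set) \<Rightarrow> (nat \<Rightarrow> real \<Rightarrow> real^2) \<Rightarrow> bool" where
  "realises I R \<gamma> \<longleftrightarrow>
     (\<forall>i < num_regions I. R i homeomorphic cball (0 :: real^2) 1 \<and>
        arc_length_parametrisation (frontier (R i)) (boundary_length I i) (\<gamma> i)) \<and>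
     (\<forall>i < num_regions I. \<forall>j < num_regions I. i \<noteq> j \<longrightarrow> R i \<inter> R j = {})"

definition segment_start :: "perimeter \<Rightarrow> nat \<Rightarrow> real" where
  "segment_start xs k = perimeter_length (take k xs)"

definition guarded :: "opg_instance \<Rightarrow> (nat \<Rightarrow> real \<Rightarrow> real^2) \<Rightarrow> nat \<Rightarrow> (real^2) set" where
  "guarded I \<gamma> i = (let xs = perimeters I ! i in
     \<Union>k < length xs. \<gamma> i ` {segment_start xs k .. segment_start xs k + fst (xs ! k)})"

section \<open>Covers and the optimisation problem\<close>

text \<open>
  The arc \<open>(i, s, l)\<close> lies on the boundary of region \<open>i\<close>, begins at \<open>\<gamma> i s\<close> and has length \<open>l\<close>.
  Single points (\<open>l = 0\<close>) and the whole boundary are included.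
\<close>

type_synonym robot_arc = "nat \<times> real \<times> real"

definition valid_arc :: "opg_instance \<Rightarrow> robot_arc \<Rightarrow> bool" where
  "valid_arc I = (\<lambda>(i, s, l). i < num_regions I \<and> 0 \<le> l \<and> l \<le> boundary_length I i)"

definition arc_points :: "(nat \<Rightarrow> real \<Rightarrow> real^2) \<Rightarrow> robot_arc \<Rightarrow> (real^2) set" where
  "arc_points \<gamma> = (\<lambda>(i, s, l). \<gamma> i ` {s .. s + l})"

definition arc_ends :: "(nat \<Rightarrow> real \<Rightarrow> real^2) \<Rightarrow> robot_arc \<Rightarrow> (real^2) set" where
  "arc_ends \<gamma> = (\<lambda>(i, s, l). {\<gamma> i s, \<gamma> i (s + l)})"

definition arc_len :: "robot_arc \<Rightarrow> real" where
  "arc_len = (\<lambda>(i, s, l). l)"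

text \<open>
  The list of the capabilities \<open>a\<close> of the types of robots \<open>1, ..., n\<close>, numbered type by type.
\<close>

definition capabilities :: "opg_instance \<Rightarrow> nat list" where
  "capabilities I = concat (map (\<lambda>(n, a). replicate n a) (robot_types I))"

definition num_robots :: "opg_instance \<Rightarrow> nat" where
  "num_robots I = (\<Sum>(n, a) \<leftarrow> robot_types I. n)"

definition is_cover :: "opg_instance \<Rightarrow> (nat \<Rightarrow> real \<Rightarrow> real^2) \<Rightarrow> robot_arc list \<Rightarrow> bool" where
  "is_cover I \<gamma> C \<longleftrightarrow>
     length C = num_robots I \<and>
     (\<forall>c \<in> set C. valid_arc I c) \<and>
     (\<forall>j < length C. \<forall>k < length C. j \<noteq> k \<longrightarrow>
        arc_points \<gamma> (C ! j) \<inter> arc_points \<gamma> (C ! k) \<subseteq> arc_ends \<gamma> (C ! j) \<inter> arc_ends \<gamma> (C ! k)) \<and>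
     (\<Union>i < num_regions I. guarded I \<gamma> i) \<subseteq> (\<Union>c \<in> set C. arc_points \<gamma> c)"

text \<open>
  The maximum is over a nonempty set whenever there is a cover, as no cover exists without robots.
\<close>

definition cost :: "opg_instance \<Rightarrow> robot_arc list \<Rightarrow> real" where
  "cost I C = Max ((\<lambda>j. arc_len (C ! j) / real (capabilities I ! j)) ` {..<num_robots I})"

primrec is_solution ::
    "opg_instance \<Rightarrow> (nat \<Rightarrow> real \<Rightarrow> real^2) \<Rightarrow> (real \<times> robot_arc list) option \<Rightarrow> bool" where
  "is_solution I \<gamma> None \<longleftrightarrow> (\<nexists>C. is_cover I \<gamma> C)"
| "is_solution I \<gamma> (Some r) \<longleftrightarrow>
     is_cover I \<gamma> (snd r) \<and> fst r = cost I (snd r) \<and>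
     (\<forall>C. is_cover I \<gamma> C \<longrightarrow> cost I (snd r) \<le> cost I C)"

definition solution_code :: "(real \<times> robot_arc list) option \<Rightarrow> val \<Rightarrow> bool" where
  "solution_code =
     option_code (pair_code frac_code (list_code (pair_code nat_code (pair_code frac_code frac_code))))"

definition OPG_LR_inputs :: "nat \<Rightarrow> val set" where
  "OPG_LR_inputs t =
     {v. \<exists>I. valid_instance I \<and> length (robot_types I) = t \<and> instance_code I v}"

definition OPG_LR_output :: "val \<Rightarrow> val \<Rightarrow> bool" where
  "OPG_LR_output v w \<longleftrightarrow>
     (\<forall>I. valid_instance I \<and> instance_code I v \<longrightarrow>
       (\<exists>r. solution_code r w \<and> (\<forall>R \<gamma>. realises I R \<gamma> \<longrightarrow> is_solution I \<gamma> r)))"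

end

theory Submission
  imports Defs
begin

text \<open>
  In a cover, the robots on one boundary fall into groups: the arcs of a group together cover a run
  of consecutive segments with the gaps between them, and different groups are separated by points
  of gaps that nobody covers. A group of total capability \<open>A\<close> that covers a run of length \<open>D\<close> costs at
  least \<open>D / A\<close>, and it attains this cost by sharing the run in proportion to the capabilities. So
  the optimum is the minimum, over all ways to cut the boundaries into runs and to distribute the
  robots over the runs, of the largest quotient \<open>D / A\<close>. Of the robots in a group only the number of
  each type matters. With \<open>t\<close> types there are thus \<open>(n\<^sub>1 + 1) \<dots> (n\<^sub>t + 1)\<close> vectors of robots used so
  far, which is polynomial in the \<open>n\<^sub>k\<close> when \<open>t\<close> is fixed.

  The optimum is therefore the value of a bottleneck path in a graph of pseudo-polynomial size. A
  state consists of a position (region, rotation, next segment) and of the vector of the robots used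
  so far; the rotation is the segment with which the runs of the region begin. A move of the path is
  one group. Best paths are found round by round, keeping one best path for every possible last
  move (\<open>best_paths_complete\<close>). Every move uses a robot, so there are at most as many rounds as
  robots (\<open>path_length\<close>).

  Covers yield paths that are no worse (\<open>exists_path\<close>). The geometric part is \<open>exists_chain\<close>: if some
  gap of the boundary has an uncovered point, the boundary is cut at such points, each arc lies
  between two neighbouring cuts, and the lengths of the arcs between two cuts add up to at least the
  length of the run between them; if there is no such point, all arcs form one group, whose lengths add up
  to at least the whole boundary. Conversely a path yields a cover with the same value
  (\<open>is_cover_path_cover\<close>, \<open>cost_path_cover\<close>): the arcs along the path follow each other in order on
  each boundary and go around at most once, hence overlap at most in endpoints.

  For the running time, all lengths are multiplied by a common denominator. It has polynomially
  many bits, but may be exponentially large, so intermediate results are measured by their bits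
  only. Magnitudes enter through a single parameter, the number \<open>(n\<^sub>1 + 1) \<dots> (n\<^sub>t + 1)\<close>. The
  functions of the algorithm are shown to be computable in time polynomial in the size of their
  argument and in this parameter by closure properties, of which \<open>pt_foldl\<close> is the main one.
\<close>

section \<open>Polynomial time on encoded data\<close>

text \<open>
  Time is discussed for functions between types rather than between trees. A function that is total
  on its type never meets a malformed tree, and no program has to tell atoms from nodes, which the
  language cannot do.
\<close>

class enc =
  fixes enc :: "'a \<Rightarrow> val"
  assumes enc_inj: "enc x = enc y \<Longrightarrow> x = y"

instantiation val :: enc begin
definition "enc_val (v :: val) = v"
instance by standard (simp add: enc_val_def)
end

instantiation nat :: enc begin
definition "enc_nat n = Atom n"
instance by standard (simp add: enc_nat_def)
end

instantiation bool :: enc begin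
definition "enc_bool b = Atom (if b then 1 else 0)"
instance by standard (simp add: enc_bool_def split: if_splits)
end

instantiation prod :: (enc, enc) enc begin
definition "enc_prod p = Node (enc (fst p)) (enc (snd p))"
instance by standard (auto simp: enc_prod_def prod_eq_iff dest: enc_inj)
end

instantiation list :: (enc) enc begin
primrec enc_list where
  "enc_list [] = Atom 0"
| "enc_list (x # xs) = Node (enc x) (enc_list xs)"
instance
proof
  fix xs ys :: "'a list"
  show "enc xs = enc ys \<Longrightarrow> xs = ys"
  proof (induction xs arbitrary: ys)
    case Nil
    then show ?case by (cases ys) auto
  next
    case (Cons x xs)
    then show ?case by (cases ys) (auto dest: enc_inj)
  qed
qed
end

lemmas enc_simps [simp] = enc_val_def enc_nat_def enc_bool_def enc_prod_def

abbreviation sz :: "'a :: enc \<Rightarrow> nat" where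
  "sz x \<equiv> val_size (enc x)"

lemma val_size_pos [simp]: "0 < val_size v" "Suc 0 \<le> val_size v"
  by (induction v) (auto simp: bits_def)

lemma sz_list: "sz xs = bits 0 + sum_list (map (\<lambda>x. 1 + sz x) xs)"
  by (induction xs) auto

lemma bits_0 [simp]: "bits 0 = 1"
  by (simp add: bits_def floorlog_def)

lemma bits_Suc_0: "bits (Suc 0) = 2"
  by (simp add: bits_def floorlog_def)

lemma bits_1 [simp]: "bits 1 = 2"
  by (simp add: bits_def floorlog_def)

lemma bits_pos [simp]: "0 < bits n"
  by (simp add: bits_def)

lemma bits_le_iff: "bits n \<le> Suc w \<longleftrightarrow> n < 2 ^ w"
  by (simp add: bits_def floorlog_le_iff)

lemma less_two_power_bits: "n < 2 ^ (bits n - 1)"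
  using bits_le_iff[of n "bits n - 1"] by (simp add: bits_def)

lemma bits_mono: "a \<le> b \<Longrightarrow> bits a \<le> bits b"
  by (simp add: bits_def floorlog_mono)

lemma bits_mult: "bits (a * b) \<le> bits a + bits b"
proof -
  have "a * b < 2 ^ (bits a - 1) * 2 ^ (bits b - 1)"
    using less_two_power_bits by (intro mult_strict_mono) auto
  also have "\<dots> = 2 ^ (bits a - 1 + (bits b - 1))" by (simp add: power_add)
  finally have "bits (a * b) \<le> Suc (bits a - 1 + (bits b - 1))" by (subst bits_le_iff)
  then show ?thesis using bits_pos[of a] bits_pos[of b] by linarith
qed

lemma bits_add: "bits (a + b) \<le> bits a + bits b"
proof -
  obtain x where x: "2 ^ (bits a - 1) = Suc x" by (metis not0_implies_Suc power_not_zero zero_neq_numeral)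
  obtain y where y: "2 ^ (bits b - 1) = Suc y" by (metis not0_implies_Suc power_not_zero zero_neq_numeral)
  have "2 ^ (bits a - 1) + 2 ^ (bits b - 1) \<le> 2 ^ (bits a - 1) * 2 ^ (bits b - 1) + (1::nat)"
    unfolding x y by simp
  then have "a + b < 2 ^ (bits a - 1) * 2 ^ (bits b - 1)"
    using less_two_power_bits[of a] less_two_power_bits[of b] by linarith
  also have "\<dots> = 2 ^ (bits a - 1 + (bits b - 1))" by (simp add: power_add)
  finally have "bits (a + b) \<le> Suc (bits a - 1 + (bits b - 1))" by (subst bits_le_iff)
  then show ?thesis using bits_pos[of a] bits_pos[of b] by linarith
qed

lemma bits_le_Suc: "bits n \<le> Suc (Suc n)"
proof -
  have "n < 2 ^ Suc n" using less_exp[of "Suc n"] by linarith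
  then show ?thesis by (simp only: bits_le_iff)
qed

lemma poly_nat_mono: "a \<le> b \<Longrightarrow> poly (q :: nat poly) a \<le> poly q b"
proof (induction q)
  case (pCons c q)
  then show ?case by (simp add: mult_le_mono)
qed simp

text \<open>
  Bounds are polynomial in the size of the argument plus a parameter \<open>\<mu>\<close>. Local variables
  extend the argument to a pair whose first component is the old argument; there the parameter is \<open>\<mu>\<close>
  of the first component, while the sizes of the new variables are counted by themselves. With
  \<open>\<mu> = 0\<close> this is ordinary polynomial time.
\<close>

definition polybounded :: "('e :: enc \<Rightarrow> nat) \<Rightarrow> ('e \<Rightarrow> nat) \<Rightarrow> bool" where
  "polybounded \<mu> g \<longleftrightarrow> (\<exists>q. \<forall>x. g x \<le> poly q (\<mu> x + sz x))"

text \<open>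
  The size of the result is bounded as well. The time does not bound it, since \<open>NODE\<close> shares its
  components: a loop can double the size of a tree in every round. Without this bound the notion would
  not be closed under composition.
\<close>

definition polytime :: "('e :: enc \<Rightarrow> nat) \<Rightarrow> ('e \<Rightarrow> 'b :: enc) \<Rightarrow> bool" where
  "polytime \<mu> f \<longleftrightarrow>
    (\<exists>p q. \<forall>x. \<exists>c. runs p (enc x) (enc (f x)) c \<and> c + sz (f x) \<le> poly q (\<mu> x + sz x))"

lemma pbd_le: "polybounded \<mu> h \<Longrightarrow> (\<And>x. g x \<le> h x) \<Longrightarrow> polybounded \<mu> g"
  proof -
  assume "polybounded \<mu> h" and le: "\<And>x. g x \<le> h x"
  then obtain q where "\<And>x. h x \<le> poly q (\<mu> x + sz x)" unfolding polybounded_def by blast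
  with le have "g x \<le> poly q (\<mu> x + sz x)" for x using le_trans by blast
  then show ?thesis unfolding polybounded_def by blast
qed

lemma pbd_const: "polybounded \<mu> (\<lambda>_. n)"
  unfolding polybounded_def by (rule exI[of _ "[:n:]"]) simp

lemma pbd_measure: "polybounded \<mu> \<mu>"
  unfolding polybounded_def by (rule exI[of _ "[:0, 1:]"]) simp

lemma pbd_sz: "polybounded \<mu> sz"
  unfolding polybounded_def by (rule exI[of _ "[:0, 1:]"]) simp

lemma pbd_add: "polybounded \<mu> g \<Longrightarrow> polybounded \<mu> h \<Longrightarrow> polybounded \<mu> (\<lambda>x. g x + h x)"
proof -
  assume "polybounded \<mu> g" "polybounded \<mu> h"
  then obtain p q where "\<And>x. g x \<le> poly p (\<mu> x + sz x)" "\<And>x. h x \<le> poly q (\<mu> x + sz x)"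
    unfolding polybounded_def by blast
  then have "g x + h x \<le> poly (p + q) (\<mu> x + sz x)" for x by (simp add: add_mono)
  then show ?thesis unfolding polybounded_def by blast
qed

lemma pbd_mult: "polybounded \<mu> g \<Longrightarrow> polybounded \<mu> h \<Longrightarrow> polybounded \<mu> (\<lambda>x. g x * h x)"
proof -
  assume "polybounded \<mu> g" "polybounded \<mu> h"
  then obtain p q where "\<And>x. g x \<le> poly p (\<mu> x + sz x)" "\<And>x. h x \<le> poly q (\<mu> x + sz x)"
    unfolding polybounded_def by blast
  then have "g x * h x \<le> poly (p * q) (\<mu> x + sz x)" for x by (simp add: mult_le_mono)
  then show ?thesis unfolding polybounded_def by blast
qed

lemma pbd_Suc: "polybounded \<mu> g \<Longrightarrow> polybounded \<mu> (\<lambda>x. Suc (g x))"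
  using pbd_add[OF pbd_const[of \<mu> 1], of g] by simp

lemma pbd_comp:
  assumes T: "polybounded \<nu> T" and "polybounded \<mu> (\<lambda>x. \<nu> (h x))" "polybounded \<mu> (\<lambda>x. sz (h x))"
  shows "polybounded \<mu> (\<lambda>x. T (h x))"
proof -
  from pbd_add[OF assms(2,3)] obtain q where q: "\<And>x. \<nu> (h x) + sz (h x) \<le> poly q (\<mu> x + sz x)"
    unfolding polybounded_def by auto
  from T obtain r where r: "\<And>y. T y \<le> poly r (\<nu> y + sz y)"
    unfolding polybounded_def by auto
  have "T (h x) \<le> poly (pcompose r q) (\<mu> x + sz x)" for x
    using le_trans[OF r poly_nat_mono[OF q]] by (simp add: poly_pcompose)
  then show ?thesis unfolding polybounded_def by blast
qed

lemma ptI: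
  assumes "\<And>x. \<exists>c. runs p (enc x) (enc (f x)) c \<and> c \<le> T x" "polybounded \<mu> T" "polybounded \<mu> (\<lambda>x. sz (f x))"
  shows "polytime \<mu> f"
proof -
  from pbd_add[OF assms(2,3)] obtain q where q: "\<And>x. T x + sz (f x) \<le> poly q (\<mu> x + sz x)"
    unfolding polybounded_def by auto
  have "\<exists>c. runs p (enc x) (enc (f x)) c \<and> c + sz (f x) \<le> poly q (\<mu> x + sz x)" for x
    using assms(1)[of x] q[of x] by (meson add_le_mono1 le_trans)
  then show ?thesis unfolding polytime_def by blast
qed

lemma ptE:
  assumes "polytime \<mu> f"
  obtains p T where "\<And>x. \<exists>c. runs p (enc x) (enc (f x)) c \<and> c \<le> T x" "polybounded \<mu> T"
    "polybounded \<mu> (\<lambda>x. sz (f x))"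
proof -
  from assms obtain p q where
    *: "\<And>x. \<exists>c. runs p (enc x) (enc (f x)) c \<and> c + sz (f x) \<le> poly q (\<mu> x + sz x)"
    unfolding polytime_def by blast
  show thesis
  proof (rule that)
    show "\<exists>c. runs p (enc x) (enc (f x)) c \<and> c \<le> poly q (\<mu> x + sz x)" for x
      using *[of x] by auto
    show "polybounded \<mu> (\<lambda>x. poly q (\<mu> x + sz x))" unfolding polybounded_def by blast
    have "sz (f x) \<le> poly q (\<mu> x + sz x)" for x using *[of x] by auto
    then show "polybounded \<mu> (\<lambda>x. sz (f x))" unfolding polybounded_def by blast
  qed
qed

lemma ptD:
  assumes "polytime \<mu> f"
  shows "\<exists>p T. (\<forall>x. \<exists>c. runs p (enc x) (enc (f x)) c \<and> c \<le> T x) \<and> polybounded \<mu> T \<and> polybounded \<mu> (\<lambda>x. sz (f x))"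
  by (rule ptE[OF assms]) blast

lemma pt_pbd: "polytime \<mu> f \<Longrightarrow> polybounded \<mu> (\<lambda>x. sz (f x))"
  by (erule ptE)

lemma length_le_sz: "length xs \<le> sz xs"
  by (induction xs) auto

lemma pt_pbd_length: "polytime \<mu> f \<Longrightarrow> polybounded \<mu> (\<lambda>x. length (f x))"
  by (rule pbd_le[OF pt_pbd length_le_sz])

lemma pt_comp:
  assumes "polytime \<nu> f" "polytime \<mu> h" "polybounded \<mu> (\<lambda>x. \<nu> (h x))"
  shows "polytime \<mu> (\<lambda>x. f (h x))"
proof -
  obtain p T where f: "\<And>x. \<exists>c. runs p (enc x) (enc (f x)) c \<and> c \<le> T x" "polybounded \<nu> T"
    "polybounded \<nu> (\<lambda>x. sz (f x))"
    using ptD[OF assms(1)] by blast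
  obtain p' T' where h: "\<And>x. \<exists>c. runs p' (enc x) (enc (h x)) c \<and> c \<le> T' x" "polybounded \<mu> T'"
    "polybounded \<mu> (\<lambda>x. sz (h x))"
    using ptD[OF assms(2)] by blast
  show ?thesis
  proof (rule ptI)
    show "\<exists>c. runs (SEQ p' p) (enc x) (enc (f (h x))) c \<and> c \<le> 1 + T' x + T (h x)" for x
      using f(1)[of "h x"] h(1)[of x] by (meson add_mono le_refl run_seq)
    show "polybounded \<mu> (\<lambda>x. 1 + T' x + T (h x))"
      by (intro pbd_add pbd_const h pbd_comp[OF f(2)] assms(3))
    show "polybounded \<mu> (\<lambda>x. sz (f (h x)))"
      by (rule pbd_comp[OF f(3) assms(3) h(3)])
  qed
qed

lemma pt_app:
  assumes "polytime (\<lambda>_. 0) f" "polytime \<mu> h"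
  shows "polytime \<mu> (\<lambda>x. f (h x))"
  by (rule pt_comp[OF assms]) (rule pbd_const)

lemma pt_id: "polytime \<mu> (\<lambda>x. x)"
  by (rule ptI[of ID _ "\<lambda>_. 1"]) (auto intro: run_id pbd_const pbd_sz)

lemma runs_const: "\<exists>p k. \<forall>v. runs p v w k"
proof (induction w)
  case (Atom n)
  show ?case using run_lit by blast
next
  case (Node w1 w2)
  then show ?case by (meson run_node)
qed

lemma pt_const: "polytime \<mu> (\<lambda>_. a)"
proof -
  obtain p k where "\<And>v. runs p v (enc a) k" using runs_const by meson
  then show ?thesis by (intro ptI[of p _ "\<lambda>_. k"]) (auto intro: pbd_const)
qed

lemma pt_Pair:
  assumes "polytime \<mu> f" "polytime \<mu> g"
  shows "polytime \<mu> (\<lambda>x. (f x, g x))"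
proof -
  obtain p T where f: "\<And>x. \<exists>c. runs p (enc x) (enc (f x)) c \<and> c \<le> T x" "polybounded \<mu> T"
    "polybounded \<mu> (\<lambda>x. sz (f x))"
    using ptD[OF assms(1)] by blast
  obtain p' T' where g: "\<And>x. \<exists>c. runs p' (enc x) (enc (g x)) c \<and> c \<le> T' x" "polybounded \<mu> T'"
    "polybounded \<mu> (\<lambda>x. sz (g x))"
    using ptD[OF assms(2)] by blast
  show ?thesis
  proof (rule ptI)
    show "\<exists>c. runs (NODE p p') (enc x) (enc (f x, g x)) c \<and> c \<le> 1 + T x + T' x" for x
      using f(1)[of x] g(1)[of x] by (simp del: One_nat_def) (meson add_mono le_refl run_node)
    show "polybounded \<mu> (\<lambda>x. 1 + T x + T' x)"
      by (intro pbd_add pbd_const f g)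
    show "polybounded \<mu> (\<lambda>x. sz (f x, g x))"
      unfolding enc_prod_def fst_conv snd_conv val_size.simps by (intro pbd_add pbd_const f g)
  qed
qed

lemma pt_Cons:
  assumes "polytime \<mu> f" "polytime \<mu> g"
  shows "polytime \<mu> (\<lambda>x. f x # g x)"
  using pt_Pair[OF assms] unfolding polytime_def by simp

lemma pt_fst: "polytime \<mu> f \<Longrightarrow> polytime \<mu> (\<lambda>x. fst (f x))"
proof (erule pt_app[rotated], rule ptI)
  show "\<exists>c. runs LEFT (enc x) (enc (fst x)) c \<and> c \<le> 1" for x :: "'b \<times> 'c"
    using run_left by auto
  show "polybounded (\<lambda>_. 0) (\<lambda>x :: 'b \<times> 'c. sz (fst x))" by (rule pbd_le[OF pbd_sz]) simp
qed (rule pbd_const)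

lemma pt_snd: "polytime \<mu> f \<Longrightarrow> polytime \<mu> (\<lambda>x. snd (f x))"
proof (erule pt_app[rotated], rule ptI)
  show "\<exists>c. runs RIGHT (enc x) (enc (snd x)) c \<and> c \<le> 1" for x :: "'b \<times> 'c"
    using run_right by auto
  show "polybounded (\<lambda>_. 0) (\<lambda>x :: 'b \<times> 'c. sz (snd x))" by (rule pbd_le[OF pbd_sz]) simp
qed (rule pbd_const)

lemma bits_arith: "bits (arith f a b) \<le> bits a + bits b"
proof (cases f)
  case Minus
  have "bits (a - b) \<le> bits a" by (rule bits_mono) simp
  with Minus show ?thesis by simp
next
  case Quot
  have "bits (a div b) \<le> bits a" by (rule bits_mono) simp
  with Quot show ?thesis by simp
qed (auto intro: bits_add bits_mult)

lemma pt_arith: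
  assumes "polytime \<mu> f" "polytime \<mu> g"
  shows "polytime \<mu> (\<lambda>e. arith op (f e) (g e))"
proof -
  have "polytime (\<lambda>_. 0) (\<lambda>p :: nat \<times> nat. arith op (fst p) (snd p))"
  proof (rule ptI)
    show "\<exists>c. runs (ARITH op) (enc x) (enc (arith op (fst x) (snd x))) c \<and>
        c \<le> 1 + bits (fst x) + bits (snd x)" for x
      using run_arith by auto
    show "polybounded (\<lambda>_. 0) (\<lambda>x :: nat \<times> nat. 1 + bits (fst x) + bits (snd x))"
      by (rule pbd_le[OF pbd_sz]) simp
    show "polybounded (\<lambda>_. 0) (\<lambda>x :: nat \<times> nat. sz (arith op (fst x) (snd x)))"
      by (rule pbd_le[OF pbd_sz]) (simp add: le_SucI[OF bits_arith])
  qed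
  from pt_app[OF this pt_Pair[OF assms]] show ?thesis by simp
qed

lemmas pt_plus = pt_arith[where op = Plus, unfolded arith.simps]
  and pt_minus = pt_arith[where op = Minus, unfolded arith.simps]
  and pt_times = pt_arith[where op = Times, unfolded arith.simps]
  and pt_div = pt_arith[where op = Quot, unfolded arith.simps]

lemma pt_Suc: "polytime \<mu> f \<Longrightarrow> polytime \<mu> (\<lambda>e. Suc (f e))"
  unfolding Suc_eq_plus1 by (intro pt_plus pt_const)

lemma pt_if_enc:
  fixes b :: "'e :: enc \<Rightarrow> 'b :: enc"
  assumes "polytime \<mu> b" "polytime \<mu> f" "polytime \<mu> g"
  shows "polytime \<mu> (\<lambda>e. if enc (b e) \<noteq> Atom 0 then f e else g e)"
proof -
  obtain r U where b: "\<And>x. \<exists>c. runs r (enc x) (enc (b x)) c \<and> c \<le> U x" "polybounded \<mu> U"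
    "polybounded \<mu> (\<lambda>x. sz (b x))"
    using ptD[OF assms(1)] by blast
  obtain p T where f: "\<And>x. \<exists>c. runs p (enc x) (enc (f x)) c \<and> c \<le> T x" "polybounded \<mu> T"
    "polybounded \<mu> (\<lambda>x. sz (f x))"
    using ptD[OF assms(2)] by blast
  obtain p' T' where g: "\<And>x. \<exists>c. runs p' (enc x) (enc (g x)) c \<and> c \<le> T' x" "polybounded \<mu> T'"
    "polybounded \<mu> (\<lambda>x. sz (g x))"
    using ptD[OF assms(3)] by blast
  show ?thesis
  proof (rule ptI)
    fix x
    obtain c1 c2 c3 where c: "runs r (enc x) (enc (b x)) c1" "c1 \<le> U x" "runs p (enc x) (enc (f x)) c2"
      "c2 \<le> T x" "runs p' (enc x) (enc (g x)) c3" "c3 \<le> T' x" using b(1) f(1) g(1) by meson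
    show "\<exists>c. runs (COND r p p') (enc x) (enc (if enc (b x) \<noteq> Atom 0 then f x else g x)) c
        \<and> c \<le> 1 + U x + T x + T' x"
    proof (cases "enc (b x) = Atom 0")
      case True
      with run_cond_false[of r "enc x" c1 p' "enc (g x)" c3 p] c show ?thesis by fastforce
    next
      case False
      with run_cond_true[of r "enc x" "enc (b x)" c1 p "enc (f x)" c2 p'] c show ?thesis by fastforce
    qed
  next
    show "polybounded \<mu> (\<lambda>x. 1 + U x + T x + T' x)"
      by (intro pbd_add pbd_const b f g)
    show "polybounded \<mu> (\<lambda>x. sz (if enc (b x) \<noteq> Atom 0 then f x else g x))"
      by (rule pbd_le[OF pbd_add[OF f(3) g(3)]]) auto
  qed
qed

lemma pt_if:
  assumes "polytime \<mu> b" "polytime \<mu> f" "polytime \<mu> g"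
  shows "polytime \<mu> (\<lambda>e. if b e then f e else g e)"
  by (rule back_subst[of "polytime \<mu>", OF pt_if_enc[OF assms]]) (simp add: fun_eq_iff)

lemma pt_less:
  assumes "polytime \<mu> f" "polytime \<mu> g"
  shows "polytime \<mu> (\<lambda>e. f e < (g e :: nat))"
  by (rule back_subst[of "polytime \<mu>", OF pt_if_enc[OF pt_minus[OF assms(2,1)] pt_const[of _ True] pt_const[of _ False]]])
    (simp add: fun_eq_iff)

lemma pt_not:
  assumes "polytime \<mu> f"
  shows "polytime \<mu> (\<lambda>e. \<not> f e)"
  by (rule back_subst[of "polytime \<mu>", OF pt_if[OF assms pt_const[of _ False] pt_const[of _ True]]])
    (simp add: fun_eq_iff)

lemma pt_conj:
  assumes "polytime \<mu> f" "polytime \<mu> g"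
  shows "polytime \<mu> (\<lambda>e. f e \<and> g e)"
  by (rule back_subst[of "polytime \<mu>", OF pt_if[OF assms pt_const[of _ False]]]) (simp add: fun_eq_iff)

lemma pt_le: "polytime \<mu> f \<Longrightarrow> polytime \<mu> g \<Longrightarrow> polytime \<mu> (\<lambda>e. f e \<le> (g e :: nat))"
  unfolding not_less[symmetric] by (intro pt_not pt_less)

lemma pt_eq_nat: "polytime \<mu> f \<Longrightarrow> polytime \<mu> g \<Longrightarrow> polytime \<mu> (\<lambda>e. f e = (g e :: nat))"
  unfolding eq_iff by (intro pt_conj pt_le)

lemma pt_let:
  assumes "polytime \<mu> g" "polytime (\<lambda>p. \<mu> (fst p)) (\<lambda>p. f (fst p) (snd p))"
  shows "polytime \<mu> (\<lambda>e. let y = g e in f e y)"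
  using pt_comp[OF assms(2) pt_Pair[OF pt_id assms(1)]] by (simp add: pbd_measure Let_def)

lemma pt_case_list:
  fixes g :: "'e :: enc \<Rightarrow> 'x :: enc list"
  assumes "polytime \<mu> g" "polytime \<mu> a"
    "polytime (\<lambda>p. \<mu> (fst p)) (\<lambda>p. f (fst p) (fst (snd p)) (snd (snd p)))"
  shows "polytime \<mu> (\<lambda>e. case g e of [] \<Rightarrow> a e | x # xs \<Rightarrow> f e x xs)"
proof -
  obtain r U where g: "\<And>x. \<exists>c. runs r (enc x) (enc (g x)) c \<and> c \<le> U x" "polybounded \<mu> U"
    "polybounded \<mu> (\<lambda>x. sz (g x))"
    using ptD[OF assms(1)] by blast
  obtain p T where a: "\<And>x. \<exists>c. runs p (enc x) (enc (a x)) c \<and> c \<le> T x" "polybounded \<mu> T"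
    "polybounded \<mu> (\<lambda>x. sz (a x))"
    using ptD[OF assms(2)] by blast
  obtain p' T' where
    f: "\<And>x. \<exists>c. runs p' (enc x) (enc (f (fst x) (fst (snd x)) (snd (snd x)))) c \<and> c \<le> T' x"
    "polybounded (\<lambda>p. \<mu> (fst p)) T'"
    "polybounded (\<lambda>p. \<mu> (fst p)) (\<lambda>x. sz (f (fst x) (fst (snd x)) (snd (snd x))))"
    using ptD[OF assms(3)] by blast
  let ?h = "\<lambda>e. (e, case g e of [] \<Rightarrow> undefined | x # xs \<Rightarrow> (x, xs))"
  \<comment> \<open>For the empty list the bound of the other branch is taken at one fixed value, so it contributes a constant.\<close>
  let ?h' = "\<lambda>e. if g e = [] then undefined else ?h e"
  have h'1: "polybounded \<mu> (\<lambda>x. \<mu> (fst (?h' x)))"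
    by (rule pbd_le[OF pbd_add[OF pbd_const[of \<mu> "\<mu> (fst (undefined :: 'e \<times> 'x \<times> 'x list))"] pbd_measure]])
      auto
  have h'2: "polybounded \<mu> (\<lambda>x. sz (?h' x))"
    by (rule pbd_le[OF pbd_add[OF pbd_const[of \<mu> "sz (undefined :: 'e \<times> 'x \<times> 'x list)"]
        pbd_add[OF pbd_const[of \<mu> 1] pbd_add[OF pbd_sz g(3)]]]])
      (auto split: list.split)
  show ?thesis
  proof (rule ptI)
    fix x
    obtain c1 where c1: "runs r (enc x) (enc (g x)) c1" "c1 \<le> U x" using g(1) by meson
    show "\<exists>c. runs (SEQ (NODE ID r) (COND RIGHT p' (SEQ LEFT p))) (enc x)
          (enc (case g x of [] \<Rightarrow> a x | y # ys \<Rightarrow> f x y ys)) c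
        \<and> c \<le> 10 + U x + T x + T' (?h' x)"
    proof (cases "g x")
      case Nil
      obtain c2 where c2: "runs p (enc x) (enc (a x)) c2" "c2 \<le> T x" using a(1) by meson
      have r: "runs r (enc x) (Atom 0) c1" using c1(1) Nil by simp
      have "runs (SEQ (NODE ID r) (COND RIGHT p' (SEQ LEFT p))) (enc x) (enc (a x))
        (1 + (1 + 1 + c1) + (1 + 1 + (1 + 1 + c2)))"
        by (rule run_seq[OF run_node[OF run_id r] run_cond_false[OF run_right run_seq[OF run_left c2(1)]]])
      then show ?thesis using c1 c2 Nil by fastforce
    next
      case (Cons y ys)
      obtain c2 where c2: "runs p' (enc (x, (y, ys))) (enc (f x y ys)) c2" "c2 \<le> T' (x, (y, ys))"
        using f(1)[of "(x, (y, ys))"] by auto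
      have r: "runs r (enc x) (Node (enc y) (enc ys)) c1" using c1(1) Cons by simp
      have p': "runs p' (Node (enc x) (Node (enc y) (enc ys))) (enc (f x y ys)) c2" using c2(1) by simp
      have "runs (SEQ (NODE ID r) (COND RIGHT p' (SEQ LEFT p))) (enc x) (enc (f x y ys))
        (1 + (1 + 1 + c1) + (1 + 1 + c2))"
        by (rule run_seq[OF run_node[OF run_id r] run_cond_true[OF run_right _ p']]) simp
      then show ?thesis using c1 c2 Cons by fastforce
    qed
  next
    show "polybounded \<mu> (\<lambda>x. 10 + U x + T x + T' (?h' x))"
      by (intro pbd_add pbd_const g a pbd_comp[OF f(2)] h'1 h'2)
    have *: "polybounded \<mu> (\<lambda>x. (\<lambda>x. sz (f (fst x) (fst (snd x)) (snd (snd x)))) (?h' x))"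
      by (rule pbd_comp[OF f(3)] h'1 h'2)+
    show "polybounded \<mu> (\<lambda>x. sz (case g x of [] \<Rightarrow> a x | y # ys \<Rightarrow> f x y ys))"
      by (rule pbd_le[OF pbd_add[OF a(3) *]]) (auto split: list.split)
  qed
qed

text \<open>
  A loop over a list works on trees \<open>((environment, accumulator), rest of the list)\<close>.
\<close>

definition fold_step :: "prog \<Rightarrow> prog" where
  "fold_step p = NODE (NODE (SEQ LEFT LEFT) (SEQ (NODE LEFT (SEQ RIGHT LEFT)) p)) (SEQ RIGHT RIGHT)"

lemma runs_fold_step:
  assumes "runs p (Node (Node e a) x) a' c"
  shows "runs (fold_step p) (Node (Node e a) (Node x xs)) (Node (Node e a') xs) (14 + c)"
proof -
  have "runs (fold_step p) (Node (Node e a) (Node x xs)) (Node (Node e a') xs)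
    (1 + (1 + (1 + 1 + 1) + (1 + (1 + 1 + (1 + 1 + 1)) + c)) + (1 + 1 + 1))"
    unfolding fold_step_def
    by (intro run_node run_seq[of LEFT _ "Node e a" 1 LEFT e 1]
        run_seq[of "NODE LEFT (SEQ RIGHT LEFT)" _ "Node (Node e a) x"]
        run_seq[of RIGHT _ "Node x xs" 1] assms run_left run_right)
  then show ?thesis by (simp add: eval_nat_numeral)
qed

lemma runs_foldl:
  assumes "\<And>a x. \<exists>c. runs p (Node (Node e (enc a)) (enc x)) (enc (f a x)) c \<and> c \<le> T a x"
    and "\<And>ys y zs. xs = ys @ y # zs \<Longrightarrow> T (foldl f a ys) y \<le> M"
  shows "\<exists>c. runs (LOOP RIGHT (fold_step p)) (Node (Node e (enc a)) (enc xs))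
     (Node (Node e (enc (foldl f a xs))) (Atom 0)) c \<and> c \<le> 2 + length xs * (16 + M)"
  using assms(2)
proof (induction xs arbitrary: a)
  case Nil
  have "runs (LOOP RIGHT (fold_step p)) (Node (Node e (enc a)) (Atom 0))
    (Node (Node e (enc a)) (Atom 0)) (1 + 1)"
    by (intro run_loop_exit run_right)
  then show ?case by auto
next
  case (Cons x xs)
  have "\<exists>c. runs (LOOP RIGHT (fold_step p)) (Node (Node e (enc (f a x))) (enc xs))
     (Node (Node e (enc (foldl f (f a x) xs))) (Atom 0)) c \<and> c \<le> 2 + length xs * (16 + M)"
  proof (rule Cons.IH)
    fix ys y zs assume "xs = ys @ y # zs"
    with Cons.prems[of "x # ys" y zs] show "T (foldl f (f a x) ys) y \<le> M" by simp
  qed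
  then obtain c where c: "runs (LOOP RIGHT (fold_step p)) (Node (Node e (enc (f a x))) (enc xs))
     (Node (Node e (enc (foldl f (f a x) xs))) (Atom 0)) c" "c \<le> 2 + length xs * (16 + M)" by blast
  obtain d where d: "runs p (Node (Node e (enc a)) (enc x)) (enc (f a x)) d" "d \<le> T a x"
    using assms(1) by blast
  have "T a x \<le> M" using Cons.prems[of "[]" x xs] by simp
  moreover have "runs (LOOP RIGHT (fold_step p)) (Node (Node e (enc a)) (Node (enc x) (enc xs)))
     (Node (Node e (enc (foldl f (f a x) xs))) (Atom 0)) (1 + 1 + (14 + d) + c)"
    by (rule run_loop_step[OF run_right _ runs_fold_step[OF d(1)] c(1)]) simp
  ultimately show ?case using c(2) d(2) by auto
qed

text \<open>
  The bound \<open>B\<close> on all intermediate accumulators cannot be dropped: iterating a polynomial time step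
  may square the size of the accumulator in every round.
\<close>

lemma pt_foldl:
  assumes xs: "polytime \<mu> xs" and a: "polytime \<mu> a"
    and f: "polytime (\<lambda>p. \<mu> (fst (fst p))) (\<lambda>p. f (fst (fst p)) (snd (fst p)) (snd p))"
    and bound: "\<And>e ys zs. xs e = ys @ zs \<Longrightarrow> sz (foldl (f e) (a e) ys) \<le> B e" "polybounded \<mu> B"
  shows "polytime \<mu> (\<lambda>e. foldl (f e) (a e) (xs e))"
proof -
  obtain p1 T1 where xs': "\<And>x. \<exists>c. runs p1 (enc x) (enc (xs x)) c \<and> c \<le> T1 x" "polybounded \<mu> T1"
    "polybounded \<mu> (\<lambda>x. sz (xs x))"
    using ptD[OF xs] by blast
  obtain p2 T2 where a': "\<And>x. \<exists>c. runs p2 (enc x) (enc (a x)) c \<and> c \<le> T2 x" "polybounded \<mu> T2"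
    "polybounded \<mu> (\<lambda>x. sz (a x))"
    using ptD[OF a] by blast
  obtain p3 T3 where f': "\<And>p. \<exists>c. runs p3 (enc p) (enc (f (fst (fst p)) (snd (fst p)) (snd p))) c \<and> c \<le> T3 p"
    "polybounded (\<lambda>p. \<mu> (fst (fst p))) T3"
    using ptD[OF f] by blast
  from f'(2) obtain q where q: "\<And>p. T3 p \<le> poly q (\<mu> (fst (fst p)) + sz p)" unfolding polybounded_def by blast
  let ?A = "\<lambda>e. \<mu> e + (2 + sz e + B e + sz (xs e))"
  let ?M = "\<lambda>e. poly q (?A e)"
  from pbd_add[OF pbd_measure pbd_add[OF pbd_add[OF pbd_add[OF pbd_const[of \<mu> 2] pbd_sz] bound(2)] xs'(3)]]
  obtain r where r: "\<And>e. ?A e \<le> poly r (\<mu> e + sz e)" unfolding polybounded_def by auto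
  have "?M e \<le> poly (pcompose q r) (\<mu> e + sz e)" for e
    using poly_nat_mono[OF r] by (simp add: poly_pcompose)
  then have M: "polybounded \<mu> ?M" unfolding polybounded_def by blast
  show ?thesis
  proof (rule ptI)
    fix e
    obtain c1 where c1: "runs p1 (enc e) (enc (xs e)) c1" "c1 \<le> T1 e" using xs'(1) by meson
    obtain c2 where c2: "runs p2 (enc e) (enc (a e)) c2" "c2 \<le> T2 e" using a'(1) by meson
    have "\<exists>c. runs (LOOP RIGHT (fold_step p3)) (Node (Node (enc e) (enc (a e))) (enc (xs e)))
     (Node (Node (enc e) (enc (foldl (f e) (a e) (xs e)))) (Atom 0)) c \<and> c \<le> 2 + length (xs e) * (16 + ?M e)"
    proof (rule runs_foldl)
      show "\<exists>c. runs p3 (Node (Node (enc e) (enc b)) (enc x)) (enc (f e b x)) c \<and> c \<le> T3 ((e, b), x)" for b x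
        using f'(1)[of "((e, b), x)"] by simp
      fix ys y zs assume eq: "xs e = ys @ y # zs"
      have 1: "sz (foldl (f e) (a e) ys) \<le> B e" using bound(1)[OF eq] .
      have "sz y \<le> sz (xs e)" unfolding eq by (simp add: sz_list)
      then have "\<mu> e + sz ((e, foldl (f e) (a e) ys), y) \<le> ?A e" using 1 by simp
      from le_trans[OF q[of "((e, foldl (f e) (a e) ys), y)"] poly_nat_mono] this
      show "T3 ((e, foldl (f e) (a e) ys), y) \<le> ?M e" by simp
    qed
    then obtain c where c: "runs (LOOP RIGHT (fold_step p3)) (Node (Node (enc e) (enc (a e))) (enc (xs e)))
     (Node (Node (enc e) (enc (foldl (f e) (a e) (xs e)))) (Atom 0)) c" "c \<le> 2 + length (xs e) * (16 + ?M e)"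
      by blast
    have "runs (SEQ (NODE (NODE ID p2) p1) (SEQ (LOOP RIGHT (fold_step p3)) (SEQ LEFT RIGHT))) (enc e)
      (enc (foldl (f e) (a e) (xs e))) (1 + (1 + (1 + 1 + c2) + c1) + (1 + c + (1 + 1 + 1)))"
      by (rule run_seq[OF run_node[OF run_node[OF run_id c2(1)] c1(1)]
            run_seq[OF c(1) run_seq[OF run_left run_right]]])
    with c1(2) c2(2) c(2)
    show "\<exists>c. runs (SEQ (NODE (NODE ID p2) p1) (SEQ (LOOP RIGHT (fold_step p3)) (SEQ LEFT RIGHT))) (enc e)
      (enc (foldl (f e) (a e) (xs e))) c \<and> c \<le> 10 + T1 e + T2 e + length (xs e) * (16 + ?M e)"
      by fastforce
  next
    show "polybounded \<mu> (\<lambda>e. 10 + T1 e + T2 e + length (xs e) * (16 + ?M e))"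
      by (intro pbd_add pbd_mult pbd_const xs' a' M pt_pbd_length[OF xs])
    show "polybounded \<mu> (\<lambda>e. sz (foldl (f e) (a e) (xs e)))"
      by (rule pbd_le[OF bound(2)]) (rule bound(1)[where zs = "[]"], simp)
  qed
qed

section \<open>List functions in polynomial time\<close>

lemma pt_app2:
  assumes "polytime (\<lambda>_. 0) (\<lambda>p. f (fst p) (snd p))" "polytime \<mu> g" "polytime \<mu> h"
  shows "polytime \<mu> (\<lambda>e. f (g e) (h e))"
  using pt_app[OF assms(1) pt_Pair[OF assms(2,3)]] by simp

lemma sz_append: "sz (xs @ ys) + 1 = sz xs + sz ys"
  by (induction xs) auto

lemma sz_rev: "sz (rev xs) = sz xs"
  by (simp add: sz_list rev_map[symmetric])

lemma sz_elem: "x \<in> set xs \<Longrightarrow> sz x < sz xs"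
  by (induction xs) auto

lemma foldl_rev_Cons: "foldl (\<lambda>a x. f x # a) a xs = rev (map f xs) @ a"
  by (induction xs arbitrary: a) auto

lemma pt_rev:
  assumes "polytime \<mu> xs"
  shows "polytime \<mu> (\<lambda>e. rev (xs e))"
proof -
  have "polytime \<mu> (\<lambda>e. foldl (\<lambda>a x. x # a) [] (xs e))"
  proof (rule pt_foldl[where B = "\<lambda>e. sz (xs e)"])
    show "sz (foldl (\<lambda>a x. x # a) [] ys) \<le> sz (xs e)" if "xs e = ys @ zs" for e ys zs
      using that sz_append[of ys zs] val_size_pos(2)[of "enc zs"]
      by (simp add: foldl_rev_Cons[of "\<lambda>x. x", simplified] sz_rev del: val_size_pos)
  qed (intro assms pt_const pt_Cons pt_fst pt_snd pt_id pt_pbd)+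
  then show ?thesis by (simp add: foldl_rev_Cons[of "\<lambda>x. x", simplified])
qed

lemma pt_append:
  assumes "polytime \<mu> xs" "polytime \<mu> ys"
  shows "polytime \<mu> (\<lambda>e. xs e @ ys e)"
proof -
  have "polytime \<mu> (\<lambda>e. foldl (\<lambda>a x. x # a) (ys e) (rev (xs e)))"
  proof (rule pt_foldl[where B = "\<lambda>e. sz (xs e) + sz (ys e)"])
    fix e us vs assume "rev (xs e) = us @ vs"
    then have "sz (xs e) = sz (us @ vs)" by (metis sz_rev)
    then show "sz (foldl (\<lambda>a x. x # a) (ys e) us) \<le> sz (xs e) + sz (ys e)"
      using sz_append[of us vs] sz_append[of "rev us" "ys e"] val_size_pos(2)[of "enc vs"]
      by (simp add: foldl_rev_Cons[of "\<lambda>x. x", simplified] sz_rev del: val_size_pos)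
  qed (intro assms pt_const pt_Cons pt_fst pt_snd pt_id pt_pbd pbd_add pt_rev)+
  then show ?thesis by (simp add: foldl_rev_Cons[of "\<lambda>x. x", simplified])
qed

lemma pbd_elem:
  assumes "polybounded (\<lambda>p. \<mu> (fst p)) g" "polybounded \<mu> (\<lambda>e. sz (xs e))"
  shows "\<exists>B. polybounded \<mu> B \<and> (\<forall>e. \<forall>x \<in> set (xs e). g (e, x) \<le> B e)"
proof -
  from assms(1) obtain q where q: "\<And>p. g p \<le> poly q (\<mu> (fst p) + sz p)" unfolding polybounded_def by blast
  let ?h = "\<lambda>e. \<mu> e + (1 + (sz e + sz (xs e)))"
  have "polybounded \<mu> ?h" by (intro pbd_add pbd_const pbd_measure pbd_sz assms)
  then obtain r where r: "\<And>e. ?h e \<le> poly r (\<mu> e + sz e)" unfolding polybounded_def by blast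
  have "poly q (?h e) \<le> poly (pcompose q r) (\<mu> e + sz e)" for e
    using poly_nat_mono[OF r] by (simp only: poly_pcompose)
  then have "polybounded \<mu> (\<lambda>e. poly q (?h e))" unfolding polybounded_def by blast
  moreover have "g (e, x) \<le> poly q (?h e)" if "x \<in> set (xs e)" for e x
    using sz_elem[OF that] by (intro le_trans[OF q poly_nat_mono]) simp
  ultimately show ?thesis by blast
qed

lemma sz_le_length: "(\<And>x. x \<in> set xs \<Longrightarrow> sz x \<le> M) \<Longrightarrow> sz xs \<le> 1 + length xs * (1 + M)"
proof (induction xs)
  case (Cons x xs)
  then have "sz xs \<le> 1 + length xs * (1 + M)" "sz x \<le> M" by simp_all
  then show ?case by simp
qed simp

lemma pt_map:
  fixes xs :: "'e :: enc \<Rightarrow> 'b :: enc list" and f :: "'e \<Rightarrow> 'b \<Rightarrow> 'c :: enc"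
  assumes "polytime \<mu> xs" "polytime (\<lambda>p. \<mu> (fst p)) (\<lambda>p. f (fst p) (snd p))"
  shows "polytime \<mu> (\<lambda>e. map (f e) (xs e))"
proof -
  from pbd_elem[OF pt_pbd[OF assms(2)] pt_pbd[OF assms(1)]] obtain B
    where B: "polybounded \<mu> B" "\<And>e x. x \<in> set (xs e) \<Longrightarrow> sz (f e x) \<le> B e" by auto
  have "polytime \<mu> (\<lambda>e. foldl (\<lambda>a x. f e x # a) [] (xs e))"
  proof (rule pt_foldl[where B = "\<lambda>e. 1 + length (xs e) * (1 + B e)"])
    have "polytime (\<lambda>p. \<mu> (fst (fst p))) (\<lambda>p :: ('e \<times> 'c list) \<times> 'b. f (fst (fst p)) (snd p))"
      using pt_comp[OF assms(2), of "\<lambda>p. \<mu> (fst (fst p))" "\<lambda>p. (fst (fst p), snd p)"]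
      by (simp add: pt_fst pt_snd pt_id pt_Pair pbd_measure)
    then show "polytime (\<lambda>p. \<mu> (fst (fst p))) (\<lambda>p. f (fst (fst p)) (snd p) # snd (fst p))"
      by (intro pt_Cons pt_fst pt_snd pt_id)
    fix e us vs assume us: "xs e = us @ vs"
    then have "sz y \<le> B e" if "y \<in> set (rev (map (f e) us))" for y using that B(2) by auto
    then have "sz (rev (map (f e) us)) \<le> 1 + length (rev (map (f e) us)) * (1 + B e)" by (rule sz_le_length)
    then have "sz (rev (map (f e) us)) \<le> 1 + length us * (1 + B e)" by simp
    also have "\<dots> \<le> 1 + length (xs e) * (1 + B e)" unfolding us by (simp add: add_mult_distrib)
    finally show "sz (foldl (\<lambda>a x. f e x # a) [] us) \<le> 1 + length (xs e) * (1 + B e)"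
      by (simp add: foldl_rev_Cons)
  qed (intro assms pt_const pbd_add pbd_mult pbd_const pt_pbd_length B)+
  from pt_rev[OF this] show ?thesis by (simp add: foldl_rev_Cons)
qed

lemma sz_concat: "sz (concat xss) \<le> sz xss"
proof (induction xss)
  case (Cons xs xss)
  then show ?case using sz_append[of xs "concat xss"] by simp
qed simp

lemma pt_concat:
  assumes "polytime \<mu> xss"
  shows "polytime \<mu> (\<lambda>e. concat (xss e))"
proof -
  have eq: "foldl (@) a xss = a @ concat xss" for a :: "'c list" and xss
    by (induction xss arbitrary: a) auto
  have "polytime \<mu> (\<lambda>e. foldl (@) [] (xss e))"
  proof (rule pt_foldl[where B = "\<lambda>e. sz (xss e)"])
    fix e us vs assume "xss e = us @ vs"
    then show "sz (foldl (@) [] us) \<le> sz (xss e)"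
      using le_trans[OF sz_concat[of us], of "sz (xss e)"] by (simp add: eq sz_list)
  qed (intro assms pt_const pt_append pt_fst pt_snd pt_id pt_pbd)+
  then show ?thesis by (simp add: eq)
qed

lemma pt_filter:
  assumes "polytime \<mu> xs" "polytime (\<lambda>p. \<mu> (fst p)) (\<lambda>p. P (fst p) (snd p))"
  shows "polytime \<mu> (\<lambda>e. filter (P e) (xs e))"
proof -
  have eq: "concat (map (\<lambda>x. if Q x then [x] else []) ys) = filter Q ys" for Q :: "'b \<Rightarrow> bool" and ys
    by (induction ys) auto
  have "polytime \<mu> (\<lambda>e. concat (map (\<lambda>x. if P e x then [x] else []) (xs e)))"
    by (intro pt_concat pt_map pt_if assms pt_Cons pt_const pt_snd pt_id)
  then show ?thesis unfolding eq .
qed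

lemma pt_is_Nil:
  assumes "polytime \<mu> xs"
  shows "polytime \<mu> (\<lambda>e. xs e = [])"
  by (rule back_subst[of "polytime \<mu>", OF pt_case_list[OF assms pt_const[of _ True] pt_const[of _ False]]])
    (simp add: fun_eq_iff split: list.split)

lemma pt_length:
  assumes "polytime \<mu> xs"
  shows "polytime \<mu> (\<lambda>e. length (xs e))"
proof -
  have eq: "foldl (\<lambda>a x. Suc a) a ys = a + length ys" for a and ys :: "'c list"
    by (induction ys arbitrary: a) auto
  have "polytime \<mu> (\<lambda>e. foldl (\<lambda>a x. Suc a) 0 (xs e))"
  proof (rule pt_foldl[where B = "\<lambda>e. Suc (Suc (length (xs e)))"])
    fix e us vs assume "xs e = us @ vs"
    then show "sz (foldl (\<lambda>a x. Suc a) 0 us) \<le> Suc (Suc (length (xs e)))"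
      using bits_le_Suc[of "length us"] by (simp add: eq)
  qed (intro assms pt_const pt_Suc pt_fst pt_snd pt_id pbd_Suc pt_pbd_length)+
  then show ?thesis by (simp add: eq)
qed

lemma bits_sum_list: "bits (sum_list ns) \<le> sz ns"
proof (induction ns)
  case (Cons n ns)
  then show ?case using bits_add[of n "sum_list ns"] by simp
qed simp

lemma bits_prod_list: "bits (prod_list ns) \<le> 1 + sz ns"
proof (induction ns)
  case (Cons n ns)
  then show ?case using bits_mult[of n "prod_list ns"] by simp
qed (simp add: bits_Suc_0)

lemma pt_sum_list:
  fixes xs :: "'e :: enc \<Rightarrow> nat list"
  assumes "polytime \<mu> xs"
  shows "polytime \<mu> (\<lambda>e. sum_list (xs e))"
proof -
  have eq: "foldl (+) a ys = a + sum_list ys" for a and ys :: "nat list"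
    by (induction ys arbitrary: a) auto
  have "polytime \<mu> (\<lambda>e. foldl (+) 0 (xs e))"
  proof (rule pt_foldl[where B = "\<lambda>e. sz (xs e)"])
    fix e us vs assume "xs e = us @ vs"
    then show "sz (foldl (+) 0 us) \<le> sz (xs e)"
      using le_trans[OF bits_sum_list[of us], of "sz (xs e)"] by (simp add: eq sz_list)
  qed (intro assms pt_const pt_plus pt_fst pt_snd pt_id pt_pbd)+
  then show ?thesis by (simp add: eq)
qed

lemma pt_prod_list:
  fixes xs :: "'e :: enc \<Rightarrow> nat list"
  assumes "polytime \<mu> xs"
  shows "polytime \<mu> (\<lambda>e. prod_list (xs e))"
proof -
  have eq: "foldl (*) a ys = a * prod_list ys" for a and ys :: "nat list"
    by (induction ys arbitrary: a) auto
  have "polytime \<mu> (\<lambda>e. foldl (*) 1 (xs e))"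
  proof (rule pt_foldl[where B = "\<lambda>e. 1 + sz (xs e)"])
    fix e us vs assume "xs e = us @ vs"
    then show "sz (foldl (*) 1 us) \<le> 1 + sz (xs e)"
      using le_trans[OF bits_prod_list[of us], of "1 + sz (xs e)"] by (simp add: eq sz_list)
  qed (intro assms pt_const pt_times pt_fst pt_snd pt_id pbd_add pbd_const pt_pbd)+
  then show ?thesis by (simp add: eq)
qed

text \<open>
  The accumulator holds what remains of the second list and the reversed result.
\<close>

definition zip_step :: "'b list \<times> ('a \<times> 'b) list \<Rightarrow> 'a \<Rightarrow> 'b list \<times> ('a \<times> 'b) list" where
  "zip_step s x = (case fst s of [] \<Rightarrow> s | y # ys \<Rightarrow> (ys, (x, y) # snd s))"

lemma zip_step_simps [simp]:
  "zip_step ([], out) x = ([], out)" "zip_step (y # ys, out) x = (ys, (x, y) # out)"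
  by (simp_all add: zip_step_def)

lemma foldl_zip_step_Nil: "foldl zip_step ([], out) xs = ([], out)"
  by (induction xs) simp_all

lemma foldl_zip_step: "foldl zip_step (ys, out) xs = (drop (length xs) ys, rev (zip xs ys) @ out)"
proof (induction xs arbitrary: ys out)
  case (Cons x xs)
  show ?case by (cases ys) (simp_all add: foldl_zip_step_Nil Cons)
qed simp

lemma sz_zip: "sz (zip xs ys) \<le> sz xs + sz ys"
proof (induction xs ys rule: list_induct2')
qed simp_all

lemma sz_drop: "sz (drop n xs) \<le> sz xs"
  using sz_append[of "take n xs" "drop n xs"] val_size_pos(2)[of "enc (take n xs)"]
  by (simp del: val_size_pos)

lemma pt_zip:
  fixes xs :: "'e :: enc \<Rightarrow> 'b :: enc list" and ys :: "'e \<Rightarrow> 'c :: enc list"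
  assumes "polytime \<mu> xs" "polytime \<mu> ys"
  shows "polytime \<mu> (\<lambda>e. zip (xs e) (ys e))"
proof -
  have "polytime \<mu> (\<lambda>e. foldl zip_step (ys e, []) (xs e))"
  proof (rule pt_foldl[where B = "\<lambda>e. 1 + (sz (ys e) + (sz (xs e) + sz (ys e)))"])
    fix e us vs assume "xs e = us @ vs"
    then have "sz us \<le> sz (xs e)" by (simp add: sz_list)
    then show "sz (foldl zip_step (ys e, []) us) \<le> 1 + (sz (ys e) + (sz (xs e) + sz (ys e)))"
      using sz_zip[of us "ys e"] sz_drop[of "length us" "ys e"] by (simp add: foldl_zip_step sz_rev)
  next
    show "polytime (\<lambda>p. \<mu> (fst (fst p))) (\<lambda>p :: ('e \<times> 'c list \<times> ('b \<times> 'c) list) \<times> 'b. zip_step (snd (fst p)) (snd p))"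
      unfolding zip_step_def
      by (intro pt_case_list pt_fst pt_snd pt_id pt_Pair pt_Cons)
  qed (intro assms pt_const pt_Pair pbd_add pbd_const pt_pbd)+
  from pt_rev[OF pt_snd[OF this]] show ?thesis by (simp add: foldl_zip_step)
qed

lemma runs_upt:
  "\<exists>c. runs (LOOP LEFT (SEQ (NODE (SEQ (NODE LEFT (LIT 1)) (ARITH Minus)) RIGHT) (NODE LEFT ID)))
     (Node (Atom n) (enc a)) (Node (Atom 0) (enc ([0..<n] @ a))) c \<and> c \<le> 2 + n * (n + 20)"
proof (induction n arbitrary: a)
  case 0
  have "runs (LOOP LEFT (SEQ (NODE (SEQ (NODE LEFT (LIT 1)) (ARITH Minus)) RIGHT) (NODE LEFT ID)))
     (Node (Atom 0) (enc a)) (Node (Atom 0) (enc a)) (1 + 1)"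
    by (intro run_loop_exit run_left)
  then show ?case by auto
next
  case (Suc n)
  from Suc[of "n # a"] obtain c where
    c: "runs (LOOP LEFT (SEQ (NODE (SEQ (NODE LEFT (LIT 1)) (ARITH Minus)) RIGHT) (NODE LEFT ID)))
     (Node (Atom n) (enc (n # a))) (Node (Atom 0) (enc ([0..<Suc n] @ a))) c" "c \<le> 2 + n * (n + 20)" by auto
  let ?p = "SEQ (NODE (SEQ (NODE LEFT (LIT 1)) (ARITH Minus)) RIGHT) (NODE LEFT ID)"
  have 1: "runs (SEQ (NODE LEFT (LIT 1)) (ARITH Minus)) (Node (Atom (Suc n)) (enc a)) (Atom n)
    (1 + (1 + 1 + 1) + (1 + bits (Suc n) + bits 1))"
    using run_seq[OF run_node[OF run_left run_lit] run_arith[of Minus "Suc n" 1]] by simp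
  have "runs ?p (Node (Atom (Suc n)) (enc a)) (Node (Atom n) (enc (n # a)))
    (1 + (1 + (1 + (1 + 1 + 1) + (1 + bits (Suc n) + bits 1)) + 1) + (1 + 1 + 1))"
    using run_seq[OF run_node[OF 1 run_right] run_node[OF run_left run_id]] by simp
  from run_loop_step[OF run_left _ this c(1)]
  have R: "runs (LOOP LEFT ?p) (Node (Atom (Suc n)) (enc a)) (Node (Atom 0) (enc ([0..<Suc n] @ a)))
    (1 + 1 + (1 + (1 + (1 + (1 + 1 + 1) + (1 + bits (Suc n) + bits 1)) + 1) + (1 + 1 + 1)) + c)"
    by simp
  show ?case
    by (rule exI, rule conjI[OF R]) (use c(2) bits_le_Suc[of "Suc n"] in \<open>simp add: bits_Suc_0 algebra_simps\<close>)
qed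

text \<open>
  Counting up to \<open>n\<close> is exponential in the number of bits of \<open>n\<close>, so \<open>n\<close> itself must be bounded. This
  is the only construction whose time depends on the magnitude of a number.
\<close>

lemma pt_upt:
  assumes "polytime \<mu> n" "polybounded \<mu> n"
  shows "polytime \<mu> (\<lambda>e. [0..<n e])"
proof -
  obtain p T where f: "\<And>x. \<exists>c. runs p (enc x) (enc (n x)) c \<and> c \<le> T x" "polybounded \<mu> T"
    using ptD[OF assms(1)] by blast
  let ?l = "LOOP LEFT (SEQ (NODE (SEQ (NODE LEFT (LIT 1)) (ARITH Minus)) RIGHT) (NODE LEFT ID))"
  show ?thesis
  proof (rule ptI)
    fix x
    obtain c1 where c1: "runs p (enc x) (Atom (n x)) c1" "c1 \<le> T x" using f(1)[of x] by auto
    obtain c2 where c2: "runs ?l (Node (Atom (n x)) (Atom 0)) (Node (Atom 0) (enc [0..<n x])) c2"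
      "c2 \<le> 2 + n x * (n x + 20)" using runs_upt[of "n x" "[] :: nat list"] by auto
    have R: "runs (SEQ (NODE p (LIT 0)) (SEQ ?l RIGHT)) (enc x) (enc [0..<n x])
      (1 + (1 + c1 + 1) + (1 + c2 + 1))"
      by (rule run_seq[OF run_node[OF c1(1) run_lit] run_seq[OF c2(1) run_right]])
    show "\<exists>c. runs (SEQ (NODE p (LIT 0)) (SEQ ?l RIGHT)) (enc x) (enc [0..<n x]) c
      \<and> c \<le> 10 + T x + n x * (n x + 20)"
      by (rule exI, rule conjI[OF R]) (use c1(2) c2(2) in simp)
  next
    show "polybounded \<mu> (\<lambda>x. 10 + T x + n x * (n x + 20))"
      by (intro pbd_add pbd_mult pbd_const f assms)
    have sz: "sz [0..<n x] \<le> 1 + length [0..<n x] * (1 + Suc (Suc (n x)))" for x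
    proof (rule sz_le_length)
      fix i assume "i \<in> set [0..<n x]"
      then show "sz i \<le> Suc (Suc (n x))" using bits_le_Suc[of i] by simp
    qed
    show "polybounded \<mu> (\<lambda>x. sz [0..<n x])"
      by (rule pbd_le[OF _ sz], unfold length_upt diff_zero) (intro pbd_add pbd_mult pbd_Suc pbd_const assms)
  qed
qed

lemma pt_enumerate:
  assumes "polytime \<mu> xs"
  shows "polytime \<mu> (\<lambda>e. List.enumerate 0 (xs e))"
  unfolding enumerate_eq_zip add_0 by (intro pt_zip pt_upt pt_length pt_pbd_length assms)

lemma pt_eq_list:
  fixes f g :: "'e :: enc \<Rightarrow> nat list"
  assumes "polytime \<mu> f" "polytime \<mu> g"
  shows "polytime \<mu> (\<lambda>e. f e = g e)"
proof -
  have eq: "(length xs = length ys \<and> filter (\<lambda>p. \<not> fst p = snd p) (zip xs ys) = []) \<longleftrightarrow> xs = ys"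
    for xs ys :: "nat list"
    unfolding list_eq_iff_zip_eq[of xs ys] filter_empty_conv by auto
  have "polytime \<mu> (\<lambda>e. length (f e) = length (g e) \<and> filter (\<lambda>p. \<not> fst p = snd p) (zip (f e) (g e)) = [])"
    by (intro pt_conj pt_eq_nat pt_length pt_is_Nil pt_filter pt_zip pt_not pt_fst pt_snd pt_id assms)
  then show ?thesis unfolding eq .
qed

fun prefix_sums :: "nat \<Rightarrow> (nat \<times> 'a) list \<Rightarrow> (nat \<times> nat \<times> 'a) list" where
  "prefix_sums b [] = []"
| "prefix_sums b (x # xs) = (b, x) # prefix_sums (b + fst x) xs"

lemma foldl_prefix_sums:
  "foldl (\<lambda>s x. (fst s + fst x, (fst s, x) # snd s)) (b, out) xs
   = (b + sum_list (map fst xs), rev (prefix_sums b xs) @ out)"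
  by (induction xs arbitrary: b out) auto

lemma sz_prefix_sums: "sz (prefix_sums b xs) \<le> sz xs + length xs * (1 + bits b + sz xs)"
proof (induction xs arbitrary: b)
  case (Cons x xs)
  have "bits (b + fst x) + sz xs \<le> bits b + sz (x # xs)"
    using bits_add[of b "fst x"] by simp
  then have "length xs * (1 + bits (b + fst x) + sz xs) \<le> length xs * (1 + bits b + sz (x # xs))"
    by (intro mult_le_mono2) simp
  then show ?case using Cons[of "b + fst x"] by simp
qed simp

lemma pt_prefix_sums:
  fixes xs :: "'e :: enc \<Rightarrow> (nat \<times> 'b :: enc) list"
  assumes "polytime \<mu> xs"
  shows "polytime \<mu> (\<lambda>e. prefix_sums 0 (xs e))"
proof -
  have "polytime \<mu> (\<lambda>e. foldl (\<lambda>s x. (fst s + fst x, (fst s, x) # snd s)) (0, []) (xs e))"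
  proof (rule pt_foldl[where B = "\<lambda>e. 2 + sz (xs e) + (sz (xs e) + length (xs e) * (2 + sz (xs e)))"])
    fix e us vs assume us: "xs e = us @ vs"
    have "sz (map fst us) \<le> sz us" by (induction us) auto
    then have 1: "bits (sum_list (map fst us)) \<le> sz us" using bits_sum_list le_trans by blast
    have 2: "sz us \<le> sz (xs e)" "length us \<le> length (xs e)" using us by (simp_all add: sz_list)
    have 3: "length us * (2 + sz us) \<le> length (xs e) * (2 + sz (xs e))" using 2 by (intro mult_le_mono) auto
    show "sz (foldl (\<lambda>s x. (fst s + fst x, (fst s, x) # snd s)) (0, []) us)
      \<le> 2 + sz (xs e) + (sz (xs e) + length (xs e) * (2 + sz (xs e)))"
      using 1 2 3 sz_prefix_sums[of 0 us] by (simp add: foldl_prefix_sums sz_rev)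
  qed (intro assms pt_const pt_Pair pt_Cons pt_plus pt_fst pt_snd pt_id pbd_add pbd_mult pbd_const pt_pbd pt_pbd_length)+
  from pt_rev[OF pt_snd[OF this]] show ?thesis by (simp add: foldl_prefix_sums)
qed

definition best_step :: "('a \<Rightarrow> 'a \<Rightarrow> bool) \<Rightarrow> 'a list \<Rightarrow> 'a \<Rightarrow> 'a list" where
  "best_step lt acc x = (case acc of [] \<Rightarrow> [x] | b # _ \<Rightarrow> if lt x b then [x] else acc)"

text \<open>
  The result has at most one element; it is empty only for the empty list.
\<close>

definition best :: "('a \<Rightarrow> 'a \<Rightarrow> bool) \<Rightarrow> 'a list \<Rightarrow> 'a list" where
  "best lt xs = foldl (best_step lt) [] xs"

lemma best_cases: "best lt xs = [] \<and> xs = [] \<or> (\<exists>x \<in> set xs. best lt xs = [x])"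
proof (induction xs rule: rev_induct)
  case (snoc x xs)
  have "best lt (xs @ [x]) = best_step lt (best lt xs) x" by (simp add: best_def)
  with snoc show ?case by (elim disjE conjE bexE) (simp_all add: best_step_def)
qed (simp add: best_def)

lemma pt_best:
  fixes xs :: "'e :: enc \<Rightarrow> 'b :: enc list"
  assumes "polytime \<mu> xs" "polytime (\<lambda>_. 0) (\<lambda>p. lt (fst p) (snd p))"
  shows "polytime \<mu> (\<lambda>e. best lt (xs e))"
  unfolding best_def
proof (rule pt_foldl[where B = "\<lambda>e. 2 + sz (xs e)"])
  fix e us vs assume us: "xs e = us @ vs"
  show "sz (foldl (best_step lt) [] us) \<le> 2 + sz (xs e)"
    using best_cases[of lt us] sz_elem[of _ "xs e"] us
    by (force simp: best_def[symmetric])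
next
  show "polytime (\<lambda>p. \<mu> (fst (fst p))) (\<lambda>p :: ('e \<times> 'b list) \<times> 'b. best_step lt (snd (fst p)) (snd p))"
    unfolding best_step_def
    by (intro pt_case_list pt_if pt_app2[OF assms(2)] pt_fst pt_snd pt_id pt_Cons pt_const)
qed (intro assms pt_const pbd_add pbd_const pt_pbd)+

section \<open>The algorithm and its running time\<close>

lemma pt_app3:
  assumes "polytime (\<lambda>_. 0) (\<lambda>p. f (fst p) (fst (snd p)) (snd (snd p)))" "polytime \<mu> g" "polytime \<mu> h" "polytime \<mu> k"
  shows "polytime \<mu> (\<lambda>e. f (g e) (h e) (k e))"
  using pt_app[OF assms(1) pt_Pair[OF assms(2) pt_Pair[OF assms(3,4)]]] by simp

lemma pt_enc:
  assumes "polytime \<mu> f"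
  shows "polytime \<mu> (\<lambda>e. enc (f e))"
  using assms unfolding polytime_def enc_val_def .

text \<open>
  Used as introduction rules, these facts follow the syntax of a function, so a running time proof
  for a nonrecursive definition is a single call of \<open>intro\<close>.
\<close>

lemmas pt_intros = pt_const pt_id pt_fst pt_snd pt_Pair pt_Cons pt_plus pt_minus pt_times pt_div pt_Suc
  pt_if pt_less pt_le pt_eq_nat pt_not pt_conj pt_let pt_case_list pt_rev pt_append pt_map pt_concat
  pt_filter pt_is_Nil pt_length pt_sum_list pt_prod_list pt_zip pt_enumerate pt_eq_list pt_prefix_sums

type_synonym perimeter_data = "((nat \<times> nat) \<times> (nat \<times> nat)) list"

definition denominators :: "perimeter_data list \<Rightarrow> nat list" where
  "denominators ps = concat (map (\<lambda>xs. concat (map (\<lambda>x. [snd (fst x), snd (snd x)]) xs)) ps)"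

definition scaled :: "nat \<Rightarrow> perimeter_data list \<Rightarrow> (nat \<times> nat) list list" where
  "scaled Q ps = map (\<lambda>xs. map (\<lambda>x. (fst (fst x) * Q div snd (fst x), fst (snd x) * Q div snd (snd x))) xs) ps"

text \<open>
  The perimeter is traversed twice, so that runs across the base point have increasing indices.
\<close>

definition spans :: "(nat \<times> nat) list \<Rightarrow> (nat \<times> nat \<times> nat \<times> nat) list" where
  "spans xs = List.enumerate 0 (prefix_sums 0 (map (\<lambda>x. (fst x + snd x, fst x)) (xs @ xs)))"

text \<open>
  A hop is a run of segments of one boundary: region, rotation, index of the first and of the last
  segment, number \<open>q\<close> of segments of the region, position and length of the run. The runs
  of a region with rotation \<open>r\<close> exhaust the indices from \<open>r\<close> to \<open>r + q - 1\<close> of the doubled perimeter.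
\<close>
type_synonym hop = "nat \<times> nat \<times> nat \<times> nat \<times> nat \<times> nat \<times> nat"

definition hop_list :: "nat \<Rightarrow> (nat \<times> nat) list \<Rightarrow> hop list" where
  "hop_list i xs = concat (map (\<lambda>r. concat (map (\<lambda>a. concat (map (\<lambda>b.
      if r \<le> fst a \<and> fst a \<le> fst b \<and> fst b < r + length xs
      then [(i, r, fst a, fst b, length xs, fst (snd a), fst (snd b) + snd (snd (snd b)) - fst (snd a))]
      else []) (spans xs))) (spans xs))) [0..<Suc (length xs)])"

definition hops :: "(nat \<times> nat) list list \<Rightarrow> hop list" where
  "hops ps = concat (map (\<lambda>p. hop_list (fst p) (snd p)) (List.enumerate 0 ps))"

definition "hop_region (h :: hop) = fst h"
definition "hop_rot (h :: hop) = fst (snd h)"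
definition "hop_first (h :: hop) = fst (snd (snd h))"
definition "hop_last (h :: hop) = fst (snd (snd (snd h)))"
definition "hop_count (h :: hop) = fst (snd (snd (snd (snd h))))"
definition "hop_start (h :: hop) = fst (snd (snd (snd (snd (snd h)))))"
definition "hop_len (h :: hop) = snd (snd (snd (snd (snd (snd h)))))"

text \<open>
  Between two regions no rotation is chosen yet; these states are \<open>[i, 0, 0]\<close>. Inside a region the
  rotation is stored as its successor, which keeps the two kinds of states apart.
\<close>

definition hop_src :: "hop \<Rightarrow> nat list" where
  "hop_src h = (if hop_first h = hop_rot h then [hop_region h, 0, 0]
     else [hop_region h, Suc (hop_rot h), hop_first h])"

definition hop_dst :: "hop \<Rightarrow> nat list" where
  "hop_dst h = (if Suc (hop_last h) = hop_rot h + hop_count h then [Suc (hop_region h), 0, 0]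
     else [hop_region h, Suc (hop_rot h), Suc (hop_last h)])"

text \<open>
  The list \<open>U\<close> supplies the numbers up to the robot counts. Inside a loop over the types nothing bounds
  a single count, hence \<open>U\<close> is computed once from the whole input.
\<close>

definition vectors :: "nat list \<Rightarrow> (nat \<times> nat) list \<Rightarrow> nat list list" where
  "vectors U ts = foldl (\<lambda>V p. concat (map (\<lambda>x. map (\<lambda>v. v @ [x]) V) (filter (\<lambda>x. x \<le> fst p) U))) [[]] ts"

definition below :: "nat list \<Rightarrow> nat list \<Rightarrow> bool" where
  "below u v \<longleftrightarrow> filter (\<lambda>p. \<not> fst p \<le> snd p) (zip u v) = []"

definition capacity :: "(nat \<times> nat) list \<Rightarrow> nat list \<Rightarrow> nat list \<Rightarrow> nat" where
  "capacity ts u v = sum_list (map (\<lambda>p. (snd (snd p) - fst (snd p)) * snd (fst p)) (zip ts (zip u v)))"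

type_synonym move = "hop \<times> (nat list \<times> nat list) \<times> nat"

definition "mv_hop (e :: move) = fst e"
definition "mv_before (e :: move) = fst (fst (snd e))"
definition "mv_after (e :: move) = snd (fst (snd e))"
definition "mv_cap (e :: move) = snd (snd e)"

text \<open>
  A positive capability means that the group is nonempty: runs of length 0 need a robot, too.
\<close>

definition moves :: "hop list \<Rightarrow> nat list list \<Rightarrow> (nat \<times> nat) list \<Rightarrow> move list" where
  "moves H V ts = concat (map (\<lambda>h. concat (map (\<lambda>u. concat (map (\<lambda>v.
     if below u v \<and> 0 < capacity ts u v then [(h, (u, v), capacity ts u v)] else []) V)) V)) H)"

definition frac_less :: "nat \<times> nat \<Rightarrow> nat \<times> nat \<Rightarrow> bool" where
  "frac_less x y \<longleftrightarrow> fst x * snd y < fst y * snd x"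

definition mv_weight :: "move \<Rightarrow> nat \<times> nat" where
  "mv_weight e = (hop_len (mv_hop e), mv_cap e)"

text \<open>
  Weights are nonnegative, so the initial value 0 does not change the maximum of a nonempty path.
\<close>

definition bottleneck :: "move list \<Rightarrow> nat \<times> nat" where
  "bottleneck P = foldl (\<lambda>m e. if frac_less m (mv_weight e) then mv_weight e else m) (0, 1) P"

definition path_less :: "move list \<Rightarrow> move list \<Rightarrow> bool" where
  "path_less P P' \<longleftrightarrow> frac_less (bottleneck P) (bottleneck P')"

definition fits :: "nat list \<Rightarrow> move \<Rightarrow> move list \<Rightarrow> bool" where
  "fits z e P = (case P of
       [] \<Rightarrow> hop_src (mv_hop e) = [0, 0, 0] \<and> mv_before e = z
     | e' # _ \<Rightarrow> hop_src (mv_hop e) = hop_dst (mv_hop e') \<and> mv_before e = mv_after e')"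

text \<open>
  Paths are lists with the last move first. For every last move one best path is kept. The empty path
  takes part in each round, so that after \<open>k\<close> rounds all lengths up to \<open>k\<close> have been considered.
\<close>

definition extend :: "move list \<Rightarrow> nat list \<Rightarrow> move list list \<Rightarrow> move list list" where
  "extend E z T = concat (map (\<lambda>e. map (\<lambda>P. e # P) (best path_less (filter (\<lambda>P. fits z e P) ([] # T)))) E)"

definition best_paths :: "move list \<Rightarrow> nat list \<Rightarrow> 'a list \<Rightarrow> move list list" where
  "best_paths E z R = foldl (\<lambda>T _. extend E z T) [] R"

definition finished :: "nat \<Rightarrow> nat list \<Rightarrow> move list \<Rightarrow> bool" where
  "finished m N P = (case P of [] \<Rightarrow> False | e # _ \<Rightarrow> hop_dst (mv_hop e) = [m, 0, 0] \<and> mv_after e = N)"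

text \<open>A robot is given by its type, its index within the type and its capability.\<close>

type_synonym robot = "nat \<times> nat \<times> nat"

definition robots :: "nat list \<Rightarrow> (nat \<times> nat) list \<Rightarrow> robot list" where
  "robots U ts = concat (map (\<lambda>p. map (\<lambda>x. (fst p, x, snd (snd p))) (filter (\<lambda>x. x < fst (snd p)) U))
     (List.enumerate 0 ts))"

text \<open>
  The robots of a type are used in the order of their indices, so a move that leads from \<open>u\<close> to \<open>v\<close>
  employs those of type \<open>k\<close> with index from \<open>u ! k\<close> up to \<open>v ! k - 1\<close>.
\<close>

definition crew :: "robot list \<Rightarrow> move \<Rightarrow> robot list" where
  "crew R e = concat (map (\<lambda>p. filter (\<lambda>\<rho>. fst \<rho> = fst p \<and> fst (snd p) \<le> fst (snd \<rho>) \<and> fst (snd \<rho>) < snd (snd p)) R)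
     (List.enumerate 0 (zip (mv_before e) (mv_after e))))"

type_synonym arc_data = "nat \<times> (nat \<times> nat) \<times> (nat \<times> nat)"

text \<open>
  A crew of capability \<open>A\<close> shares a run of length \<open>D\<close>: if the robots before it have capability \<open>p\<close>,
  a robot of capability \<open>a\<close> gets the arc from \<open>D p / A\<close> to \<open>D (p + a) / A\<close> of the run. The common
  denominator \<open>Q\<close> is divided out again.
\<close>

definition placements :: "nat \<Rightarrow> robot list \<Rightarrow> move \<Rightarrow> ((nat \<times> nat) \<times> arc_data) list" where
  "placements Q R e = map (\<lambda>c. (snd (snd c), (hop_region (mv_hop e),
       ((hop_start (mv_hop e) * mv_cap e + hop_len (mv_hop e) * fst c, mv_cap e * Q),
        (hop_len (mv_hop e) * fst (snd c), mv_cap e * Q)))))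
     (prefix_sums 0 (map (\<lambda>\<rho>. (snd (snd \<rho>), (fst \<rho>, fst (snd \<rho>)))) (crew R e)))"

definition arcs_of_path :: "nat \<Rightarrow> robot list \<Rightarrow> move list \<Rightarrow> arc_data list" where
  "arcs_of_path Q R P = (let A = concat (map (\<lambda>e. placements Q R e) (rev P)) in
     concat (map (\<lambda>\<rho>. concat (map (\<lambda>c. if fst (fst c) = fst \<rho> \<and> snd (fst c) = fst (snd \<rho>) then [snd c] else []) A)) R))"

text \<open>
  The number of vectors of robots used so far. It exceeds every single robot count.
\<close>

definition size_param :: "perimeter_data list \<times> (nat \<times> nat) list \<Rightarrow> nat" where
  "size_param d = prod_list (map (\<lambda>p. Suc (fst p)) (snd d))"

definition best_complete_path ::
  "nat list \<Rightarrow> nat \<Rightarrow> perimeter_data list \<times> (nat \<times> nat) list \<Rightarrow> move list list" where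
  "best_complete_path U Q d =
     best path_less (filter (\<lambda>P. finished (length (fst d)) (map fst (snd d)) P)
       (best_paths (moves (hops (scaled Q (fst d))) (vectors U (snd d)) (snd d)) (map (\<lambda>_. 0) (snd d))
          (robots U (snd d))))"

definition solve :: "perimeter_data list \<times> (nat \<times> nat) list \<Rightarrow> val" where
  "solve d = (let U = [0..<size_param d]; Q = prod_list (denominators (fst d)) in
     case best_complete_path U Q d of
       [] \<Rightarrow> Atom 0
     | P # _ \<Rightarrow> enc ((fst (bottleneck P), snd (bottleneck P) * Q), arcs_of_path Q (robots U (snd d)) P))"

lemma pt_denominators: "polytime \<mu> f \<Longrightarrow> polytime \<mu> (\<lambda>e. denominators (f e))"
  by (erule pt_app[rotated], unfold denominators_def) (intro pt_intros)

lemma pt_scaled: "polytime \<mu> f \<Longrightarrow> polytime \<mu> g \<Longrightarrow> polytime \<mu> (\<lambda>e. scaled (f e) (g e))"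
  by (erule (1) pt_app2[rotated], unfold scaled_def) (intro pt_intros)

lemma pt_spans: "polytime \<mu> f \<Longrightarrow> polytime \<mu> (\<lambda>e. spans (f e))"
  by (erule pt_app[rotated], unfold spans_def) (intro pt_intros)

lemma pt_hop_list: "polytime \<mu> f \<Longrightarrow> polytime \<mu> g \<Longrightarrow> polytime \<mu> (\<lambda>e. hop_list (f e) (g e))"
  by (erule (1) pt_app2[rotated], unfold hop_list_def)
    (intro pt_intros pt_spans pt_upt pbd_Suc pt_pbd_length)

lemma pt_hops: "polytime \<mu> f \<Longrightarrow> polytime \<mu> (\<lambda>e. hops (f e))"
  by (erule pt_app[rotated], unfold hops_def) (intro pt_intros pt_hop_list)

lemmas hop_defs = hop_region_def hop_rot_def hop_first_def hop_last_def hop_count_def hop_start_def hop_len_def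
lemmas mv_defs = mv_hop_def mv_before_def mv_after_def mv_cap_def mv_weight_def

lemma pt_hop_src: "polytime \<mu> f \<Longrightarrow> polytime \<mu> (\<lambda>e. hop_src (f e))"
  by (erule pt_app[rotated], unfold hop_src_def hop_defs) (intro pt_intros)

lemma pt_hop_dst: "polytime \<mu> f \<Longrightarrow> polytime \<mu> (\<lambda>e. hop_dst (f e))"
  by (erule pt_app[rotated], unfold hop_dst_def hop_defs) (intro pt_intros)

lemma pt_below: "polytime \<mu> f \<Longrightarrow> polytime \<mu> g \<Longrightarrow> polytime \<mu> (\<lambda>e. below (f e) (g e))"
  by (erule (1) pt_app2[rotated], unfold below_def) (intro pt_intros)

lemma pt_capacity: "polytime \<mu> f \<Longrightarrow> polytime \<mu> g \<Longrightarrow> polytime \<mu> h \<Longrightarrow> polytime \<mu> (\<lambda>e. capacity (f e) (g e) (h e))"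
  by (erule (2) pt_app3[rotated], unfold capacity_def) (intro pt_intros)

lemma pt_moves: "polytime \<mu> f \<Longrightarrow> polytime \<mu> g \<Longrightarrow> polytime \<mu> h \<Longrightarrow> polytime \<mu> (\<lambda>e. moves (f e) (g e) (h e))"
  by (erule (2) pt_app3[rotated], unfold moves_def) (intro pt_intros pt_capacity pt_below)

lemma pt_frac_less: "polytime \<mu> f \<Longrightarrow> polytime \<mu> g \<Longrightarrow> polytime \<mu> (\<lambda>e. frac_less (f e) (g e))"
  by (erule (1) pt_app2[rotated], unfold frac_less_def) (intro pt_intros)

lemma bottleneck_cases: "bottleneck P = (0, 1) \<or> bottleneck P \<in> mv_weight ` set P"
proof (induction P rule: rev_induct)
  case (snoc e P)
  have "bottleneck (P @ [e]) = (if frac_less (bottleneck P) (mv_weight e) then mv_weight e else bottleneck P)"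
    by (simp add: bottleneck_def)
  with snoc show ?case by (auto split: if_splits)
qed (simp add: bottleneck_def)

lemma pt_bottleneck: "polytime \<mu> f \<Longrightarrow> polytime \<mu> (\<lambda>e. bottleneck (f e))"
proof (erule pt_app[rotated], unfold bottleneck_def, rule pt_foldl[where B = "\<lambda>P. 4 + sz P"])
  fix P us vs :: "move list" assume P: "P = us @ vs"
  have "sz (mv_weight e) \<le> sz P" if "e \<in> set us" for e
  proof -
    have "sz (mv_weight e) \<le> sz e" by (simp add: mv_defs hop_defs)
    also have "\<dots> \<le> sz P" using sz_elem[of e P] that P by simp
    finally show ?thesis .
  qed
  note le = this
  have "sz (bottleneck us) \<le> 4 + sz P"
    using bottleneck_cases[of us]
  proof
    assume "bottleneck us \<in> mv_weight ` set us"
    then obtain e where "bottleneck us = mv_weight e" "e \<in> set us" by blast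
    then show ?thesis by (simp only: trans_le_add2[OF le])
  qed (simp add: bits_Suc_0)
  then show "sz (foldl (\<lambda>m e. if frac_less m (mv_weight e) then mv_weight e else m) (0, 1) us) \<le> 4 + sz P"
    unfolding bottleneck_def .
next
  show "polytime (\<lambda>_. 0) (\<lambda>p :: (move list \<times> nat \<times> nat) \<times> move.
    if frac_less (snd (fst p)) (mv_weight (snd p)) then mv_weight (snd p) else snd (fst p))"
    unfolding mv_defs hop_defs by (intro pt_intros pt_frac_less)
qed (intro pt_intros pbd_add pbd_const pbd_sz)+

lemma pt_path_less: "polytime \<mu> f \<Longrightarrow> polytime \<mu> g \<Longrightarrow> polytime \<mu> (\<lambda>e. path_less (f e) (g e))"
  by (erule (1) pt_app2[rotated], unfold path_less_def) (intro pt_intros pt_bottleneck pt_frac_less)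

lemma pt_fits: "polytime \<mu> f \<Longrightarrow> polytime \<mu> g \<Longrightarrow> polytime \<mu> h \<Longrightarrow> polytime \<mu> (\<lambda>e. fits (f e) (g e) (h e))"
  by (erule (2) pt_app3[rotated], unfold fits_def mv_defs) (intro pt_intros pt_hop_src pt_hop_dst)

lemma pt_extend: "polytime \<mu> f \<Longrightarrow> polytime \<mu> g \<Longrightarrow> polytime \<mu> h \<Longrightarrow> polytime \<mu> (\<lambda>e. extend (f e) (g e) (h e))"
  by (erule (2) pt_app3[rotated], unfold extend_def) (intro pt_intros pt_best pt_fits pt_path_less)

lemma extend_props:
  assumes "\<And>P. P \<in> set T \<Longrightarrow> length P \<le> n \<and> set P \<subseteq> set E"
  shows "length (extend E z T) \<le> length E"
    and "P \<in> set (extend E z T) \<Longrightarrow> length P \<le> Suc n \<and> set P \<subseteq> set E"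
proof -
  have "length (best path_less Ps) \<le> 1" for Ps using best_cases[of path_less Ps] by auto
  note * = this
  have "length (concat (map (\<lambda>e. map (\<lambda>P. e # P) (best path_less (filter (\<lambda>P. fits z e P) ([] # T)))) E')) \<le> length E'" for E'
  proof (induction E')
    case (Cons e E')
    then show ?case using *[of "filter (\<lambda>P. fits z e P) ([] # T)"] by simp
  qed simp
  then show "length (extend E z T) \<le> length E" unfolding extend_def .
next
  assume "P \<in> set (extend E z T)"
  then obtain e P' where e: "e \<in> set E" "P' \<in> set (best path_less (filter (\<lambda>P. fits z e P) ([] # T)))" "P = e # P'"
    unfolding extend_def by auto
  then have "P' \<in> set (filter (\<lambda>P. fits z e P) ([] # T))"
    using best_cases[of path_less "filter (\<lambda>P. fits z e P) ([] # T)"] by (auto split: if_splits)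
  then have "P' = [] \<or> P' \<in> set T" by (auto split: if_splits)
  then show "length P \<le> Suc n \<and> set P \<subseteq> set E" using e assms by auto
qed

lemma best_paths_props:
  "length (best_paths E z R) \<le> length E
   \<and> (\<forall>P \<in> set (best_paths E z R). length P \<le> length R \<and> set P \<subseteq> set E)"
proof (induction R rule: rev_induct)
  case (snoc x R)
  have "best_paths E z (R @ [x]) = extend E z (best_paths E z R)" by (simp add: best_paths_def)
  with extend_props[where T = "best_paths E z R" and n = "length R" and E = E and z = z] snoc show ?case by auto
qed (simp add: best_paths_def)

text \<open>
  All intermediate lists of paths are small: they contain at most one path for each last move, and a
  path of at most as many moves as there have been rounds.
\<close>

lemma pt_best_paths:
  fixes h :: "'e :: enc \<Rightarrow> 'b :: enc list"
  shows "polytime \<mu> f \<Longrightarrow> polytime \<mu> g \<Longrightarrow> polytime \<mu> h \<Longrightarrow> polytime \<mu> (\<lambda>e. best_paths (f e) (g e) (h e))"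
proof (erule (2) pt_app3[rotated], unfold best_paths_def,
    rule pt_foldl[where B = "\<lambda>p. 1 + length (fst p) * (1 + (1 + length (snd (snd p)) * (1 + sz (fst p))))"])
  fix p :: "move list \<times> nat list \<times> 'b list" and us vs assume p: "snd (snd p) = us @ vs"
  let ?T = "best_paths (fst p) (fst (snd p)) us"
  have P: "sz P \<le> 1 + length (snd (snd p)) * (1 + sz (fst p))" if "P \<in> set ?T" for P
  proof -
    have "length P \<le> length us" "set P \<subseteq> set (fst p)" using best_paths_props that by blast+
    then have "sz e \<le> sz (fst p)" if "e \<in> set P" for e using sz_elem[of e "fst p"] that by auto
    then have "sz P \<le> 1 + length P * (1 + sz (fst p))" by (rule sz_le_length)
    also have "\<dots> \<le> 1 + length (snd (snd p)) * (1 + sz (fst p))"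
      using \<open>length P \<le> length us\<close> p by (intro add_mono mult_le_mono) auto
    finally show ?thesis .
  qed
  have "length ?T \<le> length (fst p)" using best_paths_props by blast
  from le_trans[OF sz_le_length[OF P] add_left_mono[OF mult_le_mono1[OF this]]]
  show "sz (foldl (\<lambda>T _. extend (fst p) (fst (snd p)) T) [] us)
    \<le> 1 + length (fst p) * (1 + (1 + length (snd (snd p)) * (1 + sz (fst p))))"
    unfolding best_paths_def .
next
  show "polybounded (\<lambda>_. 0) (\<lambda>p :: move list \<times> nat list \<times> 'b list.
      1 + length (fst p) * (1 + (1 + length (snd (snd p)) * (1 + sz (fst p)))))"
    by (intro pbd_add pbd_mult pbd_const pt_pbd_length pt_pbd pt_intros)
qed (intro pt_intros pt_extend)+

lemma pt_finished: "polytime \<mu> f \<Longrightarrow> polytime \<mu> g \<Longrightarrow> polytime \<mu> h \<Longrightarrow> polytime \<mu> (\<lambda>e. finished (f e) (g e) (h e))"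
  by (erule (2) pt_app3[rotated], unfold finished_def mv_defs) (intro pt_intros pt_hop_dst)

lemma pt_robots: "polytime \<mu> f \<Longrightarrow> polytime \<mu> g \<Longrightarrow> polytime \<mu> (\<lambda>e. robots (f e) (g e))"
  by (erule (1) pt_app2[rotated], unfold robots_def) (intro pt_intros)

lemma pt_crew: "polytime \<mu> f \<Longrightarrow> polytime \<mu> g \<Longrightarrow> polytime \<mu> (\<lambda>e. crew (f e) (g e))"
  by (erule (1) pt_app2[rotated], unfold crew_def mv_defs) (intro pt_intros)

lemma pt_placements: "polytime \<mu> f \<Longrightarrow> polytime \<mu> g \<Longrightarrow> polytime \<mu> h \<Longrightarrow> polytime \<mu> (\<lambda>e. placements (f e) (g e) (h e))"
  by (erule (2) pt_app3[rotated], unfold placements_def mv_defs hop_defs) (intro pt_intros pt_crew)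

lemma pt_arcs_of_path: "polytime \<mu> f \<Longrightarrow> polytime \<mu> g \<Longrightarrow> polytime \<mu> h \<Longrightarrow> polytime \<mu> (\<lambda>e. arcs_of_path (f e) (g e) (h e))"
  by (erule (2) pt_app3[rotated], unfold arcs_of_path_def) (intro pt_intros pt_placements)

lemma vectors_snoc:
  "vectors U (ts @ [p]) = concat (map (\<lambda>x. map (\<lambda>v. v @ [x]) (vectors U ts)) (filter (\<lambda>x. x \<le> fst p) U))"
  by (simp add: vectors_def)

lemma length_vectors:
  assumes "distinct U"
  shows "length (vectors U ts) \<le> prod_list (map (\<lambda>p. Suc (fst p)) ts)"
proof (induction ts rule: rev_induct)
  case (snoc p ts)
  have "length (filter (\<lambda>x. x \<le> fst p) U) = card (set (filter (\<lambda>x. x \<le> fst p) U))"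
    using assms by (intro distinct_card[symmetric] distinct_filter)
  also have "\<dots> \<le> card {..fst p}" by (intro card_mono) auto
  finally have "length (filter (\<lambda>x. x \<le> fst p) U) \<le> Suc (fst p)" by simp
  moreover have "length (concat (map (\<lambda>x. map (\<lambda>v. v @ [x]) V) xs)) = length V * length xs" for V :: "nat list list" and xs
    by (induction xs) auto
  ultimately show ?case using snoc by (simp add: vectors_snoc mult_le_mono del: mult_Suc_right)
qed (simp add: vectors_def)

lemma vectors_elem: "v \<in> set (vectors U ts) \<Longrightarrow> length v = length ts \<and> set v \<subseteq> set U"
proof (induction ts arbitrary: v rule: rev_induct)
  case (snoc p ts)
  then obtain w x where "v = w @ [x]" "w \<in> set (vectors U ts)" "x \<in> set U"
    by (auto simp: vectors_snoc)
  with snoc.IH[of w] show ?case by simp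
qed (simp add: vectors_def)

text \<open>
  Sublists of the types have at most as many vectors as the whole list, since all factors
  of the product that counts them are positive.
\<close>

lemma pt_vectors: "polytime size_param (\<lambda>d. vectors [0..<size_param d] (snd d))"
proof -
  have U: "polytime size_param (\<lambda>d. [0..<size_param d])"
    by (intro pt_upt pbd_measure) (unfold size_param_def, intro pt_intros)
  let ?B = "\<lambda>d. 1 + size_param d * (1 + (1 + length (snd d) * (1 + sz [0..<size_param d])))"
  have "polytime size_param (\<lambda>d. foldl (\<lambda>V p. concat (map (\<lambda>x. map (\<lambda>v. v @ [x]) V)
      (filter (\<lambda>x. x \<le> fst p) [0..<size_param d]))) [[]] (snd d))"
  proof (rule pt_foldl[where B = ?B])
    fix d :: "perimeter_data list \<times> (nat \<times> nat) list" and us vs assume d: "snd d = us @ vs"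
    let ?V = "vectors [0..<size_param d] us"
    let ?N = "\<lambda>ts. prod_list (map (\<lambda>p. Suc (fst p)) ts)"
    have "length ?V \<le> ?N us * 1" using length_vectors[of "[0..<size_param d]" us] by simp
    also have "1 \<le> ?N vs" by (induction vs) auto
    also have "?N us * ?N vs = size_param d" by (simp add: size_param_def d)
    finally have le: "length ?V \<le> size_param d" by simp
    have "sz v \<le> 1 + length (snd d) * (1 + sz [0..<size_param d])" if "v \<in> set ?V" for v
    proof -
      have v: "length v = length us" "set v \<subseteq> set [0..<size_param d]" using vectors_elem[OF that] by auto
      then have "sz x \<le> sz [0..<size_param d]" if "x \<in> set v" for x
        using sz_elem[of x "[0..<size_param d]"] that by auto
      then have "sz v \<le> 1 + length v * (1 + sz [0..<size_param d])" by (rule sz_le_length)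
      also have "\<dots> \<le> 1 + length (snd d) * (1 + sz [0..<size_param d])"
        using v d by (intro add_mono mult_le_mono) auto
      finally show ?thesis .
    qed
    then have "sz ?V \<le> 1 + length ?V * (1 + (1 + length (snd d) * (1 + sz [0..<size_param d])))"
      by (rule sz_le_length)
    also have "\<dots> \<le> ?B d" using le by (intro add_mono mult_le_mono) auto
    finally show "sz (foldl (\<lambda>V p. concat (map (\<lambda>x. map (\<lambda>v. v @ [x]) V)
      (filter (\<lambda>x. x \<le> fst p) [0..<size_param d]))) [[]] us) \<le> ?B d"
      unfolding vectors_def .
  next
    show "polybounded size_param ?B"
      by (intro pbd_add pbd_mult pbd_const pbd_measure pt_pbd_length pt_pbd U pt_intros)
    have U': "polytime (\<lambda>p. size_param (fst (fst p)))
      (\<lambda>p :: ((perimeter_data list \<times> (nat \<times> nat) list) \<times> nat list list) \<times> nat \<times> nat. [0..<size_param (fst (fst p))])"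
      by (rule pt_comp[OF U]) (intro pt_intros pbd_measure)+
    show "polytime (\<lambda>p. size_param (fst (fst p)))
      (\<lambda>p :: ((perimeter_data list \<times> (nat \<times> nat) list) \<times> nat list list) \<times> nat \<times> nat.
        concat (map (\<lambda>x. map (\<lambda>v. v @ [x]) (snd (fst p)))
          (filter (\<lambda>x. x \<le> fst (snd p)) [0..<size_param (fst (fst p))])))"
      by (intro pt_intros U')
  qed (intro pt_intros)+
  then show ?thesis unfolding vectors_def .
qed

lemma pt_solve: "polytime size_param solve"
proof -
  have U: "polytime size_param (\<lambda>d. [0..<size_param d])"
    by (intro pt_upt pbd_measure) (unfold size_param_def, intro pt_intros)
  have "polytime size_param (\<lambda>d. best_complete_path [0..<size_param d] (prod_list (denominators (fst d))) d)"
    unfolding best_complete_path_def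
    by (intro pt_best pt_finished pt_best_paths pt_moves pt_hops pt_scaled pt_vectors pt_robots U
        pt_denominators pt_path_less pt_intros)
  then show ?thesis unfolding solve_def Let_def
    by (intro pt_case_list pt_enc pt_arcs_of_path pt_bottleneck pt_robots pt_denominators pt_intros
       pt_comp[OF U] pbd_measure)
qed

section \<open>Moves and bottleneck paths\<close>

lemma length_prefix_sums [simp]: "length (prefix_sums b xs) = length xs"
  by (induction b xs rule: prefix_sums.induct) auto

lemma nth_prefix_sums: "k < length xs \<Longrightarrow> prefix_sums b xs ! k = (b + sum_list (map fst (take k xs)), xs ! k)"
proof (induction b xs arbitrary: k rule: prefix_sums.induct)
  case (2 b x xs)
  then show ?case by (cases k) auto
qed simp

definition span_start :: "(nat \<times> nat) list \<Rightarrow> nat \<Rightarrow> nat" where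
  "span_start xs k = sum_list (map (\<lambda>x. fst x + snd x) (take k (xs @ xs)))"

definition span_end :: "(nat \<times> nat) list \<Rightarrow> nat \<Rightarrow> nat" where
  "span_end xs k = span_start xs k + fst ((xs @ xs) ! k)"

lemma set_spans:
  "set (spans xs) = (\<lambda>k. (k, span_start xs k, fst ((xs @ xs) ! k) + snd ((xs @ xs) ! k), fst ((xs @ xs) ! k))) ` {..<2 * length xs}"
proof -
  have *: "prefix_sums 0 (map (\<lambda>x. (fst x + snd x, fst x)) (xs @ xs)) ! k
    = (span_start xs k, fst ((xs @ xs) ! k) + snd ((xs @ xs) ! k), fst ((xs @ xs) ! k))" if "k < 2 * length xs" for k
    using that unfolding span_start_def
    by (subst nth_prefix_sums) (simp_all add: take_map comp_def del: map_append take_append)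
  show ?thesis unfolding spans_def set_eq_iff in_set_enumerate_eq image_iff
    using * by (force simp del: map_append)
qed

lemma mem_concat_map: "y \<in> set (concat (map f xs)) \<longleftrightarrow> (\<exists>x \<in> set xs. y \<in> set (f x))"
  by auto

lemma mem_if_singleton: "x \<in> set (if c then [y] else []) \<longleftrightarrow> c \<and> x = y"
  by auto

lemma mem_hops:
  "h \<in> set (hops ips) \<longleftrightarrow> (\<exists>i r a b. i < length ips \<and> r \<le> length (ips ! i) \<and> r \<le> a \<and> a \<le> b
     \<and> b < r + length (ips ! i)
     \<and> h = (i, r, a, b, length (ips ! i), span_start (ips ! i) a, span_end (ips ! i) b - span_start (ips ! i) a))"
  (is "_ \<longleftrightarrow> ?R")
proof -
  have "h \<in> set (hop_list i xs) \<longleftrightarrow> (\<exists>r \<in> {..length xs}. \<exists>x \<in> set (spans xs). \<exists>y \<in> set (spans xs).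
     r \<le> fst x \<and> fst x \<le> fst y \<and> fst y < r + length xs \<and>
     h = (i, r, fst x, fst y, length xs, fst (snd x), fst (snd y) + snd (snd (snd y)) - fst (snd x)))" for i xs
    unfolding hop_list_def mem_concat_map mem_if_singleton set_upt atLeast0LessThan lessThan_Suc_atMost conj_assoc ..
  note 1 = this
  have 2: "(\<exists>r \<in> {..length xs}. \<exists>x \<in> set (spans xs). \<exists>y \<in> set (spans xs).
     r \<le> fst x \<and> fst x \<le> fst y \<and> fst y < r + length xs \<and>
     h = (i, r, fst x, fst y, length xs, fst (snd x), fst (snd y) + snd (snd (snd y)) - fst (snd x))) \<longleftrightarrow> (\<exists>r a b. r \<le> length xs \<and> r \<le> a \<and> a \<le> b \<and> b < r + length xs \<and>
     h = (i, r, a, b, length xs, span_start xs a, span_end xs b - span_start xs a))" for i xs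
    unfolding set_spans span_end_def by fastforce
  have *: "h \<in> set (hop_list i xs) \<longleftrightarrow> (\<exists>r a b. r \<le> length xs \<and> r \<le> a \<and> a \<le> b \<and> b < r + length xs \<and>
     h = (i, r, a, b, length xs, span_start xs a, span_end xs b - span_start xs a))" for i xs
    unfolding 1 2 ..
  have "h \<in> set (hops ips) \<longleftrightarrow> (\<exists>i < length ips. h \<in> set (hop_list i (ips ! i)))"
    unfolding hops_def mem_concat_map Bex_def in_set_enumerate_eq by auto
  then show ?thesis unfolding * by blast
qed

lemma mem_vectors:
  assumes "\<And>p. p \<in> set ts \<Longrightarrow> {..fst p} \<subseteq> set U"
  shows "v \<in> set (vectors U ts) \<longleftrightarrow> length v = length ts \<and> (\<forall>k < length ts. v ! k \<le> fst (ts ! k))"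
  using assms
proof (induction ts arbitrary: v rule: rev_induct)
  case Nil
  then show ?case by (simp add: vectors_def)
next
  case (snoc p ts)
  have U: "{..fst p} \<subseteq> set U" using snoc.prems by simp
  have IH: "w \<in> set (vectors U ts) \<longleftrightarrow> length w = length ts \<and> (\<forall>k < length ts. w ! k \<le> fst (ts ! k))" for w
    using snoc by simp
  show ?case
  proof (cases v rule: rev_cases)
    case (snoc w x)
    have "v \<in> set (vectors U (ts @ [p])) \<longleftrightarrow> w \<in> set (vectors U ts) \<and> x \<le> fst p"
      using U unfolding vectors_snoc snoc by auto
    then show ?thesis unfolding IH snoc by (auto simp: nth_append less_Suc_eq)
  qed (auto simp: vectors_snoc)
qed

lemma below_iff:
  assumes "length u = length v"
  shows "below u v \<longleftrightarrow> (\<forall>k < length u. u ! k \<le> v ! k)"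
  using assms unfolding below_def filter_empty_conv by (auto simp: set_zip)

lemma capacity_eq:
  assumes "length u = length ts" "length v = length ts"
  shows "capacity ts u v = (\<Sum>k < length ts. (v ! k - u ! k) * snd (ts ! k))"
  using assms unfolding capacity_def
  by (subst sum_list_sum_nth) (simp add: atLeast0LessThan)

lemma mem_moves:
  "e \<in> set (moves H V ts) \<longleftrightarrow> mv_hop e \<in> set H \<and> mv_before e \<in> set V \<and> mv_after e \<in> set V
    \<and> below (mv_before e) (mv_after e) \<and> mv_cap e = capacity ts (mv_before e) (mv_after e) \<and> 0 < mv_cap e"
  by (cases e) (auto simp: moves_def mv_defs split: if_splits)

lemma best_minimal:
  assumes val: "\<And>x y. x \<in> set xs \<Longrightarrow> y \<in> set xs \<Longrightarrow> lt x y \<longleftrightarrow> f x < (f y :: real)"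
    and "y \<in> set xs"
  shows "\<exists>x \<in> set xs. best lt xs = [x] \<and> f x \<le> f y"
  using assms
proof (induction xs arbitrary: y rule: rev_induct)
  case (snoc z xs)
  have eq: "best lt (xs @ [z]) = best_step lt (best lt xs) z" by (simp add: best_def)
  show ?case
  proof (cases "xs = []")
    case True
    then show ?thesis using snoc.prems(2) by (simp add: best_def best_step_def)
  next
    case False
    have IH: "\<exists>x \<in> set xs. best lt xs = [x] \<and> f x \<le> f y" if "y \<in> set xs" for y
      by (rule snoc.IH[OF _ that]) (simp add: snoc.prems(1))
    obtain x0 where "x0 \<in> set xs" using False by (cases xs) auto
    from IH[OF this] obtain x where x: "x \<in> set xs" "best lt xs = [x]" by blast
    have min: "f x \<le> f y" if "y \<in> set xs" for y using IH[OF that] x(2) by auto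
    have "lt z x \<longleftrightarrow> f z < f x" using snoc.prems(1)[of z x] x(1) by simp
    then show ?thesis using snoc.prems(2) x min unfolding eq
      by (cases "lt z x") (fastforce simp: best_step_def)+
  qed
qed simp

definition frac_val :: "nat \<times> nat \<Rightarrow> real" where
  "frac_val x = real (fst x) / real (snd x)"

lemma frac_less_iff:
  assumes "0 < snd x" "0 < snd y"
  shows "frac_less x y \<longleftrightarrow> frac_val x < frac_val y"
proof -
  have "frac_val x < frac_val y \<longleftrightarrow> real (fst x * snd y) < real (fst y * snd x)"
    using assms by (simp add: frac_val_def field_simps)
  then show ?thesis unfolding frac_less_def by (simp only: of_nat_less_iff)
qed

definition caps_pos :: "move list \<Rightarrow> bool" where
  "caps_pos P \<longleftrightarrow> (\<forall>e \<in> set P. 0 < mv_cap e)"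

abbreviation mv_val :: "move \<Rightarrow> real" where
  "mv_val e \<equiv> frac_val (mv_weight e)"

abbreviation path_val :: "move list \<Rightarrow> real" where
  "path_val P \<equiv> frac_val (bottleneck P)"

lemma bottleneck_pos: "caps_pos P \<Longrightarrow> 0 < snd (bottleneck P)"
  using bottleneck_cases[of P] by (auto simp: caps_pos_def mv_weight_def)

lemma path_val_eq:
  assumes "caps_pos P"
  shows "path_val P = Max (insert 0 (mv_val ` set P))"
  using assms
proof (induction P rule: rev_induct)
  case Nil
  then show ?case by (simp add: bottleneck_def frac_val_def)
next
  case (snoc e P)
  have P: "caps_pos P" and e: "0 < snd (mv_weight e)" using snoc.prems by (auto simp: caps_pos_def mv_weight_def)
  have "bottleneck (P @ [e]) = (if frac_less (bottleneck P) (mv_weight e) then mv_weight e else bottleneck P)"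
    by (simp add: bottleneck_def)
  then have "path_val (P @ [e]) = max (mv_val e) (path_val P)"
    using frac_less_iff[OF bottleneck_pos[OF P] e] by (auto simp: max_def)
  also have "\<dots> = Max (insert (mv_val e) (insert 0 (mv_val ` set P)))"
    unfolding snoc.IH[OF P] by (rule Max_insert[symmetric]) auto
  finally show ?case by (simp add: insert_commute)
qed

lemma path_val_le_iff: "caps_pos P \<Longrightarrow> path_val P \<le> c \<longleftrightarrow> 0 \<le> c \<and> (\<forall>e \<in> set P. mv_val e \<le> c)"
  by (simp add: path_val_eq)

lemma path_less_iff: "caps_pos P \<Longrightarrow> caps_pos P' \<Longrightarrow> path_less P P' \<longleftrightarrow> path_val P < path_val P'"
  unfolding path_less_def by (intro frac_less_iff bottleneck_pos)

primrec is_path :: "move list \<Rightarrow> nat list \<Rightarrow> move list \<Rightarrow> bool" where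
  "is_path E z [] \<longleftrightarrow> True"
| "is_path E z (e # P) \<longleftrightarrow> e \<in> set E \<and> fits z e P \<and> is_path E z P"

lemma is_path_subset: "is_path E z P \<Longrightarrow> set P \<subseteq> set E"
  by (induction P) auto

lemma is_path_caps: "caps_pos E \<Longrightarrow> is_path E z P \<Longrightarrow> caps_pos P"
  using is_path_subset unfolding caps_pos_def by blast

lemma best_paths_snoc: "best_paths E z (R @ [x]) = extend E z (best_paths E z R)"
  by (simp add: best_paths_def)

lemma best_paths_sound: "P \<in> set (best_paths E z R) \<Longrightarrow> is_path E z P \<and> P \<noteq> []"
proof (induction R arbitrary: P rule: rev_induct)
  case (snoc x R)
  let ?Q = "\<lambda>e. filter (\<lambda>P. fits z e P) ([] # best_paths E z R)"
  from snoc.prems obtain e P' where e: "e \<in> set E" "P' \<in> set (best path_less (?Q e))" "P = e # P'"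
    unfolding best_paths_snoc extend_def by auto
  then have "P' \<in> set (?Q e)" using best_cases[of path_less "?Q e"] by (auto simp del: filter.simps)
  then have "fits z e P'" "P' = [] \<or> P' \<in> set (best_paths E z R)" by (auto simp del: filter.simps)
  then show ?case using e snoc.IH[of P'] by auto
qed (simp add: best_paths_def)

lemma fits_hd: "fits z e (f # P) \<longleftrightarrow> fits z e (f # P')"
  by (simp add: fits_def)

text \<open>
  Whether a move fits a path depends on the last move of the path only. So in a given path the part
  before the last move may be replaced by a best path with the same last move, and the value does not
  increase.
\<close>

lemma best_paths_complete:
  assumes E: "caps_pos E" and "is_path E z (e # P)" "length (e # P) \<le> length R"
  shows "\<exists>P'. e # P' \<in> set (best_paths E z R) \<and> path_val (e # P') \<le> path_val (e # P)"
  using assms(2,3)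
proof (induction R arbitrary: e P rule: rev_induct)
  case (snoc x R)
  let ?Q = "filter (\<lambda>P. fits z e P) ([] # best_paths E z R)"
  have e: "e \<in> set E" "fits z e P" "is_path E z P" "length P \<le> length R" using snoc.prems by auto
  have caps: "caps_pos P'" if "P' \<in> set ?Q" for P'
    using that best_paths_sound[of P' E z R] is_path_caps[OF E]
    by (auto simp: caps_pos_def[of "[]"] split: if_splits)
  have caps_e: "caps_pos (e # P') \<longleftrightarrow> caps_pos P'" for P' using E e(1) by (auto simp: caps_pos_def)
  obtain P1 where P1: "P1 \<in> set ?Q" "path_val P1 \<le> path_val P"
  proof (cases P)
    case Nil
    then show ?thesis using that[of "[]"] e(2) by simp
  next
    case (Cons f P2)
    from snoc.IH[of f P2] e(3,4) obtain P' where P': "f # P' \<in> set (best_paths E z R)"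
      "path_val (f # P') \<le> path_val P" unfolding Cons by blast
    have "fits z e (f # P')" using e(2) fits_hd unfolding Cons by blast
    with P' that show ?thesis by (auto simp del: filter.simps)
  qed
  obtain P' where P': "P' \<in> set ?Q" "best path_less ?Q = [P']" "path_val P' \<le> path_val P1"
    using best_minimal[where xs = ?Q and lt = path_less and f = path_val, OF _ P1(1)] path_less_iff caps by blast
  have "e # P' \<in> set (best_paths E z (R @ [x]))"
    unfolding best_paths_snoc extend_def using e(1) P'(2)
    by (auto simp del: filter.simps intro!: bexI[of _ e])
  moreover have "path_val (e # P') \<le> path_val (e # P)"
  proof -
    have "caps_pos P" using is_path_caps[OF E e(3)] .
    then have "0 \<le> path_val (e # P) \<and> path_val P \<le> path_val (e # P) \<and> mv_val e \<le> path_val (e # P)"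
      using caps_e path_val_le_iff[of "e # P" "path_val (e # P)"] path_val_le_iff[of P "path_val (e # P)"] by auto
    then show ?thesis
      using path_val_le_iff[of "e # P'" "path_val (e # P)"] caps_e caps[OF P'(1)]
        path_val_le_iff[of P' "path_val P"] P'(3) P1(2) by auto
  qed
  ultimately show ?case by blast
qed simp

section \<open>Cutting a covered circle into groups\<close>

lemma interval_cover_length:
  fixes x y :: "'i \<Rightarrow> real"
  assumes "finite S" "{\<alpha>..<\<beta>} \<subseteq> (\<Union>j \<in> S. {x j..y j})" "\<And>j. j \<in> S \<Longrightarrow> x j \<le> y j"
  shows "\<beta> - \<alpha> \<le> (\<Sum>j \<in> S. y j - x j)"
proof (cases "\<alpha> \<le> \<beta>")
  case True
  have "\<beta> - \<alpha> = measure lborel {\<alpha>..<\<beta>}" using True by simp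
  also have "\<dots> \<le> measure lborel (\<Union>j \<in> S. {x j..y j})"
  proof (rule measure_mono_fmeasurable[OF assms(2)])
    show "(\<Union>j \<in> S. {x j..y j}) \<in> fmeasurable lborel"
      by (rule fmeasurable.finite_UN[OF assms(1)], rule fmeasurableI) (simp_all add: emeasure_lborel_Icc_eq)
  qed simp
  also have "\<dots> \<le> (\<Sum>j \<in> S. measure lborel {x j..y j})"
    using assms(1) by (rule measure_UNION_le) simp
  also have "\<dots> = (\<Sum>j \<in> S. y j - x j)" using assms(3) by (intro sum.cong) auto
  finally show ?thesis .
next
  case False
  have "0 \<le> (\<Sum>j \<in> S. y j - x j)" using assms(3) by (intro sum_nonneg) auto
  with False show ?thesis by simp
qed

text \<open>
  The indices from \<open>a\<close> to \<open>e - 1\<close> are cut into runs, each with a set of robots related to it by \<open>G\<close>; the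
  sets are disjoint, and the last argument is their union.
\<close>

inductive chain :: "(nat \<Rightarrow> nat \<Rightarrow> 'j set \<Rightarrow> bool) \<Rightarrow> nat \<Rightarrow> nat \<Rightarrow> 'j set \<Rightarrow> bool" for G where
  chain_nil: "chain G a a {}"
| chain_step: "G a b S \<Longrightarrow> a \<le> b \<Longrightarrow> S \<inter> T = {} \<Longrightarrow> chain G (Suc b) e T \<Longrightarrow> chain G a e (S \<union> T)"

text \<open>
  A covered circle of length \<open>L\<close>, unrolled to the real line. Segment \<open>k\<close> is \<open>{st k..en k}\<close>, the segments
  of two rounds are numbered, and arc \<open>j\<close> stands for all its translates by multiples of \<open>L\<close>.
\<close>

locale circle_cover =
  fixes q :: nat and L :: real and st en :: "nat \<Rightarrow> real" and J :: "'j set" and s l :: "'j \<Rightarrow> real"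
  assumes q: "0 < q" and L: "0 < L" and J: "finite J"
    and st_en: "\<And>k. k < 2 * q \<Longrightarrow> st k \<le> en k" "\<And>k. k < 2 * q \<Longrightarrow> en k \<le> st (Suc k)"
    and shift: "\<And>k. k \<le> q \<Longrightarrow> st (k + q) = st k + L" "\<And>k. k < q \<Longrightarrow> en (k + q) = en k + L"
    and l: "\<And>j. j \<in> J \<Longrightarrow> 0 \<le> l j" "\<And>j. j \<in> J \<Longrightarrow> l j \<le> L"
    and segs: "\<And>k x. k < q \<Longrightarrow> st k \<le> x \<Longrightarrow> x \<le> en k \<Longrightarrow>
      \<exists>j \<in> J. \<exists>z :: int. s j + z * L \<le> x \<and> x \<le> s j + z * L + l j"
begin

definition cov :: "real \<Rightarrow> bool" where
  "cov x \<longleftrightarrow> (\<exists>j \<in> J. \<exists>z :: int. s j + z * L \<le> x \<and> x \<le> s j + z * L + l j)"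

lemma cov_shift: "cov (x + L) \<longleftrightarrow> cov x"
proof
  assume "cov (x + L)"
  then obtain j z where j: "j \<in> J" "s j + real_of_int z * L \<le> x + L" "x + L \<le> s j + real_of_int z * L + l j" unfolding cov_def by blast
  then have "s j + real_of_int (z - 1) * L \<le> x" "x \<le> s j + real_of_int (z - 1) * L + l j" by (simp_all add: algebra_simps)
  with j show "cov x" unfolding cov_def by blast
next
  assume "cov x"
  then obtain j z where j: "j \<in> J" "s j + real_of_int z * L \<le> x" "x \<le> s j + real_of_int z * L + l j" unfolding cov_def by blast
  then have "s j + real_of_int (z + 1) * L \<le> x + L" "x + L \<le> s j + real_of_int (z + 1) * L + l j" by (simp_all add: algebra_simps)
  with j show "cov (x + L)" unfolding cov_def by blast
qed

lemma cov_seg: "k < 2 * q \<Longrightarrow> st k \<le> x \<Longrightarrow> x \<le> en k \<Longrightarrow> cov x"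
proof (cases "k < q")
  case True
  then show "st k \<le> x \<Longrightarrow> x \<le> en k \<Longrightarrow> cov x" using segs unfolding cov_def by blast
next
  case False
  assume k: "k < 2 * q" "st k \<le> x" "x \<le> en k"
  with False shift(1)[of "k - q"] shift(2)[of "k - q"]
  have "st (k - q) \<le> x - L" "x - L \<le> en (k - q)" "k - q < q" by auto
  then have "cov (x - L)" using segs unfolding cov_def by blast
  then show "cov x" using cov_shift[of "x - L"] by simp
qed

lemma st_mono: "a \<le> b \<Longrightarrow> b \<le> 2 * q \<Longrightarrow> st a \<le> st b"
proof (induction b rule: dec_induct)
  case (step n)
  then have "st n \<le> st (Suc n)" using st_en[of n] by simp
  with step show ?case by simp
qed simp

lemma locate:
  assumes "a < b" "b \<le> 2 * q" "st a \<le> x" "x < st b"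
  obtains k where "a \<le> k" "k < b" "st k \<le> x" "x < st (Suc k)"
proof -
  have "\<exists>k. a \<le> k \<and> k < b \<and> st k \<le> x \<and> x < st (Suc k)"
    using assms
  proof (induction b)
    case (Suc b)
    show ?case
    proof (cases "a < b \<and> x < st b")
      case True
      with Suc show ?thesis by (meson Suc_leD less_Suc_eq)
    next
      case False
      then have "st b \<le> x" using Suc.prems by (cases "a = b") auto
      with Suc.prems show ?thesis by (intro exI[of _ b]) auto
    qed
  qed simp
  then show thesis using that by blast
qed

text \<open>The translate of arc \<open>j\<close> that begins in \<open>[c, c + L)\<close>.\<close>

definition pos :: "real \<Rightarrow> 'j \<Rightarrow> real" where
  "pos c j = s j - of_int \<lfloor>(s j - c) / L\<rfloor> * L"

lemma pos_bounds: "c \<le> pos c j" "pos c j < c + L"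
proof -
  have "of_int \<lfloor>(s j - c) / L\<rfloor> * L \<le> (s j - c) / L * L"
    using L by (intro mult_right_mono) auto
  then show "c \<le> pos c j" using L by (simp add: pos_def)
  have "(s j - c) / L * L < (of_int \<lfloor>(s j - c) / L\<rfloor> + 1) * L"
    using L by (intro mult_strict_right_mono) linarith+
  moreover have "(s j - c) / L * L = s j - c" using L by simp
  ultimately have "s j - c < (of_int \<lfloor>(s j - c) / L\<rfloor> + 1) * L" by simp
  then show "pos c j < c + L" by (simp add: pos_def algebra_simps)
qed

lemma cov_pos: "cov x \<longleftrightarrow> (\<exists>j \<in> J. \<exists>z :: int. pos c j + z * L \<le> x \<and> x \<le> pos c j + z * L + l j)"
proof
  assume "cov x"
  then obtain j z where j: "j \<in> J" "s j + real_of_int z * L \<le> x" "x \<le> s j + real_of_int z * L + l j" unfolding cov_def by blast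
  let ?z = "z + \<lfloor>(s j - c) / L\<rfloor>"
  have "pos c j + ?z * L = s j + z * L" by (simp add: pos_def algebra_simps)
  with j show "\<exists>j \<in> J. \<exists>z :: int. pos c j + z * L \<le> x \<and> x \<le> pos c j + z * L + l j" by metis
next
  assume "\<exists>j \<in> J. \<exists>z :: int. pos c j + z * L \<le> x \<and> x \<le> pos c j + z * L + l j"
  then obtain j and z :: int where j: "j \<in> J" "pos c j + z * L \<le> x" "x \<le> pos c j + z * L + l j" by blast
  have "s j + real_of_int (z - \<lfloor>(s j - c) / L\<rfloor>) * L = pos c j + z * L" by (simp add: pos_def algebra_simps)
  with j show "cov x" unfolding cov_def by metis
qed

lemma mult_L_cases:
  assumes "u \<le> p + real_of_int z * L + d" "p + real_of_int z * L < u + L" "u \<le> p" "p < u + L" "d \<le> L"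
  shows "z = 0 \<or> z = -1"
proof -
  have "z < 1"
  proof (rule ccontr)
    assume "\<not> z < 1"
    then have "1 * L \<le> real_of_int z * L" using L by (intro mult_right_mono) auto
    with assms show False by linarith
  qed
  moreover have "z > -2"
  proof (rule ccontr)
    assume "\<not> z > -2"
    then have "real_of_int z * L \<le> (-2) * L" using L by (intro mult_right_mono) auto
    with assms show False by linarith
  qed
  ultimately show ?thesis by linarith
qed

text \<open>
  Within one round \<open>[c, c + L)\<close> the arc \<open>j\<close> leaves at most two pieces: one that begins at its
  translate in the round, and one that comes in at \<open>c\<close> from the preceding round. Their lengths add up to
  \<open>l j\<close>, so subadditivity of length applies to the pieces.
\<close>

lemma full_cover:
  assumes "\<And>x. c \<le> x \<Longrightarrow> x < c + L \<Longrightarrow> cov x"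
  shows "L \<le> (\<Sum>j \<in> J. l j)"
proof -
  let ?x = "\<lambda>(j, b). if b then pos c j else c"
  let ?y = "\<lambda>(j, b). if b then min (pos c j + l j) (c + L) else max c (pos c j + l j - L)"
  have "c + L - c \<le> (\<Sum>p \<in> J \<times> UNIV. ?y p - ?x p)"
  proof (rule interval_cover_length)
    show "finite (J \<times> (UNIV :: bool set))" using J by simp
    show "?x p \<le> ?y p" if "p \<in> J \<times> UNIV" for p
      using that l pos_bounds[of c "fst p"] by (auto simp: less_imp_le split: prod.splits)
    show "{c..<c + L} \<subseteq> (\<Union>p \<in> J \<times> UNIV. {?x p..?y p})"
    proof
      fix x assume x: "x \<in> {c..<c + L}"
      then obtain j and z :: int where j: "j \<in> J" "pos c j + z * L \<le> x" "x \<le> pos c j + z * L + l j"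
        using assms[of x] cov_pos[of x c] by auto
      have "z = 0 \<or> z = -1"
        by (rule mult_L_cases[of c "pos c j" z "l j"]) (use j x pos_bounds[of c j] l[of j] in auto)
      then show "x \<in> (\<Union>p \<in> J \<times> UNIV. {?x p..?y p})"
      proof
        assume "z = 0"
        with j x show ?thesis by (intro UN_I[of "(j, True)"]) auto
      next
        assume "z = -1"
        with j x show ?thesis by (intro UN_I[of "(j, False)"]) auto
      qed
    qed
  qed
  also have "(\<Sum>p \<in> J \<times> UNIV. ?y p - ?x p) = (\<Sum>j \<in> J. \<Sum>b \<in> UNIV. ?y (j, b) - ?x (j, b))"
    by (subst sum.cartesian_product) (auto intro!: sum.cong)
  also have "\<dots> = (\<Sum>j \<in> J. l j)"
    using l by (intro sum.cong) (auto simp: UNIV_bool min_def max_def)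
  finally show ?thesis by simp
qed

definition group :: "nat \<Rightarrow> nat \<Rightarrow> 'j set \<Rightarrow> bool" where
  "group a b S \<longleftrightarrow> S \<noteq> {} \<and> S \<subseteq> J \<and> en b - st a \<le> (\<Sum>j \<in> S. l j)"

text \<open>
  From here on the circle is cut at an uncovered point \<open>c\<close> of the gap after segment \<open>k0\<close>. Then every
  arc has a translate strictly inside the round \<open>(c, c + L)\<close>.
\<close>

context
  fixes c :: real and k0 :: nat
  assumes c: "\<not> cov c" "k0 < q" "en k0 \<le> c" "c \<le> st (Suc k0)"
begin

lemma pos_inside: "j \<in> J \<Longrightarrow> c < pos c j" "j \<in> J \<Longrightarrow> pos c j + l j < c + L"
proof -
  assume j: "j \<in> J"
  show "c < pos c j"
  proof (rule ccontr)
    assume "\<not> c < pos c j"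
    then have "pos c j + of_int 0 * L \<le> c" "c \<le> pos c j + of_int 0 * L + l j"
      using pos_bounds[of c j] l(1)[OF j] by auto
    then show False using c(1) cov_pos j by blast
  qed
  show "pos c j + l j < c + L"
  proof (rule ccontr)
    assume "\<not> pos c j + l j < c + L"
    then have "pos c j + of_int (-1) * L \<le> c" "c \<le> pos c j + of_int (-1) * L + l j"
      using pos_bounds[of c j] by auto
    then show False using c(1) cov_pos j by blast
  qed
qed

lemma cov_window:
  assumes "cov x" "c < x" "x < c + L"
  shows "\<exists>j \<in> J. pos c j \<le> x \<and> x \<le> pos c j + l j"
proof -
  obtain j and z :: int where j: "j \<in> J" "pos c j + z * L \<le> x" "x \<le> pos c j + z * L + l j"
    using assms(1) cov_pos[of x c] by blast
  have "z = 0 \<or> z = -1"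
    by (rule mult_L_cases[of c "pos c j" z "l j"]) (use j assms pos_bounds[of c j] l[of j] in auto)
  moreover have "z \<noteq> -1" using j assms pos_inside(2)[of j] by auto
  ultimately show ?thesis using j by auto
qed

lemma not_cov_pos: "\<not> cov y \<Longrightarrow> j \<in> J \<Longrightarrow> pos c j \<le> y \<Longrightarrow> pos c j + l j < y"
proof (rule ccontr)
  assume "\<not> cov y" "j \<in> J" "pos c j \<le> y" "\<not> pos c j + l j < y"
  then have "pos c j + of_int 0 * L \<le> y" "y \<le> pos c j + of_int 0 * L + l j" by auto
  with \<open>\<not> cov y\<close> \<open>j \<in> J\<close> cov_pos show False by blast
qed

text \<open>
  Let \<open>b\<close> be the first segment from \<open>a\<close> on that is followed by an uncovered point \<open>w\<close> in its gap. Everything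
  from \<open>st a\<close> to \<open>en b\<close> is covered, and by arcs that begin between the uncovered points \<open>y\<close> and \<open>w\<close>, because no
  arc crosses these. So these arcs form a group for the run from \<open>a\<close> to \<open>b\<close>, and the arcs of all
  later runs begin after \<open>w\<close>.
\<close>

lemma chain_from:
  assumes "Suc k0 \<le> a" "a < Suc k0 + q" "\<not> cov y" "c \<le> y" "y < st a"
  shows "\<exists>S. S \<subseteq> {j \<in> J. y < pos c j} \<and> chain group a (Suc k0 + q) S"
  using assms
proof (induction "Suc k0 + q - a" arbitrary: a y rule: less_induct)
  case less
  define gap where "gap b \<longleftrightarrow> a \<le> b \<and> (\<exists>w. \<not> cov w \<and> en b \<le> w \<and> w \<le> st (Suc b))" for b
  have last: "\<not> cov (c + L)" "en (k0 + q) \<le> c + L" "c + L \<le> st (Suc (k0 + q))"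
    using c cov_shift shift(1)[of "Suc k0"] shift(2)[of k0] by auto
  then have gap_last: "gap (k0 + q)" unfolding gap_def using less.prems by auto
  define b where "b = (LEAST b. gap b)"
  have b: "gap b" "b \<le> k0 + q" "\<And>k. k < b \<Longrightarrow> \<not> gap k"
    unfolding b_def by (rule LeastI[of gap, OF gap_last], rule Least_le[of gap, OF gap_last], erule not_less_Least)
  have ab: "a \<le> b" and b2: "b < 2 * q" using b(1,2) c(2) unfolding gap_def by auto
  have a2: "a < 2 * q" using ab b2 by simp
  have "\<exists>w. \<not> cov w \<and> en b \<le> w \<and> w \<le> st (Suc b) \<and> w \<le> c + L"
  proof (cases "b = k0 + q")
    case True
    with last show ?thesis by auto
  next
    case False
    with b(2) have "Suc b \<le> k0 + q" by simp
    then have "st (Suc b) \<le> st (k0 + q)" using st_mono c(2) by simp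
    also have "\<dots> \<le> c + L" using st_en(1)[of "k0 + q"] last(2) c(2) by simp
    finally show ?thesis using b(1) unfolding gap_def by fastforce
  qed
  then obtain w where w: "\<not> cov w" "en b \<le> w" "w \<le> st (Suc b)" "w \<le> c + L" by blast
  have stab: "st a \<le> en b" using st_mono[OF ab] st_en(1)[OF b2] b2 by simp
  have w1: "en b < w" using w(1,2) cov_seg[OF b2 st_en(1)[OF b2]] by (cases "en b = w") auto
  have inside: "cov x" if x: "st a \<le> x" "x \<le> en b" for x
  proof (cases "st b \<le> x")
    case True
    with x cov_seg[OF b2] show ?thesis by blast
  next
    case False
    with x ab have "a < b" by (cases "a = b") auto
    moreover have "x < st b" using False by simp
    ultimately obtain k where k: "a \<le> k" "k < b" "st k \<le> x" "x < st (Suc k)"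
      using locate[of a b x] less_imp_le[OF b2] x(1) by blast
    show ?thesis
    proof (cases "x \<le> en k")
      case True
      then show ?thesis using cov_seg[of k x] k b2 by simp
    next
      case False
      then show ?thesis using b(3)[OF k(2)] k unfolding gap_def by fastforce
    qed
  qed
  define S where "S = {j \<in> J. y < pos c j \<and> pos c j < w}"
  have in_S: "\<exists>j \<in> S. pos c j \<le> x \<and> x \<le> pos c j + l j" if x: "st a \<le> x" "x \<le> en b" for x
  proof -
    have xw: "c < x" "x < c + L" using x less.prems(4,5) w1 w(4) by auto
    obtain j where j: "j \<in> J" "pos c j \<le> x" "x \<le> pos c j + l j"
      using cov_window[OF inside[OF x] xw] by blast
    have "y < pos c j"
    proof (rule ccontr)
      assume "\<not> y < pos c j"
      then have "pos c j + l j < y" using not_cov_pos[OF less.prems(3) j(1)] by simp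
      with j x less.prems(5) show False by simp
    qed
    then show ?thesis using j x w1 unfolding S_def by auto
  qed
  have "group a b S"
    unfolding group_def
  proof (intro conjI)
    show "S \<noteq> {}" using in_S[of "st a"] stab by auto
    show "S \<subseteq> J" unfolding S_def by auto
    have "en b - st a \<le> (\<Sum>j \<in> S. (pos c j + l j) - pos c j)"
    proof (rule interval_cover_length)
      show "finite S" unfolding S_def using J by simp
      show "{st a..<en b} \<subseteq> (\<Union>j \<in> S. {pos c j..pos c j + l j})"
      proof
        fix x assume "x \<in> {st a..<en b}"
        then show "x \<in> (\<Union>j \<in> S. {pos c j..pos c j + l j})" using in_S[of x] by auto
      qed
      show "pos c j \<le> pos c j + l j" if "j \<in> S" for j using that l unfolding S_def by auto
    qed
    then show "en b - st a \<le> sum l S" by simp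
  qed
  note step = chain_step[of group a b S, OF this ab]
  show ?case
  proof (cases "b = k0 + q")
    case True
    have "chain group a (Suc k0 + q) (S \<union> {})"
      by (rule step) (use True in \<open>simp_all add: chain_nil\<close>)
    moreover have "S \<union> {} \<subseteq> {j \<in> J. y < pos c j}" unfolding S_def by auto
    ultimately show ?thesis by (intro exI conjI)
  next
    case False
    then have lt: "Suc b < Suc k0 + q" using b(2) by simp
    have "w \<noteq> st (Suc b)" using w(1) cov_seg[of "Suc b" "st (Suc b)"] st_en(1)[of "Suc b"] lt c(2) by auto
    then have "w < st (Suc b)" using w(3) by simp
    moreover have "c \<le> w" using less.prems(4,5) stab w1 by simp
    moreover have "Suc k0 + q - Suc b < Suc k0 + q - a" "Suc k0 \<le> Suc b" using lt ab less.prems(1) by linarith+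
    ultimately have "\<exists>T. T \<subseteq> {j \<in> J. w < pos c j} \<and> chain group (Suc b) (Suc k0 + q) T"
      using less.hyps lt w(1) by blast
    then obtain T where T: "T \<subseteq> {j \<in> J. w < pos c j}" "chain group (Suc b) (Suc k0 + q) T" by blast
    have "S \<inter> T = {}" using T(1) unfolding S_def by auto
    from step[OF this T(2)] have "chain group a (Suc k0 + q) (S \<union> T)" .
    moreover have "S \<union> T \<subseteq> {j \<in> J. y < pos c j}"
      using T(1) less.prems(5) stab w1 unfolding S_def by auto
    ultimately show ?thesis by (intro exI conjI)
  qed
qed

end

theorem exists_chain: "\<exists>r S. r \<le> q \<and> S \<subseteq> J \<and> chain group r (r + q) S"
proof (cases "\<forall>x. st 0 \<le> x \<and> x < st 0 + L \<longrightarrow> cov x")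
  case True
  then have full: "L \<le> (\<Sum>j \<in> J. l j)" using full_cover[of "st 0"] by blast
  have "en (q - 1) \<le> st q" using st_en(2)[of "q - 1"] q by simp
  then have "en (q - 1) - st 0 \<le> L" using shift(1)[of 0] by simp
  moreover have "J \<noteq> {}" using full L by auto
  ultimately have "group 0 (q - 1) J" unfolding group_def using full by simp
  from chain_step[of group, OF this, of "{}" q] have "chain group 0 q J"
    using q by (simp add: chain_nil)
  then show ?thesis by (intro exI[of _ 0] exI[of _ J]) simp
next
  case False
  then obtain c where c: "\<not> cov c" "st 0 \<le> c" "c < st 0 + L" by blast
  then have "c < st q" using shift(1)[of 0] by simp
  then obtain k where k: "k < q" "st k \<le> c" "c < st (Suc k)" using locate[of 0 q c] q c(2) by (metis le_add1 mult_2)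
  have "en k \<le> c" using cov_seg[of k c] c(1) k by force
  with c k have ctx: "\<not> cov c" "k < q" "en k \<le> c" "c \<le> st (Suc k)" by auto
  from chain_from[OF ctx, of "Suc k" c] k(3) q c(1)
  obtain S where "S \<subseteq> {j \<in> J. c < pos c j}" "chain group (Suc k) (Suc k + q) S" by auto
  then show ?thesis using k(1) by (intro exI[of _ "Suc k"] exI[of _ S]) auto
qed

end

section \<open>From covers to paths\<close>

lemma span_start_Suc: "k < 2 * length xs \<Longrightarrow>
  span_start xs (Suc k) = span_start xs k + (fst ((xs @ xs) ! k) + snd ((xs @ xs) ! k))"
  unfolding span_start_def by (subst take_Suc_conv_app_nth) (simp_all del: take_append)

lemma span_start_0 [simp]: "span_start xs 0 = 0"
  by (simp add: span_start_def)

lemma span_start_le_end: "span_start xs k \<le> span_end xs k"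
  by (simp add: span_end_def)

lemma span_end_le_start: "k < 2 * length xs \<Longrightarrow> span_end xs k \<le> span_start xs (Suc k)"
  by (simp add: span_end_def span_start_Suc)

lemma span_start_shift: "k \<le> length xs \<Longrightarrow> span_start xs (k + length xs) = span_start xs k + span_start xs (length xs)"
  by (simp add: span_start_def)

lemma span_end_shift: "k < length xs \<Longrightarrow> span_end xs (k + length xs) = span_end xs k + span_start xs (length xs)"
  by (simp add: span_end_def span_start_shift nth_append)

lemma span_start_mono: "a \<le> b \<Longrightarrow> b \<le> 2 * length xs \<Longrightarrow> span_start xs a \<le> span_start xs b"
proof (induction b rule: dec_induct)
  case (step n)
  then show ?case using span_start_le_end[of xs n] span_end_le_start[of n xs] by simp
qed simp

lemma enumerate_conv_map: "List.enumerate 0 xs = map (\<lambda>i. (i, xs ! i)) [0..<length xs]"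
  by (rule nth_equalityI) (simp_all add: nth_enumerate_eq)

lemma filter_less_upt: "n \<le> K \<Longrightarrow> filter (\<lambda>x. x < n) [0..<K] = [0..<n]"
proof -
  assume "n \<le> K"
  then have "[0..<K] = [0..<n] @ [n..<K]" using upt_add_eq_append[of 0 n "K - n"] by simp
  then show ?thesis by (simp add: filter_empty_conv)
qed

lemma Suc_le_prod_list: "p \<in> set ts \<Longrightarrow> Suc (f p) \<le> prod_list (map (\<lambda>p. Suc (f p)) ts)"
proof (induction ts)
  case (Cons q ts)
  have "1 \<le> prod_list (map (\<lambda>p. Suc (f p)) ts)" by (induction ts) auto
  then have "Suc (f q) * 1 \<le> Suc (f q) * prod_list (map (\<lambda>p. Suc (f p)) ts)" by (intro mult_le_mono2)
  moreover have "1 * prod_list (map (\<lambda>p. Suc (f p)) ts) \<le> Suc (f q) * prod_list (map (\<lambda>p. Suc (f p)) ts)"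
    by (intro mult_le_mono1) simp
  ultimately show ?case using Cons by (cases "p = q") auto
qed simp

lemma chain_le: "chain G a e S \<Longrightarrow> a \<le> e"
  by (induction rule: chain.induct) auto

text \<open>
  An instance together with its integral data: all lengths are multiples of \<open>1 / Q\<close>.
\<close>

locale opg =
  fixes I :: opg_instance and ips :: "(nat \<times> nat) list list" and ts :: "(nat \<times> nat) list" and Q :: nat
  assumes valid: "valid_instance I" and Q: "0 < Q"
    and perims: "perimeters I = map (map (\<lambda>x. (real (fst x) / real Q, real (snd x) / real Q))) ips"
    and types: "robot_types I = ts"
begin

definition U :: "nat list" where "U = [0..<prod_list (map (\<lambda>p. Suc (fst p)) ts)]"
definition RS :: "robot list" where "RS = robots U ts"
definition V :: "nat list list" where "V = vectors U ts"
definition E :: "move list" where "E = moves (hops ips) V ts"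
definition Z :: "nat list" where "Z = map (\<lambda>_. 0) ts"
definition N :: "nat list" where "N = map fst ts"

abbreviation "m \<equiv> length ips"
abbreviation "n \<equiv> length RS"

lemma num_regions: "num_regions I = m"
  by (simp add: num_regions_def perims)

lemma m_pos: "0 < m"
  using valid by (auto simp: valid_instance_def perims)

lemma perim_nth: "i < m \<Longrightarrow> perimeters I ! i = map (\<lambda>x. (real (fst x) / real Q, real (snd x) / real Q)) (ips ! i)"
  by (simp add: perims)

lemma q_pos: "i < m \<Longrightarrow> 0 < length (ips ! i)"
proof -
  assume i: "i < m"
  then have "valid_perimeter (perimeters I ! i)" using valid
    unfolding valid_instance_def perims by simp
  then show ?thesis unfolding valid_perimeter_def perim_nth[OF i] by auto
qed

lemma perimeter_length_take:
  assumes "k \<le> length xs"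
  shows "perimeter_length (take k (map (\<lambda>x. (real (fst x) / real Q, real (snd x) / real Q)) xs)) = real (span_start xs k) / Q"
  using assms
proof (induction k)
  case (Suc k)
  then show ?case
    by (simp add: take_Suc_conv_app_nth perimeter_length_def span_start_Suc nth_append add_divide_distrib)
qed (simp add: perimeter_length_def)

lemma boundary_length: "i < m \<Longrightarrow> boundary_length I i = real (span_start (ips ! i) (length (ips ! i))) / Q"
  using perimeter_length_take[of "length (ips ! i)" "ips ! i"] by (simp add: boundary_length_def perim_nth)

lemma segment_start: "i < m \<Longrightarrow> k \<le> length (ips ! i) \<Longrightarrow>
  segment_start (perimeters I ! i) k = real (span_start (ips ! i) k) / Q"
  unfolding segment_start_def perim_nth by (rule perimeter_length_take)

lemma guarded_eq: "i < m \<Longrightarrow> guarded I \<gamma> i =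
  (\<Union>k < length (ips ! i). \<gamma> i ` {real (span_start (ips ! i) k) / Q..real (span_end (ips ! i) k) / Q})"
proof -
  assume i: "i < m"
  have len: "length (perimeters I ! i) = length (ips ! i)" by (simp add: perim_nth[OF i])
  have fst: "fst (perimeters I ! i ! k) = real (fst (ips ! i ! k)) / Q" if "k < length (ips ! i)" for k
    using that by (simp add: perim_nth[OF i])
  show ?thesis unfolding guarded_def Let_def len
    by (intro SUP_cong refl) (simp add: segment_start[OF i] fst span_end_def nth_append add_divide_distrib)
qed

lemma RS_eq: "RS = concat (map (\<lambda>k. map (\<lambda>x. (k, x, snd (ts ! k))) [0..<fst (ts ! k)]) [0..<length ts])"
proof -
  have "filter (\<lambda>x. x < fst (ts ! k)) U = [0..<fst (ts ! k)]" if "k < length ts" for k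
    unfolding U_def using Suc_le_prod_list[of "ts ! k" ts fst] that by (intro filter_less_upt) simp
  then show ?thesis unfolding RS_def robots_def enumerate_conv_map
    by (auto simp: comp_def intro!: arg_cong[where f = concat])
qed

lemma set_RS: "set RS = {(k, x, a). k < length ts \<and> x < fst (ts ! k) \<and> a = snd (ts ! k)}"
  unfolding RS_eq by auto

lemma distinct_RS: "distinct RS"
proof -
  have "distinct (concat (map (\<lambda>k. map (\<lambda>x. (k, x, f k)) [0..<g k]) [0..<t]))" for f g :: "nat \<Rightarrow> nat" and t
    by (induction t) (auto simp: distinct_map inj_on_def)
  then show ?thesis unfolding RS_eq .
qed

lemma capabilities_eq: "capabilities I = map (\<lambda>\<rho>. snd (snd \<rho>)) RS"
proof -
  have "capabilities I = concat (map (\<lambda>p. replicate (fst p) (snd p)) (map ((!) ts) [0..<length ts]))"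
    by (simp add: capabilities_def types map_nth case_prod_unfold)
  also have "\<dots> = map (\<lambda>\<rho>. snd (snd \<rho>)) RS"
    unfolding RS_eq by (simp add: map_concat comp_def map_replicate_const)
  finally show ?thesis .
qed

lemma num_robots: "num_robots I = n"
proof -
  have "length (capabilities I) = num_robots I"
    by (simp add: capabilities_def num_robots_def length_concat comp_def case_prod_unfold)
  then show ?thesis by (simp add: capabilities_eq)
qed

definition rtype :: "nat \<Rightarrow> nat" where "rtype j = fst (RS ! j)"
definition cap :: "nat \<Rightarrow> nat" where "cap j = snd (snd (RS ! j))"

lemma capability: "j < n \<Longrightarrow> capabilities I ! j = cap j"
  by (simp add: capabilities_eq cap_def)

lemma ts_pos: "k < length ts \<Longrightarrow> 0 < snd (ts ! k)"
  using valid unfolding valid_instance_def types by (force simp: in_set_conv_nth case_prod_beta)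

lemma rtype_cap: "j < n \<Longrightarrow> rtype j < length ts \<and> cap j = snd (ts ! rtype j)"
  using nth_mem[of j RS] unfolding set_RS by (auto simp: rtype_def cap_def)

lemma cap_pos: "j < n \<Longrightarrow> 0 < cap j"
  using rtype_cap ts_pos by simp

definition cnt :: "nat set \<Rightarrow> nat list" where
  "cnt S = map (\<lambda>k. card {j \<in> S. rtype j = k}) [0..<length ts]"

lemma length_cnt [simp]: "length (cnt S) = length ts"
  by (simp add: cnt_def)

lemma nth_cnt: "k < length ts \<Longrightarrow> cnt S ! k = card {j \<in> S. rtype j = k}"
  by (simp add: cnt_def)

lemma card_type: "k < length ts \<Longrightarrow> card {j. j < n \<and> rtype j = k} = fst (ts ! k)"
proof -
  assume k: "k < length ts"
  have "card {j. j < n \<and> rtype j = k} = length (filter (\<lambda>\<rho>. fst \<rho> = k) RS)"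
    by (simp add: length_filter_conv_card rtype_def)
  also have "\<dots> = card (set (filter (\<lambda>\<rho>. fst \<rho> = k) RS))"
    using distinct_RS by (intro distinct_card[symmetric] distinct_filter)
  also have "set (filter (\<lambda>\<rho>. fst \<rho> = k) RS) = (\<lambda>x. (k, x, snd (ts ! k))) ` {..<fst (ts ! k)}"
    using k by (auto simp: set_RS)
  also have "card \<dots> = fst (ts ! k)" by (subst card_image) (auto simp: inj_on_def)
  finally show ?thesis .
qed

lemma mem_V: "v \<in> set V \<longleftrightarrow> length v = length ts \<and> (\<forall>k < length ts. v ! k \<le> fst (ts ! k))"
  unfolding V_def
proof (rule mem_vectors)
  fix p assume "p \<in> set ts"
  then show "{..fst p} \<subseteq> set U" unfolding U_def using Suc_le_prod_list[of p ts fst] by auto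
qed

lemma cnt_V: "S \<subseteq> {..<n} \<Longrightarrow> cnt S \<in> set V"
proof -
  assume S: "S \<subseteq> {..<n}"
  have "card {j \<in> S. rtype j = k} \<le> card {j. j < n \<and> rtype j = k}" for k
    using S by (intro card_mono) auto
  then have "card {j \<in> S. rtype j = k} \<le> fst (ts ! k)" if "k < length ts" for k
    using card_type[OF that] by metis
  then show ?thesis unfolding mem_V by (simp add: nth_cnt)
qed

lemma cnt_Un:
  assumes "finite S" "finite T" "S \<inter> T = {}" "k < length ts"
  shows "cnt (S \<union> T) ! k = cnt S ! k + cnt T ! k"
proof -
  have "{j \<in> S \<union> T. rtype j = k} = {j \<in> S. rtype j = k} \<union> {j \<in> T. rtype j = k}" by auto
  moreover have "card \<dots> = card {j \<in> S. rtype j = k} + card {j \<in> T. rtype j = k}"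
    using assms by (intro card_Un_disjoint) auto
  ultimately show ?thesis using assms(4) by (simp add: nth_cnt)
qed

lemma capacity_cnt:
  assumes "S \<subseteq> {..<n}" "T \<subseteq> {..<n}" "S \<inter> T = {}"
  shows "capacity ts (cnt S) (cnt (S \<union> T)) = (\<Sum>j \<in> T. cap j)"
proof -
  have fin: "finite S" "finite T" using assms by (auto intro: finite_subset)
  have "capacity ts (cnt S) (cnt (S \<union> T)) = (\<Sum>k < length ts. (cnt (S \<union> T) ! k - cnt S ! k) * snd (ts ! k))"
    by (rule capacity_eq) simp_all
  also have "\<dots> = (\<Sum>k < length ts. (\<Sum>j \<in> {j \<in> T. rtype j = k}. cap j))"
  proof (intro sum.cong refl)
    fix k assume "k \<in> {..<length ts}"
    then have k: "k < length ts" by simp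
    have "(\<Sum>j \<in> {j \<in> T. rtype j = k}. cap j) = (\<Sum>j \<in> {j \<in> T. rtype j = k}. snd (ts ! k))"
      using rtype_cap assms(2) by (intro sum.cong) auto
    then show "(cnt (S \<union> T) ! k - cnt S ! k) * snd (ts ! k) = (\<Sum>j \<in> {j \<in> T. rtype j = k}. cap j)"
      using cnt_Un[OF fin assms(3) k] by (simp add: nth_cnt[OF k])
  qed
  also have "\<dots> = (\<Sum>j \<in> T. cap j)"
    using fin(2) rtype_cap assms(2) by (intro sum.group) auto
  finally show ?thesis .
qed

definition ends_at :: "move list \<Rightarrow> nat list \<Rightarrow> nat list \<Rightarrow> bool" where
  "ends_at P x u \<longleftrightarrow> (case P of [] \<Rightarrow> x = [0, 0, 0] \<and> u = Z | e # _ \<Rightarrow> hop_dst (mv_hop e) = x \<and> mv_after e = u)"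

lemma fits_iff: "fits Z e P \<longleftrightarrow> ends_at P (hop_src (mv_hop e)) (mv_before e)"
  by (auto simp: fits_def ends_at_def split: list.split)

lemma caps_E: "caps_pos E"
  by (auto simp: caps_pos_def E_def mem_moves)

definition reach :: "real \<Rightarrow> nat list \<Rightarrow> nat list \<Rightarrow> bool" where
  "reach c x u \<longleftrightarrow> (\<exists>P. is_path E Z P \<and> ends_at P x u \<and> (\<forall>e \<in> set P. mv_val e \<le> c))"

lemma reach_step:
  assumes "reach c x u" "h \<in> set (hops ips)" "hop_src h = x" "u \<in> set V" "v \<in> set V" "below u v"
    "0 < capacity ts u v" "real (hop_len h) \<le> c * real (capacity ts u v)"
  shows "reach c (hop_dst h) v"
proof -
  from assms(1) obtain P where P: "is_path E Z P" "ends_at P x u" "\<forall>e \<in> set P. mv_val e \<le> c"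
    unfolding reach_def by blast
  let ?e = "(h, (u, v), capacity ts u v) :: move"
  have "?e \<in> set E" using assms unfolding E_def mem_moves by (simp add: mv_defs)
  moreover have "fits Z ?e P" using P(2) assms(3) by (simp add: fits_iff mv_defs)
  moreover have "mv_val ?e \<le> c" using assms(7,8) by (simp add: frac_val_def mv_defs divide_le_eq)
  ultimately have "is_path E Z (?e # P)" "\<forall>e \<in> set (?e # P). mv_val e \<le> c" using P by auto
  moreover have "ends_at (?e # P) (hop_dst h) v" by (simp add: ends_at_def mv_defs)
  ultimately show ?thesis unfolding reach_def by blast
qed

text \<open>
  A cut of a boundary into groups is turned into moves one group after the other. The conditional
  is the state before segment \<open>a\<close>: the region is exhausted, not yet entered, or entered with rotation \<open>r\<close>.
\<close>

lemma reach_chain: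
  assumes "chain G a e S" "i < m" "e = r + length (ips ! i)" "r \<le> length (ips ! i)" "r \<le> a"
    and G: "\<And>a b S. G a b S \<Longrightarrow> S \<noteq> {} \<and> S \<subseteq> J \<and>
      real (span_end (ips ! i) b) - real (span_start (ips ! i) a) \<le> c * (\<Sum>j \<in> S. real (cap j))"
    and J: "J \<subseteq> {..<n}" and T: "T \<subseteq> {..<n}" "T \<inter> J = {}"
    and "reach c (if a = e then [Suc i, 0, 0] else if a = r then [i, 0, 0] else [i, Suc r, a]) (cnt T)"
  shows "reach c [Suc i, 0, 0] (cnt (T \<union> S))"
proof -
  have "S' \<subseteq> J \<Longrightarrow> reach c [Suc i, 0, 0] (cnt (T \<union> S' \<union> S))"
    if "S' \<inter> S = {}"
      "reach c (if a = e then [Suc i, 0, 0] else if a = r then [i, 0, 0] else [i, Suc r, a]) (cnt (T \<union> S'))" for S'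
    using assms(1,3,5) that
  proof (induction arbitrary: S' rule: chain.induct)
    case (chain_nil a)
    then show ?case by simp
  next
    case (chain_step a b S1 S2 e)
    have g: "S1 \<noteq> {}" "S1 \<subseteq> J" "real (span_end (ips ! i) b) - real (span_start (ips ! i) a) \<le> c * (\<Sum>j \<in> S1. real (cap j))"
      using G[OF chain_step.hyps(1)] by auto
    have be: "Suc b \<le> r + length (ips ! i)" using chain_le[OF chain_step.hyps(4)] chain_step.prems by simp
    let ?h = "(i, r, a, b, length (ips ! i), span_start (ips ! i) a, span_end (ips ! i) b - span_start (ips ! i) a) :: hop"
    have h: "?h \<in> set (hops ips)"
      unfolding mem_hops using assms(2,4) chain_step be by auto
    have "a \<noteq> e" using be chain_step by simp
    have src: "hop_src ?h = (if a = e then [Suc i, 0, 0] else if a = r then [i, 0, 0] else [i, Suc r, a])"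
      using \<open>a \<noteq> e\<close> by (simp add: hop_src_def hop_defs)
    have dst: "hop_dst ?h = (if Suc b = e then [Suc i, 0, 0] else if Suc b = r then [i, 0, 0] else [i, Suc r, Suc b])"
      using chain_step by (simp add: hop_dst_def hop_defs)
    let ?W = "T \<union> S'"
    have W: "?W \<subseteq> {..<n}" "S1 \<subseteq> {..<n}" "?W \<inter> S1 = {}"
      using T J g(2) chain_step.prems by auto
    have cap: "capacity ts (cnt ?W) (cnt (?W \<union> S1)) = (\<Sum>j \<in> S1. cap j)"
      by (rule capacity_cnt[OF W])
    have fin: "finite ?W" "finite S1" using W(1,2) by (meson finite_lessThan finite_subset)+
    have "reach c (hop_dst ?h) (cnt (?W \<union> S1))"
    proof (rule reach_step[OF _ h src])
      show "reach c (if a = e then [Suc i, 0, 0] else if a = r then [i, 0, 0] else [i, Suc r, a]) (cnt ?W)"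
        using chain_step.prems by blast
      show "cnt ?W \<in> set V" "cnt (?W \<union> S1) \<in> set V" using W by (auto intro!: cnt_V)
      show "below (cnt ?W) (cnt (?W \<union> S1))"
        by (subst below_iff) (simp_all add: cnt_Un[OF fin W(3)])
      obtain j where "j \<in> S1" using g(1) by blast
      then have "0 < cap j" using cap_pos W(2) by blast
      also have "cap j \<le> (\<Sum>j \<in> S1. cap j)" using \<open>j \<in> S1\<close> fin(2) by (intro member_le_sum) auto
      finally show "0 < capacity ts (cnt ?W) (cnt (?W \<union> S1))" unfolding cap .
      have "span_start (ips ! i) a \<le> span_start (ips ! i) b"
        using chain_step.hyps(2) be assms(4) by (intro span_start_mono) auto
      then have "span_start (ips ! i) a \<le> span_end (ips ! i) b" using span_start_le_end le_trans by blast
      then show "real (hop_len ?h) \<le> c * real (capacity ts (cnt ?W) (cnt (?W \<union> S1)))"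
        using g(3) unfolding cap by (simp add: hop_len_def of_nat_diff)
    qed
    then have "reach c (if Suc b = e then [Suc i, 0, 0] else if Suc b = r then [i, 0, 0] else [i, Suc r, Suc b]) (cnt (T \<union> (S' \<union> S1)))"
      unfolding dst by (simp only: Un_assoc)
    then have "reach c [Suc i, 0, 0] (cnt (T \<union> (S' \<union> S1) \<union> S2))"
      using chain_step.prems chain_step.hyps(2,3) g(2) by (intro chain_step.IH) auto
    then show ?case by (simp only: Un_assoc)
  qed
  from this[of "{}"] assms(10) show ?thesis by simp
qed

end

context opg
begin

lemma Z_cnt: "cnt {} = Z"
  by (simp add: cnt_def Z_def map_replicate_const)

text \<open>
  Robots that are left over join the last group. This increases its capability, so no
  weight grows, and all robots receive an arc.
\<close>

lemma reach_complete:
  assumes "reach c [m, 0, 0] u" "0 \<le> c"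
  shows "\<exists>P. is_path E Z P \<and> finished m N P \<and> path_val P \<le> c"
proof -
  obtain P where P: "is_path E Z P" "ends_at P [m, 0, 0] u" "\<forall>e \<in> set P. mv_val e \<le> c"
    using assms(1) unfolding reach_def by blast
  from P(2) m_pos obtain e P' where e: "P = e # P'" by (cases P) (auto simp: ends_at_def)
  have eE: "e \<in> set E" using P(1) e by simp
  then have eV: "mv_before e \<in> set V" "mv_after e \<in> set V" and hop: "mv_hop e \<in> set (hops ips)"
    and below: "below (mv_before e) (mv_after e)"
    and cap: "mv_cap e = capacity ts (mv_before e) (mv_after e)" "0 < mv_cap e"
    unfolding E_def mem_moves by auto
  have len: "length (mv_before e) = length ts" "length (mv_after e) = length ts" "length N = length ts"
    using eV unfolding mem_V by (simp_all add: N_def)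
  let ?c = "capacity ts (mv_before e) N"
  let ?e = "(mv_hop e, (mv_before e, N), ?c) :: move"
  have "mv_after e ! k \<le> N ! k" if "k < length ts" for k using eV(2) that unfolding mem_V by (simp add: N_def)
  then have le: "mv_cap e \<le> ?c"
    unfolding cap(1) capacity_eq[OF len(1,2)] capacity_eq[OF len(1,3)]
    by (intro sum_mono mult_le_mono1 diff_le_mono) auto
  have "?e \<in> set E" unfolding E_def mem_moves
  proof (intro conjI)
    show "mv_after ?e \<in> set V" unfolding mem_V by (simp add: mv_defs N_def)
    show "below (mv_before ?e) (mv_after ?e)" using eV(1) len unfolding mem_V by (simp add: below_iff mv_defs N_def)
  qed (use eV hop le cap in \<open>simp_all add: mv_defs\<close>)
  moreover have "fits Z ?e P'" using P(1) unfolding e by (simp add: fits_iff mv_defs)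
  ultimately have path: "is_path E Z (?e # P')" using P(1) e by simp
  have "mv_val ?e \<le> mv_val e"
    using le cap(2) by (simp add: frac_val_def mv_defs divide_left_mono)
  also have "\<dots> \<le> c" using P(3) e by simp
  finally have "path_val (?e # P') \<le> c"
    using assms(2) P(3) path_val_le_iff[OF is_path_caps[OF caps_E path]] by (simp add: e)
  moreover have "finished m N (?e # P')" using P(2) unfolding e by (simp add: finished_def ends_at_def mv_defs)
  ultimately show ?thesis using path by blast
qed

lemma cost_bound:
  assumes "is_cover I \<gamma> C" "j < n"
  shows "arc_len (C ! j) \<le> cost I C * cap j"
proof -
  have "arc_len (C ! j) / real (capabilities I ! j) \<le> cost I C"
    unfolding cost_def using assms(2) by (intro Max_ge) (auto simp: num_robots)
  then show ?thesis using cap_pos[OF assms(2)] by (simp add: capability[OF assms(2)] divide_le_eq)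
qed

context
  fixes R \<gamma>
  assumes real: "realises I R \<gamma>"
begin

lemma frontier_disjoint:
  assumes "i < m" "i' < m" "x \<in> frontier (R i)" "x \<in> frontier (R i')"
  shows "i = i'"
proof (rule ccontr)
  assume "i \<noteq> i'"
  then have "R i \<inter> R i' = {}" using real assms unfolding realises_def num_regions by blast
  moreover have "frontier (R k) \<subseteq> R k" if "k < m" for k
  proof -
    have "R k homeomorphic cball (0 :: real^2) 1" using real that unfolding realises_def num_regions by blast
    then have "compact (R k)" using homeomorphic_compactness compact_cball by blast
    then show ?thesis by (intro frontier_subset_closed compact_imp_closed)
  qed
  ultimately show False using assms by blast
qed

lemma param: "i < m \<Longrightarrow> arc_length_parametrisation (frontier (R i)) (boundary_length I i) (\<gamma> i)"
  using real unfolding realises_def num_regions by blast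

lemma gamma_eq: "i < m \<Longrightarrow> \<gamma> i x = \<gamma> i y \<longleftrightarrow> (\<exists>k :: int. y = x + of_int k * boundary_length I i)"
  using param unfolding arc_length_parametrisation_def by blast

lemma gamma_frontier: "i < m \<Longrightarrow> \<gamma> i x \<in> frontier (R i)"
  using param unfolding arc_length_parametrisation_def by blast

lemma boundary_pos: "i < m \<Longrightarrow> 0 < boundary_length I i"
  using param unfolding arc_length_parametrisation_def by blast

context
  fixes C
  assumes cover: "is_cover I \<gamma> C"
begin

lemma length_C: "length C = n"
  using cover unfolding is_cover_def num_robots by simp

lemma valid_C: "j < n \<Longrightarrow> fst (C ! j) < m \<and> 0 \<le> snd (snd (C ! j)) \<and> snd (snd (C ! j)) \<le> boundary_length I (fst (C ! j))"
proof -
  assume "j < n"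
  then have "C ! j \<in> set C" using length_C by simp
  then have "valid_arc I (C ! j)" using cover unfolding is_cover_def by blast
  then show ?thesis unfolding valid_arc_def num_regions by (simp add: case_prod_beta)
qed

definition crew_of :: "nat \<Rightarrow> nat set" where
  "crew_of i = {j. j < n \<and> fst (C ! j) = i}"

text \<open>
  A boundary with the arcs of a cover that lie on it, in the parametrisation by arc length. Since
  different boundaries are disjoint, no other arcs contain points of it.
\<close>

lemma circle:
  assumes i: "i < m"
  shows "circle_cover (length (ips ! i)) (boundary_length I i) (\<lambda>k. real (span_start (ips ! i) k) / Q)
    (\<lambda>k. real (span_end (ips ! i) k) / Q) (crew_of i) (\<lambda>j. fst (snd (C ! j))) (\<lambda>j. snd (snd (C ! j)))"
proof
  let ?q = "length (ips ! i)"
  show "0 < ?q" by (rule q_pos[OF i])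
  show "0 < boundary_length I i" by (rule boundary_pos[OF i])
  show "finite (crew_of i)" unfolding crew_of_def by simp
  show "real (span_start (ips ! i) k) / Q \<le> real (span_end (ips ! i) k) / Q" for k
    using span_start_le_end by (simp add: divide_right_mono)
  show "real (span_end (ips ! i) k) / Q \<le> real (span_start (ips ! i) (Suc k)) / Q" if "k < 2 * ?q" for k
    using span_end_le_start[OF that] by (simp add: divide_right_mono)
  show "real (span_start (ips ! i) (k + ?q)) / Q = real (span_start (ips ! i) k) / Q + boundary_length I i" if "k \<le> ?q" for k
    using span_start_shift[OF that] by (simp add: boundary_length[OF i] add_divide_distrib)
  show "real (span_end (ips ! i) (k + ?q)) / Q = real (span_end (ips ! i) k) / Q + boundary_length I i" if "k < ?q" for k
    using span_end_shift[OF that] by (simp add: boundary_length[OF i] add_divide_distrib)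
  show "0 \<le> snd (snd (C ! j))" "snd (snd (C ! j)) \<le> boundary_length I i" if "j \<in> crew_of i" for j
    using that valid_C[of j] unfolding crew_of_def by auto
  fix k x assume k: "k < ?q" "real (span_start (ips ! i) k) / Q \<le> x" "x \<le> real (span_end (ips ! i) k) / Q"
  then have "\<gamma> i x \<in> guarded I \<gamma> i" unfolding guarded_eq[OF i]
    by (intro UN_I[of k] imageI) auto
  then have "\<gamma> i x \<in> (\<Union>c \<in> set C. arc_points \<gamma> c)"
    using cover i unfolding is_cover_def num_regions by blast
  then obtain j where j: "j < n" "\<gamma> i x \<in> arc_points \<gamma> (C ! j)"
    using length_C by (auto simp: in_set_conv_nth)
  then obtain y where y: "\<gamma> i x = \<gamma> (fst (C ! j)) y" "fst (snd (C ! j)) \<le> y" "y \<le> fst (snd (C ! j)) + snd (snd (C ! j))"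
    unfolding arc_points_def by (auto simp: case_prod_beta)
  have "i = fst (C ! j)"
    using frontier_disjoint[OF i, of "fst (C ! j)" "\<gamma> i x"] gamma_frontier i valid_C[OF j(1)] y(1) by metis
  then have jc: "j \<in> crew_of i" and "\<gamma> i x = \<gamma> i y" using j(1) y(1) unfolding crew_of_def by auto
  then obtain z :: int where "y = x + of_int z * boundary_length I i" using gamma_eq[OF i] by blast
  then have "fst (snd (C ! j)) + of_int (- z) * boundary_length I i \<le> x"
    "x \<le> fst (snd (C ! j)) + of_int (- z) * boundary_length I i + snd (snd (C ! j))" using y by auto
  then show "\<exists>j \<in> crew_of i. \<exists>z :: int. fst (snd (C ! j)) + of_int z * boundary_length I i \<le> x \<and>
    x \<le> fst (snd (C ! j)) + of_int z * boundary_length I i + snd (snd (C ! j))" using jc by blast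
qed

lemma exists_path: "\<exists>P. is_path E Z P \<and> finished m N P \<and> path_val P \<le> cost I C * Q"
proof -
  let ?c = "cost I C * Q"
  have "\<exists>T. T \<subseteq> {j. j < n \<and> fst (C ! j) < i} \<and> reach ?c [i, 0, 0] (cnt T)" if "i \<le> m" for i
    using that
  proof (induction i)
    case 0
    have "reach ?c [0, 0, 0] (cnt {})" unfolding reach_def
      by (rule exI[of _ "[]"]) (simp add: ends_at_def Z_cnt)
    then show ?case by blast
  next
    case (Suc i)
    then have i: "i < m" by simp
    obtain T where T: "T \<subseteq> {j. j < n \<and> fst (C ! j) < i}" "reach ?c [i, 0, 0] (cnt T)"
      using Suc by auto
    interpret circle_cover "length (ips ! i)" "boundary_length I i" "\<lambda>k. real (span_start (ips ! i) k) / Q"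
      "\<lambda>k. real (span_end (ips ! i) k) / Q" "crew_of i" "\<lambda>j. fst (snd (C ! j))" "\<lambda>j. snd (snd (C ! j))"
      by (rule circle[OF i])
    obtain r S where S: "r \<le> length (ips ! i)" "S \<subseteq> crew_of i" "chain group r (r + length (ips ! i)) S"
      using exists_chain by blast
    have "reach ?c [Suc i, 0, 0] (cnt (T \<union> S))"
    proof (rule reach_chain[OF S(3) i refl S(1) le_refl])
      fix a b S' assume "group a b S'"
      then have g: "S' \<noteq> {}" "S' \<subseteq> crew_of i"
        "real (span_end (ips ! i) b) / Q - real (span_start (ips ! i) a) / Q \<le> (\<Sum>j \<in> S'. snd (snd (C ! j)))"
        unfolding group_def by auto
      have "snd (snd (C ! j)) \<le> cost I C * cap j" if "j \<in> S'" for j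
        using cost_bound[OF cover, of j] that g(2) unfolding crew_of_def by (auto simp: arc_len_def case_prod_beta)
      then have "(\<Sum>j \<in> S'. snd (snd (C ! j))) \<le> (\<Sum>j \<in> S'. cost I C * cap j)" by (rule sum_mono)
      with g(3) have "(real (span_end (ips ! i) b) - real (span_start (ips ! i) a)) / Q \<le> cost I C * (\<Sum>j \<in> S'. real (cap j))"
        by (simp add: sum_distrib_left diff_divide_distrib)
      then have "real (span_end (ips ! i) b) - real (span_start (ips ! i) a) \<le> cost I C * (\<Sum>j \<in> S'. real (cap j)) * Q"
        using Q by (simp add: divide_le_eq)
      then show "S' \<noteq> {} \<and> S' \<subseteq> crew_of i \<and>
          real (span_end (ips ! i) b) - real (span_start (ips ! i) a) \<le> ?c * (\<Sum>j \<in> S'. real (cap j))"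
        using g by (simp add: algebra_simps)
    next
      show "crew_of i \<subseteq> {..<n}" "T \<subseteq> {..<n}" "T \<inter> crew_of i = {}" using T(1) unfolding crew_of_def by auto
      show "reach ?c (if r = r + length (ips ! i) then [Suc i, 0, 0] else if r = r then [i, 0, 0] else [i, Suc r, r]) (cnt T)"
        using T(2) q_pos[OF i] by simp
    qed
    moreover have "T \<union> S \<subseteq> {j. j < n \<and> fst (C ! j) < Suc i}" using T(1) S(2) unfolding crew_of_def by auto
    ultimately show ?case by blast
  qed
  from this[of m] obtain T where T: "reach ?c [m, 0, 0] (cnt T)" by auto
  have "0 \<le> ?c"
  proof -
    obtain P where P: "ends_at P [m, 0, 0] (cnt T)" "\<forall>e \<in> set P. mv_val e \<le> ?c"
      using T unfolding reach_def by blast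
    with m_pos obtain e P' where "P = e # P'" by (cases P) (auto simp: ends_at_def)
    with P(2) have "mv_val e \<le> ?c" by simp
    moreover have "0 \<le> mv_val e" by (simp add: frac_val_def)
    ultimately show ?thesis by linarith
  qed
  from reach_complete[OF T this] show ?thesis .
qed

end

end

end

section \<open>From paths to covers\<close>

lemma concat_select:
  assumes "distinct (map fst A)" "t < length A"
  shows "concat (map (\<lambda>c. if fst c = fst (A ! t) then [snd c] else []) A) = [snd (A ! t)]"
  using assms
proof (induction A arbitrary: t)
  case (Cons c A)
  have none: "concat (map (\<lambda>c. if fst c = k then [snd c] else []) B) = []" if "k \<notin> fst ` set B" for k and B :: "('a \<times> 'b) list"
    using that by (induction B) auto
  show ?case
  proof (cases t)
    case 0
    then show ?thesis using Cons.prems none[of "fst c" A] by simp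
  next
    case (Suc t')
    then have "fst c \<noteq> fst (A ! t')" using Cons.prems by (metis Suc_less_eq distinct.simps(2) image_eqI length_Cons list.simps(9) list.set_map nth_mem)
    then show ?thesis using Cons Suc by simp
  qed
qed simp

lemma step_between:
  fixes f :: "nat \<Rightarrow> real"
  assumes "0 < k" "f 0 \<le> x" "x \<le> f k"
  shows "\<exists>t < k. f t \<le> x \<and> x \<le> f (Suc t)"
  using assms(1,3)
proof (induction k)
  case (Suc k)
  show ?case
  proof (cases "f k \<le> x")
    case True
    then show ?thesis using Suc.prems by blast
  next
    case False
    then have "0 < k" using assms(2) by (cases k) auto
    then show ?thesis using Suc False by (metis less_Suc_eq linear)
  qed
qed simp

definition precedes :: "move \<Rightarrow> move \<Rightarrow> bool" where
  "precedes f e \<longleftrightarrow> hop_region (mv_hop f) < hop_region (mv_hop e) \<or>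
     (hop_region (mv_hop f) = hop_region (mv_hop e) \<and> hop_rot (mv_hop f) = hop_rot (mv_hop e) \<and>
      hop_last (mv_hop f) < hop_first (mv_hop e))"

context opg
begin

lemma move_hop:
  assumes "e \<in> set E"
  defines "i \<equiv> hop_region (mv_hop e)" and "r \<equiv> hop_rot (mv_hop e)"
    and "a \<equiv> hop_first (mv_hop e)" and "b \<equiv> hop_last (mv_hop e)"
  shows "i < m" "r \<le> length (ips ! i)" "r \<le> a" "a \<le> b" "b < r + length (ips ! i)"
    "hop_count (mv_hop e) = length (ips ! i)" "hop_start (mv_hop e) = span_start (ips ! i) a"
    "hop_len (mv_hop e) = span_end (ips ! i) b - span_start (ips ! i) a"
proof -
  have "mv_hop e \<in> set (hops ips)" using assms(1) unfolding E_def mem_moves by blast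
  then show "i < m" "r \<le> length (ips ! i)" "r \<le> a" "a \<le> b" "b < r + length (ips ! i)"
    "hop_count (mv_hop e) = length (ips ! i)" "hop_start (mv_hop e) = span_start (ips ! i) a"
    "hop_len (mv_hop e) = span_end (ips ! i) b - span_start (ips ! i) a"
    unfolding mem_hops i_def r_def a_def b_def by (auto simp: hop_defs)
qed

lemma move_span:
  assumes "e \<in> set E"
  shows "hop_start (mv_hop e) + hop_len (mv_hop e) = span_end (ips ! hop_region (mv_hop e)) (hop_last (mv_hop e))"
proof -
  note h = move_hop[OF assms]
  have "span_start (ips ! hop_region (mv_hop e)) (hop_first (mv_hop e))
    \<le> span_start (ips ! hop_region (mv_hop e)) (hop_last (mv_hop e))"
    using h by (intro span_start_mono) auto
  also have "\<dots> \<le> span_end (ips ! hop_region (mv_hop e)) (hop_last (mv_hop e))" by (rule span_start_le_end)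
  finally show ?thesis using h by simp
qed

lemma move_vectors:
  assumes "e \<in> set E"
  shows "length (mv_before e) = length ts" "length (mv_after e) = length ts"
    "\<And>k. k < length ts \<Longrightarrow> mv_before e ! k \<le> mv_after e ! k"
    "\<And>k. k < length ts \<Longrightarrow> mv_after e ! k \<le> fst (ts ! k)"
    "mv_cap e = (\<Sum>k < length ts. (mv_after e ! k - mv_before e ! k) * snd (ts ! k))" "0 < mv_cap e"
proof -
  have e: "mv_before e \<in> set V" "mv_after e \<in> set V" "below (mv_before e) (mv_after e)"
    "mv_cap e = capacity ts (mv_before e) (mv_after e)" "0 < mv_cap e"
    using assms unfolding E_def mem_moves by auto
  show len: "length (mv_before e) = length ts" "length (mv_after e) = length ts" using e unfolding mem_V by auto
  show "mv_before e ! k \<le> mv_after e ! k" if "k < length ts" for k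
    using e(3) that len by (simp add: below_iff)
  show "mv_after e ! k \<le> fst (ts ! k)" if "k < length ts" for k
    using e(2) that unfolding mem_V by simp
  show "mv_cap e = (\<Sum>k < length ts. (mv_after e ! k - mv_before e ! k) * snd (ts ! k))"
    unfolding e(4) by (rule capacity_eq[OF len])
  show "0 < mv_cap e" by (rule e(5))
qed

lemma mem_crew:
  assumes "e \<in> set E"
  shows "(k, x, a) \<in> set (crew RS e) \<longleftrightarrow> k < length ts \<and> mv_before e ! k \<le> x \<and> x < mv_after e ! k \<and> a = snd (ts ! k)"
proof -
  note v = move_vectors[OF assms]
  have "(k, x, a) \<in> set (crew RS e) \<longleftrightarrow>
    (k, x, a) \<in> set RS \<and> k < length ts \<and> mv_before e ! k \<le> x \<and> x < mv_after e ! k"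
    unfolding crew_def enumerate_conv_map using v(1,2) by auto
  then show ?thesis unfolding set_RS using v(4)[of k] by auto
qed

lemma distinct_crew: "distinct (crew RS e)"
proof -
  have "distinct (concat (map (\<lambda>p. filter (\<lambda>\<rho>. fst \<rho> = fst p \<and> f p \<rho>) RS) ps))" if "distinct (map fst ps)"
    for f and ps :: "(nat \<times> nat \<times> nat) list"
    using that
  proof (induction ps)
    case (Cons p ps)
    have "\<rho> \<notin> set (concat (map (\<lambda>p. filter (\<lambda>\<rho>. fst \<rho> = fst p \<and> f p \<rho>) RS) ps))" if "fst \<rho> = fst p" for \<rho>
    proof
      assume "\<rho> \<in> set (concat (map (\<lambda>p. filter (\<lambda>\<rho>. fst \<rho> = fst p \<and> f p \<rho>) RS) ps))"
      then obtain p' where "p' \<in> set ps" "fst \<rho> = fst p'" by auto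
      then have "fst p \<in> fst ` set ps" using that by (metis image_eqI)
      then show False using Cons.prems by simp
    qed
    note new = this
    have "set (filter (\<lambda>\<rho>. fst \<rho> = fst p \<and> f p \<rho>) RS) \<inter>
      set (concat (map (\<lambda>p. filter (\<lambda>\<rho>. fst \<rho> = fst p \<and> f p \<rho>) RS) ps)) = {}"
    proof (intro Int_emptyI)
      fix \<rho> assume "\<rho> \<in> set (filter (\<lambda>\<rho>. fst \<rho> = fst p \<and> f p \<rho>) RS)"
      then have "fst \<rho> = fst p" by simp
      note new[OF this]
      moreover assume "\<rho> \<in> set (concat (map (\<lambda>p. filter (\<lambda>\<rho>. fst \<rho> = fst p \<and> f p \<rho>) RS) ps))"
      ultimately show False by (rule notE)
    qed
    moreover have "distinct (concat (map (\<lambda>p. filter (\<lambda>\<rho>. fst \<rho> = fst p \<and> f p \<rho>) RS) ps))"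
      using Cons by simp
    ultimately show ?case using distinct_RS by (simp only: list.map concat.simps distinct_append distinct_filter simp_thms)
  qed simp
  from this[of "List.enumerate 0 (zip (mv_before e) (mv_after e))"] show ?thesis
    unfolding crew_def by simp
qed

lemma crew_capacity:
  assumes "e \<in> set E"
  shows "sum_list (map (\<lambda>\<rho>. snd (snd \<rho>)) (crew RS e)) = mv_cap e"
proof -
  note v = move_vectors[OF assms]
  let ?S = "\<lambda>k. (\<lambda>x. (k, x, snd (ts ! k))) ` {mv_before e ! k..<mv_after e ! k}"
  have set: "set (crew RS e) = (\<Union>k \<in> {..<length ts}. ?S k)"
    using mem_crew[OF assms] by auto
  have "sum_list (map (\<lambda>\<rho>. snd (snd \<rho>)) (crew RS e)) = (\<Sum>\<rho> \<in> set (crew RS e). snd (snd \<rho>))"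
    by (rule sum_list_distinct_conv_sum_set[OF distinct_crew])
  also have "\<dots> = (\<Sum>k < length ts. \<Sum>\<rho> \<in> ?S k. snd (snd \<rho>))"
    unfolding set by (rule sum.UNION_disjoint) auto
  also have "\<dots> = mv_cap e"
    unfolding v(5) by (intro sum.cong refl, subst sum.reindex) (auto simp: inj_on_def)
  finally show ?thesis .
qed

definition end_vector :: "move list \<Rightarrow> nat list" where
  "end_vector P = (case P of [] \<Rightarrow> Z | e # _ \<Rightarrow> mv_after e)"

lemma end_vector_fits: "fits Z e P \<Longrightarrow> mv_before e = end_vector P"
  by (auto simp: fits_def end_vector_def split: list.splits)

text \<open>
  Each move has positive capability, hence increases the number of robots used.
\<close>

lemma path_length:
  assumes "is_path E Z P"
  shows "length P \<le> n"
proof -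
  have "length P \<le> (\<Sum>k < length ts. end_vector P ! k)" using assms
  proof (induction P)
    case (Cons e P)
    then have e: "e \<in> set E" and before: "mv_before e = end_vector P" using end_vector_fits by auto
    note v = move_vectors[OF e]
    have "\<exists>k < length ts. mv_before e ! k < mv_after e ! k"
    proof (rule ccontr)
      assume "\<not> (\<exists>k < length ts. mv_before e ! k < mv_after e ! k)"
      then have "mv_after e ! k - mv_before e ! k = 0" if "k < length ts" for k using that
        by (metis diff_is_0_eq leI)
      then have "mv_cap e = 0" unfolding v(5) by simp
      with v(6) show False by simp
    qed
    then have "(\<Sum>k < length ts. mv_before e ! k) < (\<Sum>k < length ts. mv_after e ! k)"
      using v(3) by (intro sum_strict_mono_ex1) auto
    moreover have "length P \<le> (\<Sum>k < length ts. mv_before e ! k)" unfolding before using Cons by simp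
    ultimately show ?case by (simp add: end_vector_def)
  qed simp
  also have "\<dots> \<le> (\<Sum>k < length ts. fst (ts ! k))"
    using assms move_vectors(4) by (intro sum_mono) (auto simp: end_vector_def Z_def split: list.split)
  also have "\<dots> = n"
    unfolding RS_eq by (simp add: length_concat comp_def sum_list_sum_nth atLeast0LessThan)
  finally show ?thesis .
qed

definition key :: "robot \<Rightarrow> nat \<times> nat" where
  "key \<rho> = (fst \<rho>, fst (snd \<rho>))"

text \<open>
  The vectors along a path telescope: each move continues the numbering of the robots where the move
  before it stopped.
\<close>

lemma path_keys:
  assumes "is_path E Z P"
  shows "distinct (concat (map (\<lambda>e. map key (crew RS e)) (rev P)))
    \<and> set (concat (map (\<lambda>e. map key (crew RS e)) (rev P))) = {(k, x). k < length ts \<and> x < end_vector P ! k}"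
  using assms
proof (induction P)
  case Nil
  then show ?case by (auto simp: end_vector_def Z_def)
next
  case (Cons e P)
  then have e: "e \<in> set E" and before: "mv_before e = end_vector P" using end_vector_fits by auto
  note v = move_vectors[OF e]
  have keys: "set (map key (crew RS e)) = {(k, x). k < length ts \<and> end_vector P ! k \<le> x \<and> x < mv_after e ! k}"
    using mem_crew[OF e] by (force simp: key_def before)
  have "inj_on key (set (crew RS e))"
    using mem_crew[OF e] by (auto simp: inj_on_def key_def)
  then have "distinct (map key (crew RS e))" using distinct_crew by (simp add: distinct_map)
  moreover have "k < length ts \<Longrightarrow> end_vector P ! k \<le> mv_after e ! k" for k using v(3) before by simp
  ultimately show ?case using Cons keys by (fastforce simp: end_vector_def[of "e # P"])
qed

lemma fits_link:
  assumes "fits Z e (f # P)"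
  shows "(Suc (hop_last (mv_hop f)) = hop_rot (mv_hop f) + hop_count (mv_hop f) \<and>
      hop_region (mv_hop e) = Suc (hop_region (mv_hop f)) \<and> hop_first (mv_hop e) = hop_rot (mv_hop e)) \<or>
    (hop_region (mv_hop e) = hop_region (mv_hop f) \<and> hop_rot (mv_hop e) = hop_rot (mv_hop f) \<and>
      hop_first (mv_hop e) = Suc (hop_last (mv_hop f)))"
  using assms unfolding fits_def by (auto simp: hop_src_def hop_dst_def split: if_splits)

lemma path_order:
  assumes "is_path E Z (e # P)" "f \<in> set P"
  shows "precedes f e"
  using assms
proof (induction P arbitrary: e)
  case (Cons g P)
  have ge: "precedes g e" using fits_link[of e g P] Cons.prems unfolding precedes_def by auto
  have g: "hop_first (mv_hop g) \<le> hop_last (mv_hop g)" using Cons.prems move_hop(4)[of g] by simp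
  show ?case
  proof (cases "f = g")
    case False
    then have "precedes f g" using Cons by simp
    with ge g show ?thesis unfolding precedes_def by auto
  qed (use ge in simp)
qed simp

definition visited :: "move list \<Rightarrow> nat \<Rightarrow> nat \<Rightarrow> bool" where
  "visited P i b \<longleftrightarrow> (\<exists>f \<in> set P. hop_region (mv_hop f) = i \<and> hop_first (mv_hop f) \<le> b \<and> b \<le> hop_last (mv_hop f))"

text \<open>
  The runs of a region with rotation \<open>r\<close> exhaust the \<open>q\<close> consecutive indices from \<open>r\<close> on, and these
  represent all residues modulo \<open>q\<close>.
\<close>

lemma visited_residue:
  assumes "e \<in> set E" "i = hop_region (mv_hop e)" "Suc (hop_last (mv_hop e)) = hop_rot (mv_hop e) + hop_count (mv_hop e)"
    "\<And>b. hop_rot (mv_hop e) \<le> b \<Longrightarrow> b \<le> hop_last (mv_hop e) \<Longrightarrow> visited P i b" "k < length (ips ! i)"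
  shows "visited P i k \<or> visited P i (k + length (ips ! i))"
  using move_hop[OF assms(1)] assms by (cases "hop_rot (mv_hop e) \<le> k") auto

lemma path_visits:
  assumes "is_path E Z (e # P)"
  shows "(\<forall>i < hop_region (mv_hop e). \<forall>k < length (ips ! i). visited (e # P) i k \<or> visited (e # P) i (k + length (ips ! i)))
    \<and> (\<forall>b. hop_rot (mv_hop e) \<le> b \<longrightarrow> b \<le> hop_last (mv_hop e) \<longrightarrow> visited (e # P) (hop_region (mv_hop e)) b)"
  using assms
proof (induction P arbitrary: e)
  case Nil
  then have "hop_region (mv_hop e) = 0" "hop_first (mv_hop e) = hop_rot (mv_hop e)"
    by (auto simp: fits_def hop_src_def split: if_splits)
  then show ?case by (simp add: visited_def)
next
  case (Cons f P)
  let ?i = "hop_region (mv_hop f)"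
  have f: "f \<in> set E" and path: "is_path E Z (f # P)" using Cons.prems by auto
  note IH = Cons.IH[OF path]
  have mono: "visited (f # P) i b \<Longrightarrow> visited (e # f # P) i b" for i b by (auto simp: visited_def)
  have here: "hop_first (mv_hop e) \<le> b \<Longrightarrow> b \<le> hop_last (mv_hop e) \<Longrightarrow> visited (e # f # P) (hop_region (mv_hop e)) b" for b
    by (auto simp: visited_def)
  have "fits Z e (f # P)" using Cons.prems by simp
  from fits_link[OF this] show ?case
  proof
    assume new: "Suc (hop_last (mv_hop f)) = hop_rot (mv_hop f) + hop_count (mv_hop f) \<and>
      hop_region (mv_hop e) = Suc ?i \<and> hop_first (mv_hop e) = hop_rot (mv_hop e)"
    have "visited (f # P) ?i k \<or> visited (f # P) ?i (k + length (ips ! ?i))" if "k < length (ips ! ?i)" for k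
      using visited_residue[OF f refl, of "f # P" k] new IH that by blast
    then have "visited (f # P) i k \<or> visited (f # P) i (k + length (ips ! i))"
      if "i < hop_region (mv_hop e)" "k < length (ips ! i)" for i k
      using IH that new less_Suc_eq by (cases "i = ?i") auto
    then show ?thesis using mono here new by metis
  next
    assume same: "hop_region (mv_hop e) = ?i \<and> hop_rot (mv_hop e) = hop_rot (mv_hop f) \<and>
      hop_first (mv_hop e) = Suc (hop_last (mv_hop f))"
    have "visited (e # f # P) (hop_region (mv_hop e)) b" if "hop_rot (mv_hop e) \<le> b" "b \<le> hop_last (mv_hop e)" for b
      using IH mono here[of b] that same by (cases "b \<le> hop_last (mv_hop f)") auto
    then show ?thesis using IH mono same by metis
  qed
qed

lemma complete_visits:
  assumes "is_path E Z P" "finished m N P" "i < m" "k < length (ips ! i)"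
  shows "visited P i k \<or> visited P i (k + length (ips ! i))"
proof -
  obtain e P' where P: "P = e # P'" using assms(2) by (cases P) (auto simp: finished_def)
  have e: "e \<in> set E" using assms(1) P by simp
  have dst: "hop_dst (mv_hop e) = [m, 0, 0]" using assms(2) P by (simp add: finished_def)
  then have last: "Suc (hop_last (mv_hop e)) = hop_rot (mv_hop e) + hop_count (mv_hop e)"
    "Suc (hop_region (mv_hop e)) = m" by (auto simp: hop_dst_def split: if_splits)
  have visits: "\<And>b. hop_rot (mv_hop e) \<le> b \<Longrightarrow> b \<le> hop_last (mv_hop e) \<Longrightarrow> visited P (hop_region (mv_hop e)) b"
    "i < hop_region (mv_hop e) \<Longrightarrow> visited P i k \<or> visited P i (k + length (ips ! i))"
    using path_visits[of e P'] assms(1,4) unfolding P by blast+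
  show ?thesis
  proof (cases "i = hop_region (mv_hop e)")
    case True
    then show ?thesis using visited_residue[OF e True last(1), of P k] visits(1) assms(4) by blast
  next
    case False
    then have "i < hop_region (mv_hop e)" using last(2) assms(3) by simp
    then show ?thesis by (rule visits(2))
  qed
qed

end

definition arc_of :: "arc_data \<Rightarrow> robot_arc" where
  "arc_of c = (fst c, frac_val (fst (snd c)), frac_val (snd (snd c)))"

context opg
begin

definition unit_share :: "move \<Rightarrow> real" where
  "unit_share e = real (hop_len (mv_hop e)) / (real (mv_cap e) * Q)"

definition arc_pos :: "move \<Rightarrow> nat \<Rightarrow> real" where
  "arc_pos e t = real (hop_start (mv_hop e)) / Q
     + unit_share e * real (sum_list (map (\<lambda>\<rho>. snd (snd \<rho>)) (take t (crew RS e))))"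

lemma unit_share_nonneg: "0 \<le> unit_share e"
  by (simp add: unit_share_def)

lemma unit_share_eq: "unit_share e = mv_val e / Q"
  by (simp add: unit_share_def frac_val_def mv_weight_def)

lemma arc_pos_Suc: "t < length (crew RS e) \<Longrightarrow>
  arc_pos e (Suc t) = arc_pos e t + unit_share e * real (snd (snd (crew RS e ! t)))"
  by (simp add: arc_pos_def take_Suc_conv_app_nth algebra_simps)

lemma arc_pos_0: "arc_pos e 0 = real (hop_start (mv_hop e)) / Q"
  by (simp add: arc_pos_def)

lemma arc_pos_length:
  assumes "e \<in> set E"
  shows "arc_pos e (length (crew RS e)) = real (hop_start (mv_hop e) + hop_len (mv_hop e)) / Q"
  using move_vectors(6)[OF assms] Q
  by (simp add: arc_pos_def crew_capacity[OF assms] unit_share_def field_simps)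

lemma arc_pos_mono: "t \<le> t' \<Longrightarrow> t' \<le> length (crew RS e) \<Longrightarrow> arc_pos e t \<le> arc_pos e t'"
proof (induction t' rule: dec_induct)
  case (step t')
  then have "arc_pos e t' \<le> arc_pos e (Suc t')"
    using arc_pos_Suc[of t' e] unit_share_nonneg[of e] by simp
  with step show ?case by simp
qed simp

lemma length_placements: "length (placements Q RS e) = length (crew RS e)"
  by (simp add: placements_def)

lemma placements_nth:
  assumes e: "e \<in> set E" and t: "t < length (crew RS e)"
  shows "fst (placements Q RS e ! t) = key (crew RS e ! t)"
    "arc_of (snd (placements Q RS e ! t)) =
      (hop_region (mv_hop e), arc_pos e t, unit_share e * real (snd (snd (crew RS e ! t))))"
proof -
  let ?pre = "sum_list (map (\<lambda>\<rho>. snd (snd \<rho>)) (take t (crew RS e)))"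
  have ps: "prefix_sums 0 (map (\<lambda>\<rho>. (snd (snd \<rho>), (fst \<rho>, fst (snd \<rho>)))) (crew RS e)) ! t
    = (?pre, (snd (snd (crew RS e ! t)), key (crew RS e ! t)))"
    using t by (subst nth_prefix_sums) (simp_all add: take_map comp_def key_def)
  have A: "0 < mv_cap e" by (rule move_vectors(6)[OF e])
  show "fst (placements Q RS e ! t) = key (crew RS e ! t)"
    using t ps by (simp add: placements_def)
  have "frac_val (hop_start (mv_hop e) * mv_cap e + hop_len (mv_hop e) * ?pre, mv_cap e * Q) = arc_pos e t"
    using A Q by (simp add: frac_val_def arc_pos_def unit_share_def field_simps)
  moreover have "frac_val (hop_len (mv_hop e) * snd (snd (crew RS e ! t)), mv_cap e * Q)
    = unit_share e * real (snd (snd (crew RS e ! t)))"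
    by (simp add: frac_val_def unit_share_def)
  ultimately show "arc_of (snd (placements Q RS e ! t)) =
      (hop_region (mv_hop e), arc_pos e t, unit_share e * real (snd (snd (crew RS e ! t))))"
    using t ps by (simp add: placements_def arc_of_def)
qed

lemma placements_denominators:
  "c \<in> set (placements Q RS e) \<Longrightarrow> snd (fst (snd (snd c))) = mv_cap e * Q \<and> snd (snd (snd (snd c))) = mv_cap e * Q"
  by (auto simp: placements_def)

text \<open>
  The second inequality says that the later arc does not run into the earlier one from behind after
  a full turn around the boundary.
\<close>

definition in_order :: "robot_arc \<Rightarrow> robot_arc \<Rightarrow> bool" where
  "in_order x y \<longleftrightarrow> fst x \<noteq> fst y \<or>
     (fst (snd x) + snd (snd x) \<le> fst (snd y) \<and> fst (snd y) + snd (snd y) \<le> fst (snd x) + boundary_length I (fst x))"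

text \<open>
  The last run of a region ends before segment \<open>r + q\<close>, which is segment \<open>r\<close> one turn later.
\<close>

lemma window:
  assumes "e \<in> set E"
  defines "i \<equiv> hop_region (mv_hop e)" and "r \<equiv> hop_rot (mv_hop e)"
  shows "real (span_start (ips ! i) r) / Q \<le> arc_pos e 0"
    "arc_pos e (length (crew RS e)) \<le> real (span_start (ips ! i) r) / Q + boundary_length I i"
proof -
  note h = move_hop[OF assms(1)]
  have i: "i < m" using h(1) unfolding i_def .
  have "span_start (ips ! i) r \<le> hop_start (mv_hop e)"
    using h unfolding i_def r_def by (auto intro!: span_start_mono)
  then show "real (span_start (ips ! i) r) / Q \<le> arc_pos e 0" unfolding arc_pos_0 by (simp add: divide_right_mono)
  have "hop_start (mv_hop e) + hop_len (mv_hop e) = span_end (ips ! i) (hop_last (mv_hop e))"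
    using move_span[OF assms(1)] unfolding i_def .
  also have "\<dots> \<le> span_start (ips ! i) (Suc (hop_last (mv_hop e)))"
    using h unfolding i_def by (intro span_end_le_start) auto
  also have "\<dots> \<le> span_start (ips ! i) (r + length (ips ! i))"
    using h unfolding i_def r_def by (intro span_start_mono) auto
  also have "\<dots> = span_start (ips ! i) r + span_start (ips ! i) (length (ips ! i))"
    using h unfolding i_def r_def by (intro span_start_shift) auto
  finally have "real (hop_start (mv_hop e) + hop_len (mv_hop e))
    \<le> real (span_start (ips ! i) r + span_start (ips ! i) (length (ips ! i)))" by (simp only: of_nat_le_iff)
  then show "arc_pos e (length (crew RS e)) \<le> real (span_start (ips ! i) r) / Q + boundary_length I i"
    unfolding arc_pos_length[OF assms(1)] boundary_length[OF i] by (simp add: divide_right_mono add_divide_distrib[symmetric])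
qed

lemma precedes_pos:
  assumes "f \<in> set E" "e \<in> set E" "precedes f e" "hop_region (mv_hop f) = hop_region (mv_hop e)"
  shows "arc_pos f (length (crew RS f)) \<le> arc_pos e 0" "hop_rot (mv_hop f) = hop_rot (mv_hop e)"
proof -
  note h = move_hop[OF assms(2)] and hf = move_hop[OF assms(1)]
  let ?i = "hop_region (mv_hop e)"
  have p: "hop_rot (mv_hop f) = hop_rot (mv_hop e)" "hop_last (mv_hop f) < hop_first (mv_hop e)"
    using assms(3,4) unfolding precedes_def by auto
  show "hop_rot (mv_hop f) = hop_rot (mv_hop e)" by (rule p)
  have "hop_start (mv_hop f) + hop_len (mv_hop f) = span_end (ips ! ?i) (hop_last (mv_hop f))"
    using move_span[OF assms(1)] assms(4) by simp
  also have "\<dots> \<le> span_start (ips ! ?i) (Suc (hop_last (mv_hop f)))"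
    using h p by (intro span_end_le_start) auto
  also have "\<dots> \<le> hop_start (mv_hop e)"
    unfolding h(7) using h p by (intro span_start_mono) auto
  finally show "arc_pos f (length (crew RS f)) \<le> arc_pos e 0"
    unfolding arc_pos_length[OF assms(1)] arc_pos_0 by (intro divide_right_mono) auto
qed

definition all_placements :: "move list \<Rightarrow> ((nat \<times> nat) \<times> arc_data) list" where
  "all_placements P = concat (map (\<lambda>e. placements Q RS e) (rev P))"

lemma in_order_moves:
  assumes "f \<in> set E" "e \<in> set E" "t < length (crew RS f)" "t' < length (crew RS e)"
    and "precedes f e \<or> f = e \<and> t < t'"
  shows "in_order (arc_of (snd (placements Q RS f ! t))) (arc_of (snd (placements Q RS e ! t')))"
proof (cases "hop_region (mv_hop f) = hop_region (mv_hop e)")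
  case True
  have rot: "hop_rot (mv_hop f) = hop_rot (mv_hop e)" using assms(5) precedes_pos(2)[OF assms(1,2) _ True] by auto
  have "arc_pos f (Suc t) \<le> arc_pos e t'"
    using assms(5)
  proof
    assume "precedes f e"
    then have "arc_pos f (length (crew RS f)) \<le> arc_pos e 0" using precedes_pos(1)[OF assms(1,2) _ True] by blast
    then show ?thesis using arc_pos_mono[of "Suc t" "length (crew RS f)" f] arc_pos_mono[of 0 t' e] assms(3,4) by simp
  next
    assume "f = e \<and> t < t'"
    then show ?thesis using arc_pos_mono[of "Suc t" t' e] assms(4) by simp
  qed
  moreover have "arc_pos e (Suc t') \<le> arc_pos f t + boundary_length I (hop_region (mv_hop f))"
    using window(2)[OF assms(2)] window(1)[OF assms(1)] arc_pos_mono[of "Suc t'" "length (crew RS e)" e]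
      arc_pos_mono[of 0 t f] assms(3,4) unfolding True rot by simp
  ultimately show ?thesis using arc_pos_Suc[OF assms(3)] arc_pos_Suc[OF assms(4)] True
    unfolding in_order_def placements_nth(2)[OF assms(1,3)] placements_nth(2)[OF assms(2,4)] by simp
next
  case False
  then show ?thesis
    unfolding in_order_def placements_nth(2)[OF assms(1,3)] placements_nth(2)[OF assms(2,4)] by simp
qed

lemma mem_all_placements:
  "c \<in> set (all_placements P) \<longleftrightarrow> (\<exists>e \<in> set P. \<exists>t < length (crew RS e). c = placements Q RS e ! t)"
  by (auto simp: all_placements_def in_set_conv_nth length_placements)

lemma sorted_placements:
  assumes "is_path E Z P"
  shows "sorted_wrt (\<lambda>c d. in_order (arc_of (snd c)) (arc_of (snd d))) (all_placements P)"
  using assms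
proof (induction P)
  case Nil
  then show ?case by (simp add: all_placements_def)
next
  case (Cons e P)
  then have e: "e \<in> set E" and P: "is_path E Z P" by auto
  have eq: "all_placements (e # P) = all_placements P @ placements Q RS e" by (simp add: all_placements_def)
  have "sorted_wrt (\<lambda>c d. in_order (arc_of (snd c)) (arc_of (snd d))) (placements Q RS e)"
    unfolding sorted_wrt_iff_nth_less length_placements using in_order_moves[OF e e] by auto
  moreover have "in_order (arc_of (snd c)) (arc_of (snd d))"
    if c: "c \<in> set (all_placements P)" and d: "d \<in> set (placements Q RS e)" for c d
  proof -
    obtain f t where f: "f \<in> set P" "t < length (crew RS f)" "c = placements Q RS f ! t"
      using c unfolding mem_all_placements by blast
    obtain t' where t': "t' < length (crew RS e)" "d = placements Q RS e ! t'"
      using d by (auto simp: in_set_conv_nth length_placements)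
    have "f \<in> set E" using f(1) is_path_subset[OF P] by blast
    then show ?thesis unfolding f(3) t'(2)
      using in_order_moves[of f e t t'] e f(2) t'(1) path_order[OF Cons.prems f(1)] by blast
  qed
  ultimately show ?case using Cons.IH[OF P] unfolding eq sorted_wrt_append by blast
qed

lemma key_inj: "\<rho> \<in> set RS \<Longrightarrow> \<rho>' \<in> set RS \<Longrightarrow> key \<rho> = key \<rho>' \<Longrightarrow> \<rho> = \<rho>'"
  unfolding set_RS key_def by auto

text \<open>
  Along a path all robots are placed exactly once. So the output, which lists for each robot the
  placements with its key, has exactly one arc for each robot and uses each placement once.
\<close>

lemma arcs_index:
  assumes "is_path E Z P" "finished m N P"
  shows "\<exists>\<tau>. (\<forall>j < n. \<tau> j < length (all_placements P) \<and> fst (all_placements P ! \<tau> j) = key (RS ! j)) \<and>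
    inj_on \<tau> {..<n} \<and> \<tau> ` {..<n} = {..<length (all_placements P)} \<and>
    arcs_of_path Q RS P = map (\<lambda>j. snd (all_placements P ! \<tau> j)) [0..<n]"
proof -
  let ?A = "all_placements P"
  have "map fst (placements Q RS e) = map key (crew RS e)" if "e \<in> set P" for e
    using placements_nth(1)[of e] is_path_subset[OF assms(1)] that
    by (intro nth_equalityI) (auto simp: length_placements)
  then have "map fst ?A = concat (map (\<lambda>e. map key (crew RS e)) (rev P))"
    unfolding all_placements_def map_concat map_map by (intro arg_cong[where f = concat] map_cong) auto
  with path_keys[OF assms(1)] have dist: "distinct (map fst ?A)"
    and keys: "set (map fst ?A) = {(k, x). k < length ts \<and> x < end_vector P ! k}" by auto
  have "end_vector P = N" using assms(2) by (auto simp: finished_def end_vector_def split: list.splits)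
  then have keys: "set (map fst ?A) = key ` set RS"
    unfolding keys set_RS by (force simp: key_def N_def)
  have "\<exists>t. t < length ?A \<and> fst (?A ! t) = key (RS ! j)" if "j < n" for j
  proof -
    have "key (RS ! j) \<in> set (map fst ?A)" unfolding keys using that by simp
    then obtain t where "t < length (map fst ?A)" "map fst ?A ! t = key (RS ! j)"
      unfolding in_set_conv_nth by blast
    then show ?thesis by auto
  qed
  then obtain \<tau> where \<tau>: "\<And>j. j < n \<Longrightarrow> \<tau> j < length ?A" "\<And>j. j < n \<Longrightarrow> fst (?A ! \<tau> j) = key (RS ! j)"
    by metis
  have "inj_on \<tau> {..<n}"
  proof (rule inj_onI)
    fix j j' assume j: "j \<in> {..<n}" "j' \<in> {..<n}" "\<tau> j = \<tau> j'"
    then have "key (RS ! j) = key (RS ! j')" using \<tau>(2)[of j] \<tau>(2)[of j'] by simp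
    then have "RS ! j = RS ! j'" using key_inj j by simp
    then show "j = j'" using j distinct_RS by (simp add: nth_eq_iff_index_eq)
  qed
  moreover have "\<tau> ` {..<n} = {..<length ?A}"
  proof
    show "\<tau> ` {..<n} \<subseteq> {..<length ?A}" using \<tau>(1) by auto
    show "{..<length ?A} \<subseteq> \<tau> ` {..<n}"
    proof
      fix t assume t: "t \<in> {..<length ?A}"
      then have "fst (?A ! t) \<in> set (map fst ?A)" by simp
      then obtain j where j: "j < n" "fst (?A ! t) = key (RS ! j)" unfolding keys by (auto simp: in_set_conv_nth)
      then have "map fst ?A ! t = map fst ?A ! \<tau> j" using \<tau>[OF j(1)] t by simp
      then have "t = \<tau> j" using nth_eq_iff_index_eq[OF dist, of t "\<tau> j"] t \<tau>(1)[OF j(1)] by simp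
      then show "t \<in> \<tau> ` {..<n}" using j(1) by simp
    qed
  qed
  moreover have "arcs_of_path Q RS P = map (\<lambda>j. snd (?A ! \<tau> j)) [0..<n]"
  proof -
    let ?f = "\<lambda>\<rho>. concat (map (\<lambda>c. if fst (fst c) = fst \<rho> \<and> snd (fst c) = fst (snd \<rho>) then [snd c] else []) ?A)"
    have "?f (RS ! j) = [snd (?A ! \<tau> j)]" if "j < n" for j
    proof -
      have "?f (RS ! j) = concat (map (\<lambda>c. if fst c = fst (?A ! \<tau> j) then [snd c] else []) ?A)"
        using \<tau>(2)[OF that] by (simp add: key_def prod_eq_iff)
      then show ?thesis using concat_select[OF dist \<tau>(1)[OF that]] by simp
    qed
    then have "map ?f RS = map (\<lambda>j. [snd (?A ! \<tau> j)]) [0..<n]"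
      by (intro nth_equalityI) auto
    then have "concat (map ?f RS) = concat (map (\<lambda>j. [snd (?A ! \<tau> j)]) [0..<n])" by simp
    also have "\<dots> = map (\<lambda>j. snd (?A ! \<tau> j)) [0..<n]" by (induction RS) (auto simp: concat_map_singleton)
    finally show ?thesis unfolding arcs_of_path_def Let_def all_placements_def .
  qed
  ultimately show ?thesis using \<tau> by blast
qed

end

context opg
begin

definition path_cover :: "move list \<Rightarrow> robot_arc list" where
  "path_cover P = map arc_of (arcs_of_path Q RS P)"

context
  fixes P
  assumes path: "is_path E Z P" and finished: "finished m N P"
begin

lemma path_in_E: "e \<in> set P \<Longrightarrow> e \<in> set E"
  using is_path_subset[OF path] by blast

lemma path_cover_facts:
  "length (path_cover P) = n"
  "j < n \<Longrightarrow> \<exists>e \<in> set P. \<exists>t < length (crew RS e). RS ! j = crew RS e ! t \<and>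
     path_cover P ! j = (hop_region (mv_hop e), arc_pos e t, unit_share e * real (cap j))"
  "e \<in> set P \<Longrightarrow> t < length (crew RS e) \<Longrightarrow> \<exists>j < n. RS ! j = crew RS e ! t \<and>
     path_cover P ! j = (hop_region (mv_hop e), arc_pos e t, unit_share e * real (snd (snd (crew RS e ! t))))"
  "j < n \<Longrightarrow> k < n \<Longrightarrow> j \<noteq> k \<Longrightarrow>
     in_order (path_cover P ! j) (path_cover P ! k) \<or> in_order (path_cover P ! k) (path_cover P ! j)"
proof -
  let ?A = "all_placements P"
  obtain \<tau> where \<tau>: "\<And>j. j < n \<Longrightarrow> \<tau> j < length ?A" "\<And>j. j < n \<Longrightarrow> fst (?A ! \<tau> j) = key (RS ! j)"
    "inj_on \<tau> {..<n}" "\<tau> ` {..<n} = {..<length ?A}"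
    "arcs_of_path Q RS P = map (\<lambda>j. snd (?A ! \<tau> j)) [0..<n]"
    using arcs_index[OF path finished] by blast
  have C: "path_cover P ! j = arc_of (snd (?A ! \<tau> j))" if "j < n" for j
    using that by (simp add: path_cover_def \<tau>(5))
  show "length (path_cover P) = n" by (simp add: path_cover_def \<tau>(5))
  have crew_RS: "crew RS e ! t \<in> set RS" if "e \<in> set P" "t < length (crew RS e)" for e t
    using nth_mem[OF that(2)] by (auto simp: crew_def)
  have found: "RS ! j = crew RS e ! t \<and>
      path_cover P ! j = (hop_region (mv_hop e), arc_pos e t, unit_share e * real (snd (snd (crew RS e ! t))))"
    if "j < n" "e \<in> set P" "t < length (crew RS e)" "?A ! \<tau> j = placements Q RS e ! t" for j e t
  proof -
    note pl = placements_nth[OF path_in_E[OF that(2)] that(3)]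
    have "key (RS ! j) = key (crew RS e ! t)" using \<tau>(2)[OF that(1)] that(4) pl(1) by simp
    then have "RS ! j = crew RS e ! t" using key_inj crew_RS[OF that(2,3)] that(1) by simp
    then show ?thesis using C[OF that(1)] that(4) pl(2) by simp
  qed
  show "\<exists>e \<in> set P. \<exists>t < length (crew RS e). RS ! j = crew RS e ! t \<and>
     path_cover P ! j = (hop_region (mv_hop e), arc_pos e t, unit_share e * real (cap j))" if j: "j < n"
  proof -
    have "?A ! \<tau> j \<in> set ?A" using \<tau>(1)[OF j] by simp
    then obtain e t where e: "e \<in> set P" "t < length (crew RS e)" "?A ! \<tau> j = placements Q RS e ! t"
      unfolding mem_all_placements by blast
    from found[OF j this] e show ?thesis unfolding cap_def by metis
  qed
  show "\<exists>j < n. RS ! j = crew RS e ! t \<and>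
     path_cover P ! j = (hop_region (mv_hop e), arc_pos e t, unit_share e * real (snd (snd (crew RS e ! t))))"
    if e: "e \<in> set P" "t < length (crew RS e)"
  proof -
    have "placements Q RS e ! t \<in> set ?A" unfolding mem_all_placements using e by blast
    then obtain s where "s < length ?A" "?A ! s = placements Q RS e ! t" by (auto simp: in_set_conv_nth)
    moreover from this(1) obtain j where "j < n" "s = \<tau> j" using \<tau>(4) by blast
    ultimately show ?thesis using found[of j e t] e by blast
  qed
  show "in_order (path_cover P ! j) (path_cover P ! k) \<or> in_order (path_cover P ! k) (path_cover P ! j)"
    if jk: "j < n" "k < n" "j \<noteq> k"
  proof -
    have "\<tau> j \<noteq> \<tau> k" using \<tau>(3) jk by (auto dest: inj_onD)
    then show ?thesis
      using sorted_placements[OF path] \<tau>(1)[OF jk(1)] \<tau>(1)[OF jk(2)] C[OF jk(1)] C[OF jk(2)]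
      unfolding sorted_wrt_iff_nth_less by (metis linorder_neqE_nat)
  qed
qed

lemma arc_within:
  assumes "e \<in> set P" "t < length (crew RS e)"
  shows "arc_pos e t + unit_share e * real (snd (snd (crew RS e ! t))) = arc_pos e (Suc t)"
    "0 \<le> unit_share e * real (snd (snd (crew RS e ! t)))"
    "unit_share e * real (snd (snd (crew RS e ! t))) \<le> boundary_length I (hop_region (mv_hop e))"
proof -
  show eq: "arc_pos e t + unit_share e * real (snd (snd (crew RS e ! t))) = arc_pos e (Suc t)"
    using arc_pos_Suc[OF assms(2)] by simp
  show "0 \<le> unit_share e * real (snd (snd (crew RS e ! t)))"
    using unit_share_nonneg by simp
  show "unit_share e * real (snd (snd (crew RS e ! t))) \<le> boundary_length I (hop_region (mv_hop e))"
    using eq window[OF path_in_E[OF assms(1)]] arc_pos_mono[of 0 t e]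
      arc_pos_mono[of "Suc t" "length (crew RS e)" e] assms(2) by simp
qed

lemma valid_path_cover: "c \<in> set (path_cover P) \<Longrightarrow> valid_arc I c"
proof -
  assume "c \<in> set (path_cover P)"
  then obtain j where j: "j < n" "c = path_cover P ! j" using path_cover_facts(1) by (auto simp: in_set_conv_nth)
  then obtain e t where e: "e \<in> set P" "t < length (crew RS e)" "RS ! j = crew RS e ! t"
    "c = (hop_region (mv_hop e), arc_pos e t, unit_share e * real (cap j))"
    using path_cover_facts(2) by blast
  show ?thesis using arc_within[OF e(1,2)] move_hop(1)[OF path_in_E[OF e(1)]]
    unfolding e(4) cap_def e(3) by (simp add: valid_arc_def num_regions)
qed

text \<open>
  All robots of a crew have the same quotient of length and capability, the weight of their move
  divided by \<open>Q\<close>.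
\<close>

lemma cost_path_cover: "cost I (path_cover P) = path_val P / Q"
proof -
  let ?X = "(\<lambda>j. arc_len (path_cover P ! j) / real (capabilities I ! j)) ` {..<n}"
  have val: "arc_len (path_cover P ! j) / real (capabilities I ! j) = mv_val e / Q"
    if "j < n" "path_cover P ! j = (i, s, unit_share e * real (cap j))" for j e i s
    using that cap_pos[OF that(1)] by (simp add: arc_len_def capability unit_share_eq)
  have X: "?X = (\<lambda>e. mv_val e / Q) ` set P"
  proof
    show "?X \<subseteq> (\<lambda>e. mv_val e / Q) ` set P"
      using path_cover_facts(2) val by blast
    show "(\<lambda>e. mv_val e / Q) ` set P \<subseteq> ?X"
    proof
      fix y assume "y \<in> (\<lambda>e. mv_val e / Q) ` set P"
      then obtain e where e: "e \<in> set P" "y = mv_val e / Q" by blast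
      have "crew RS e \<noteq> []"
        using crew_capacity[OF path_in_E[OF e(1)]] move_vectors(6)[OF path_in_E[OF e(1)]] by auto
      then have "0 < length (crew RS e)" by simp
      from path_cover_facts(3)[OF e(1) this] obtain j where j: "j < n" "RS ! j = crew RS e ! 0"
        "path_cover P ! j = (hop_region (mv_hop e), arc_pos e 0, unit_share e * real (snd (snd (crew RS e ! 0))))"
        by blast
      then have "arc_len (path_cover P ! j) / real (capabilities I ! j) = y"
        unfolding e(2) using val[of j _ _ e] by (simp add: cap_def)
      then show "y \<in> ?X" using j(1) by blast
    qed
  qed
  have caps: "caps_pos P" by (rule is_path_caps[OF caps_E path])
  have "P \<noteq> []" using finished by (auto simp: finished_def)
  then obtain e where e: "e \<in> set P" using hd_in_set by blast
  have nonneg: "0 \<le> mv_val f" for f by (simp add: frac_val_def)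
  have le: "mv_val f \<le> path_val P" if "f \<in> set P" for f using path_val_le_iff[OF caps, of "path_val P"] that by simp
  have "path_val P \<in> insert 0 (mv_val ` set P)"
    unfolding path_val_eq[OF caps] by (rule Max_in) auto
  then have "path_val P \<in> mv_val ` set P"
  proof
    assume "path_val P = 0"
    then have "mv_val e = path_val P" using le[OF e] nonneg[of e] by simp
    then show ?thesis using e by (metis image_eqI)
  qed
  then have "path_val P / Q \<in> ?X" unfolding X by auto
  moreover have "y \<le> path_val P / Q" if "y \<in> ?X" for y
    using that le unfolding X by (auto intro!: divide_right_mono)
  ultimately show ?thesis unfolding cost_def num_robots by (intro Max_eqI) auto
qed

context
  fixes R \<gamma>
  assumes real: "realises I R \<gamma>"
begin

text \<open>
  If two arcs in order share a point, its parameters differ by a multiple of \<open>L\<close> that lies between 0 and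
  \<open>L\<close>. If it is 0, the first arc ends where the second begins; if it is \<open>L\<close>, the second arc ends where
  the first begins.
\<close>

lemma in_order_ends:
  assumes "in_order x y" "valid_arc I x" "valid_arc I y"
  shows "arc_points \<gamma> x \<inter> arc_points \<gamma> y \<subseteq> arc_ends \<gamma> x \<inter> arc_ends \<gamma> y"
proof
  fix p assume p: "p \<in> arc_points \<gamma> x \<inter> arc_points \<gamma> y"
  obtain i s l where x: "x = (i, s, l)" by (cases x)
  obtain i' s' l' where y: "y = (i', s', l')" by (cases y)
  have i: "i < m" "i' < m" "0 \<le> l" "0 \<le> l'" using assms(2,3) unfolding x y valid_arc_def num_regions by auto
  have pu: "p \<in> \<gamma> i ` {s..s + l}" and pw: "p \<in> \<gamma> i' ` {s'..s' + l'}"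
    using p unfolding x y arc_points_def by auto
  from pu obtain u where u: "p = \<gamma> i u" "s \<le> u" "u \<le> s + l" by auto
  from pw obtain w where w: "p = \<gamma> i' w" "s' \<le> w" "w \<le> s' + l'" by auto
  have "i = i'" using frontier_disjoint[OF real i(1,2), of p] gamma_frontier[OF real] i u(1) w(1) by metis
  then have o: "s + l \<le> s'" "s' + l' \<le> s + boundary_length I i" using assms(1) unfolding x y in_order_def by auto
  have L: "0 < boundary_length I i" by (rule boundary_pos[OF real i(1)])
  obtain z :: int where z: "w = u + of_int z * boundary_length I i"
    using u(1) w(1) gamma_eq[OF real i(1)] \<open>i = i'\<close> by metis
  have "0 \<le> of_int z * boundary_length I i" "of_int z * boundary_length I i \<le> 1 * boundary_length I i"
    using z u w o by auto
  then have "0 \<le> z" "z \<le> 1" using L by (simp_all add: zero_le_mult_iff)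
  then have "z = 0 \<or> z = 1" by linarith
  then show "p \<in> arc_ends \<gamma> x \<inter> arc_ends \<gamma> y"
  proof
    assume "z = 0"
    then have "u = s + l" "w = s'" using z u w o i by auto
    then show ?thesis using u(1) w(1) unfolding x y arc_ends_def by simp
  next
    assume "z = 1"
    then have "u = s" "w = s' + l'" using z u w o i by auto
    then show ?thesis using u(1) w(1) unfolding x y arc_ends_def by simp
  qed
qed

lemma path_cover_covers:
  assumes i: "i < m" and k: "k < length (ips ! i)"
    and x: "real (span_start (ips ! i) k) / Q \<le> x" "x \<le> real (span_end (ips ! i) k) / Q"
  shows "\<gamma> i x \<in> (\<Union>c \<in> set (path_cover P). arc_points \<gamma> c)"
proof -
  let ?q = "length (ips ! i)"
  have "\<exists>b y. visited P i b \<and> b < 2 * ?q \<and> real (span_start (ips ! i) b) / Q \<le> y \<and> y \<le> real (span_end (ips ! i) b) / Q \<and> \<gamma> i y = \<gamma> i x"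
    using complete_visits[OF path finished i k]
  proof
    assume "visited P i k"
    then show ?thesis using k x by (intro exI[of _ k] exI[of _ x]) auto
  next
    assume v: "visited P i (k + ?q)"
    let ?y = "x + boundary_length I i"
    have "\<gamma> i x = \<gamma> i ?y" using gamma_eq[OF real i, of x ?y] by (metis mult_1 of_int_1)
    moreover have "real (span_start (ips ! i) (k + ?q)) / Q \<le> ?y" "?y \<le> real (span_end (ips ! i) (k + ?q)) / Q"
      using x k by (simp_all add: span_start_shift span_end_shift boundary_length[OF i] add_divide_distrib)
    ultimately show ?thesis using v k by (intro exI[of _ "k + ?q"] exI[of _ ?y]) auto
  qed
  then obtain b y where b: "visited P i b" "b < 2 * ?q"
    and y: "real (span_start (ips ! i) b) / Q \<le> y" "y \<le> real (span_end (ips ! i) b) / Q" "\<gamma> i y = \<gamma> i x" by blast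
  obtain e where e: "e \<in> set P" "hop_region (mv_hop e) = i" "hop_first (mv_hop e) \<le> b" "b \<le> hop_last (mv_hop e)"
    using b(1) unfolding visited_def by blast
  note eE = path_in_E[OF e(1)]
  note h = move_hop[OF eE, unfolded e(2)]
  have "arc_pos e 0 \<le> y"
  proof -
    have "hop_start (mv_hop e) \<le> span_start (ips ! i) b"
      unfolding h(7) using e b(2) by (intro span_start_mono) auto
    then have "arc_pos e 0 \<le> real (span_start (ips ! i) b) / Q" unfolding arc_pos_0 by (simp add: divide_right_mono)
    with y(1) show ?thesis by simp
  qed
  moreover have "y \<le> arc_pos e (length (crew RS e))"
  proof -
    have "span_end (ips ! i) b \<le> span_end (ips ! i) (hop_last (mv_hop e))"
    proof (cases "b = hop_last (mv_hop e)")
      case False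
      have "span_end (ips ! i) b \<le> span_start (ips ! i) (Suc b)" by (rule span_end_le_start[OF b(2)])
      also have "\<dots> \<le> span_start (ips ! i) (hop_last (mv_hop e))" using False e h by (intro span_start_mono) auto
      also have "\<dots> \<le> span_end (ips ! i) (hop_last (mv_hop e))" by (rule span_start_le_end)
      finally show ?thesis .
    qed simp
    then have "real (span_end (ips ! i) b) / Q \<le> arc_pos e (length (crew RS e))"
      unfolding arc_pos_length[OF eE] move_span[OF eE] e(2) by (simp add: divide_right_mono)
    with y(2) show ?thesis by simp
  qed
  moreover have "0 < length (crew RS e)"
    using crew_capacity[OF eE] move_vectors(6)[OF eE] by auto
  ultimately obtain t where t: "t < length (crew RS e)" "arc_pos e t \<le> y" "y \<le> arc_pos e (Suc t)"
    using step_between[of "length (crew RS e)" "arc_pos e" y] by blast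
  from path_cover_facts(3)[OF e(1) t(1)] obtain j where j: "j < n"
    "path_cover P ! j = (i, arc_pos e t, unit_share e * real (snd (snd (crew RS e ! t))))" unfolding e(2) by blast
  have "\<gamma> i y \<in> arc_points \<gamma> (path_cover P ! j)"
    unfolding j(2) arc_points_def using t arc_within(1)[OF e(1) t(1)] by auto
  then show ?thesis using j(1) y(3) path_cover_facts(1) by (metis UN_I nth_mem)
qed

lemma is_cover_path_cover: "is_cover I \<gamma> (path_cover P)"
  unfolding is_cover_def
proof (intro conjI ballI allI impI)
  show "length (path_cover P) = num_robots I" using path_cover_facts(1) num_robots by simp
  show "valid_arc I c" if "c \<in> set (path_cover P)" for c using valid_path_cover[OF that] .
  show "arc_points \<gamma> (path_cover P ! j) \<inter> arc_points \<gamma> (path_cover P ! k)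
      \<subseteq> arc_ends \<gamma> (path_cover P ! j) \<inter> arc_ends \<gamma> (path_cover P ! k)"
    if jk: "j < length (path_cover P)" "k < length (path_cover P)" "j \<noteq> k" for j k
  proof -
    have v: "valid_arc I (path_cover P ! j)" "valid_arc I (path_cover P ! k)" using jk valid_path_cover by auto
    have "in_order (path_cover P ! j) (path_cover P ! k) \<or> in_order (path_cover P ! k) (path_cover P ! j)"
      using path_cover_facts(4) jk path_cover_facts(1) by simp
    then show ?thesis using in_order_ends v by blast
  qed
  show "(\<Union>i < num_regions I. guarded I \<gamma> i) \<subseteq> (\<Union>c \<in> set (path_cover P). arc_points \<gamma> c)"
  proof
    fix p assume "p \<in> (\<Union>i < num_regions I. guarded I \<gamma> i)"
    then obtain i where i: "i < m" "p \<in> guarded I \<gamma> i" unfolding num_regions by auto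
    then obtain k x where "k < length (ips ! i)" "real (span_start (ips ! i) k) / Q \<le> x"
      "x \<le> real (span_end (ips ! i) k) / Q" "p = \<gamma> i x"
      unfolding guarded_eq[OF i(1)] by auto
    then show "p \<in> (\<Union>c \<in> set (path_cover P). arc_points \<gamma> c)" using path_cover_covers[OF i(1)] by simp
  qed
qed

end

end

lemma optimal_path:
  assumes "best path_less (filter (\<lambda>P. finished m N P) (best_paths E Z RS)) = P # Ps"
  shows "is_path E Z P" "finished m N P"
proof -
  have "P \<in> set (filter (\<lambda>P. finished m N P) (best_paths E Z RS))"
    using best_cases[of path_less "filter (\<lambda>P. finished m N P) (best_paths E Z RS)"] assms by auto
  then show "is_path E Z P" "finished m N P" using best_paths_sound by auto
qed

text \<open>
  A better cover would give a better path, and that path is short enough to have been considered.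
\<close>

lemma optimal_path_solution:
  assumes "best path_less (filter (\<lambda>P. finished m N P) (best_paths E Z RS)) = P # Ps" "realises I R \<gamma>"
  shows "is_solution I \<gamma> (Some (path_val P / Q, path_cover P))"
proof -
  let ?F = "filter (\<lambda>P. finished m N P) (best_paths E Z RS)"
  have caps: "caps_pos P'" if "P' \<in> set ?F" for P'
    using that best_paths_sound[of P' E Z RS] is_path_caps[OF caps_E] by auto
  note P = optimal_path[OF assms(1)]
  have opt: "path_val P / Q \<le> cost I C" if C: "is_cover I \<gamma> C" for C
  proof -
    obtain P' where P': "is_path E Z P'" "finished m N P'" "path_val P' \<le> cost I C * Q"
      using exists_path[OF assms(2) C] by blast
    obtain e T where eT: "P' = e # T" using P'(2) by (cases P') (auto simp: finished_def)
    have "length (e # T) \<le> length RS" using path_length[OF P'(1)] unfolding eT .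
    from best_paths_complete[OF caps_E P'(1)[unfolded eT] this] obtain T' where
      T': "e # T' \<in> set (best_paths E Z RS)" "path_val (e # T') \<le> path_val P'" unfolding eT by blast
    have "finished m N (e # T')" using P'(2) unfolding eT finished_def by simp
    with T'(1) have "e # T' \<in> set ?F" by simp
    from best_minimal[where xs = ?F and lt = path_less and f = path_val, OF _ this]
    have "path_val P \<le> path_val (e # T')" using path_less_iff caps assms(1) by auto
    with T'(2) P'(3) have "path_val P \<le> cost I C * Q" by simp
    then show ?thesis using Q by (simp add: divide_le_eq)
  qed
  show ?thesis
    using is_cover_path_cover[OF P assms(2)] cost_path_cover[OF P] opt by simp
qed

lemma no_path_solution:
  assumes "best path_less (filter (\<lambda>P. finished m N P) (best_paths E Z RS)) = []" "realises I R \<gamma>"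
  shows "is_solution I \<gamma> None"
proof -
  have empty: "filter (\<lambda>P. finished m N P) (best_paths E Z RS) = []"
    using best_cases[of path_less "filter (\<lambda>P. finished m N P) (best_paths E Z RS)"] assms(1) by auto
  have False if C: "is_cover I \<gamma> C" for C
  proof -
    obtain P' where P': "is_path E Z P'" "finished m N P'"
      using exists_path[OF assms(2) C] by blast
    obtain e T where eT: "P' = e # T" using P'(2) by (cases P') (auto simp: finished_def)
    have "length (e # T) \<le> length RS" using path_length[OF P'(1)] unfolding eT .
    from best_paths_complete[OF caps_E P'(1)[unfolded eT] this] obtain T' where
      T': "e # T' \<in> set (best_paths E Z RS)" by blast
    have "finished m N (e # T')" using P'(2) unfolding eT finished_def by simp
    with T' empty show False by (auto simp: filter_empty_conv)
  qed
  then show ?thesis by auto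
qed

end

section \<open>Decoding and conclusion\<close>

lemma list_code_decode:
  assumes "list_code A xs v" "\<And>x w. A x w \<Longrightarrow> \<exists>y. w = enc y \<and> D y = x \<and> G y"
  shows "\<exists>ys. v = enc ys \<and> map D ys = xs \<and> (\<forall>y \<in> set ys. G y)"
  using assms(1)
proof (induction xs arbitrary: v)
  case Nil
  then show ?case by (intro exI[of _ "[]"]) simp
next
  case (Cons x xs)
  then obtain w u where v: "v = Node w u" "A x w" "list_code A xs u" by auto
  obtain y where y: "w = enc y" "D y = x" "G y" using assms(2)[OF v(2)] by blast
  obtain ys where ys: "u = enc ys" "map D ys = xs" "\<forall>y \<in> set ys. G y" using Cons.IH[OF v(3)] by blast
  show ?case by (rule exI[of _ "y # ys"]) (use v y ys in simp)
qed

definition lengths_of :: "(nat \<times> nat) \<times> (nat \<times> nat) \<Rightarrow> real \<times> real" where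
  "lengths_of x = (frac_val (fst x), frac_val (snd x))"

definition proper :: "(nat \<times> nat) \<times> (nat \<times> nat) \<Rightarrow> bool" where
  "proper x \<longleftrightarrow> 0 < snd (fst x) \<and> 0 < snd (snd x)"

lemma decode_instance:
  assumes "instance_code I v"
  shows "\<exists>ps. v = enc (ps, robot_types I) \<and> perimeters I = map (map lengths_of) ps \<and>
    (\<forall>xs \<in> set ps. \<forall>x \<in> set xs. proper x)"
proof -
  from assms obtain a b where v: "v = Node a b"
    "list_code (list_code (pair_code frac_code frac_code)) (perimeters I) a"
    "list_code (pair_code nat_code nat_code) (robot_types I) b"
    unfolding instance_code_def pair_code_def[of "list_code (list_code (pair_code frac_code frac_code))"] by auto
  have "\<exists>ys. b = enc ys \<and> map id ys = robot_types I \<and> (\<forall>y \<in> set ys. True)"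
  proof (rule list_code_decode[OF v(3)])
    fix x w assume "pair_code nat_code nat_code x w"
    then show "\<exists>y. w = enc y \<and> id y = x \<and> True" by (auto simp: pair_code_def nat_code_def)
  qed
  then have b: "b = enc (robot_types I)" by auto
  have seg: "\<exists>y. w = enc y \<and> lengths_of y = x \<and> proper y" if code: "pair_code frac_code frac_code x w" for x w
  proof -
    obtain w1 w2 where w: "w = Node w1 w2" "frac_code (fst x) w1" "frac_code (snd x) w2"
      using code unfolding pair_code_def by (elim exE conjE)
    from w(2) obtain p q where pq: "0 < q" "fst x = real p / real q" "w1 = Node (Atom p) (Atom q)"
      unfolding frac_code_def by (elim exE conjE)
    from w(3) obtain c d where cd: "0 < d" "snd x = real c / real d" "w2 = Node (Atom c) (Atom d)"
      unfolding frac_code_def by (elim exE conjE)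
    have "w = enc ((p, q), (c, d)) \<and> lengths_of ((p, q), (c, d)) = x \<and> proper ((p, q), (c, d))"
      using pq cd w(1) by (simp add: lengths_of_def proper_def frac_val_def prod_eq_iff)
    then show ?thesis by (rule exI)
  qed
  have "\<exists>ps. a = enc ps \<and> map (map lengths_of) ps = perimeters I \<and> (\<forall>xs \<in> set ps. \<forall>x \<in> set xs. proper x)"
  proof (rule list_code_decode[OF v(2)])
    fix xs w assume "list_code (pair_code frac_code frac_code) xs w"
    then show "\<exists>ys. w = enc ys \<and> map lengths_of ys = xs \<and> (\<forall>y \<in> set ys. proper y)"
      using seg by (rule list_code_decode)
  qed
  then obtain ps where "a = enc ps" "map (map lengths_of) ps = perimeters I" "\<forall>xs \<in> set ps. \<forall>x \<in> set xs. proper x" by blast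
  then show ?thesis using v(1) b by (intro exI[of _ ps]) simp
qed

lemma dvd_prod_list: "x \<in> set xs \<Longrightarrow> (x :: nat) dvd prod_list xs"
  by (induction xs) auto

lemma prod_list_pos: "(\<And>x. x \<in> set xs \<Longrightarrow> 0 < x) \<Longrightarrow> 0 < (prod_list xs :: nat)"
  by (induction xs) auto

text \<open>
  Dividing by \<open>b\<close> after multiplication by \<open>Q\<close> is exact, as each denominator is a factor of \<open>Q\<close>.
\<close>

lemma scaled_lengths:
  assumes proper: "\<And>xs x. xs \<in> set ps \<Longrightarrow> x \<in> set xs \<Longrightarrow> proper x"
  defines "Q \<equiv> prod_list (denominators ps)"
  shows "0 < Q" "map (map lengths_of) ps = map (map (\<lambda>x. (real (fst x) / real Q, real (snd x) / real Q))) (scaled Q ps)"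
proof -
  show Q: "0 < Q"
    unfolding Q_def using proper by (intro prod_list_pos) (fastforce simp: denominators_def proper_def)
  have val: "frac_val (a, b) = real (a * Q div b) / real Q" if b: "b dvd Q" "0 < b" for a b
  proof -
    obtain k where k: "Q = b * k" using b(1) by (rule dvdE)
    then have "a * Q div b = a * k" using b(2) by simp
    then show ?thesis using Q b(2) unfolding k by (simp add: frac_val_def)
  qed
  have "lengths_of x = (real (fst (fst x) * Q div snd (fst x)) / real Q, real (fst (snd x) * Q div snd (snd x)) / real Q)"
    if x: "xs \<in> set ps" "x \<in> set xs" for xs x
  proof -
    have "snd (fst x) dvd Q" "snd (snd x) dvd Q"
      unfolding Q_def by (rule dvd_prod_list, use x in \<open>force simp: denominators_def\<close>)+
    then show ?thesis using proper[OF x] val[of "snd (fst x)" "fst (fst x)"] val[of "snd (snd x)" "fst (snd x)"]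
      unfolding proper_def lengths_of_def by simp
  qed
  then show "map (map lengths_of) ps = map (map (\<lambda>x. (real (fst x) / real Q, real (snd x) / real Q))) (scaled Q ps)"
    unfolding scaled_def by (simp add: comp_def)
qed

lemma length_scaled: "length (scaled Q ps) = length ps"
  by (simp add: scaled_def)

lemma list_code_map:
  "(\<And>x. x \<in> set xs \<Longrightarrow> A (f x) (enc x)) \<Longrightarrow> list_code A (map f xs) (enc xs)"
  by (induction xs) auto

lemma (in opg) code_path_cover:
  assumes "is_path E Z P" "finished m N P"
  shows "solution_code (Some (path_val P / Q, path_cover P))
    (enc ((fst (bottleneck P), snd (bottleneck P) * Q), arcs_of_path Q RS P))"
proof -
  have caps: "caps_pos P" by (rule is_path_caps[OF caps_E assms(1)])
  have "frac_code (path_val P / Q) (enc (fst (bottleneck P), snd (bottleneck P) * Q))"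
    unfolding frac_code_def
    by (rule exI[of _ "fst (bottleneck P)"], rule exI[of _ "snd (bottleneck P) * Q"])
      (use Q bottleneck_pos[OF caps] in \<open>simp add: frac_val_def\<close>)
  moreover have "list_code (pair_code nat_code (pair_code frac_code frac_code)) (path_cover P) (enc (arcs_of_path Q RS P))"
    unfolding path_cover_def
  proof (rule list_code_map)
    fix c assume c: "c \<in> set (arcs_of_path Q RS P)"
    obtain \<tau> where \<tau>: "\<forall>j < n. \<tau> j < length (all_placements P) \<and> fst (all_placements P ! \<tau> j) = key (RS ! j)"
      "arcs_of_path Q RS P = map (\<lambda>j. snd (all_placements P ! \<tau> j)) [0..<n]"
      using arcs_index[OF assms] by blast
    from c obtain j where "j < n" "c = snd (all_placements P ! \<tau> j)" unfolding \<tau>(2) by auto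
    then obtain d where "d \<in> set (all_placements P)" "c = snd d" using \<tau>(1) nth_mem by blast
    then obtain e where e: "e \<in> set P" "d \<in> set (placements Q RS e)" unfolding all_placements_def by auto
    have "0 < mv_cap e * Q" using caps e(1) Q by (simp add: caps_pos_def)
    then have "0 < snd (fst (snd c))" "0 < snd (snd (snd c))"
      using placements_denominators[OF e(2)] \<open>c = snd d\<close> by auto
    then show "pair_code nat_code (pair_code frac_code frac_code) (arc_of c) (enc c)"
      unfolding pair_code_def frac_code_def nat_code_def arc_of_def
      by (cases c) (auto simp: frac_val_def)
  qed
  ultimately show ?thesis unfolding solution_code_def by (simp add: pair_code_def)
qed

lemma solve_correct:
  assumes "valid_instance I" "perimeters I = map (map lengths_of) ps"
    "\<And>xs x. xs \<in> set ps \<Longrightarrow> x \<in> set xs \<Longrightarrow> proper x"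
  shows "\<exists>r. solution_code r (solve (ps, robot_types I)) \<and> (\<forall>R \<gamma>. realises I R \<gamma> \<longrightarrow> is_solution I \<gamma> r)"
proof -
  let ?ts = "robot_types I" and ?Q = "prod_list (denominators ps)"
  interpret opg I "scaled ?Q ps" ?ts ?Q
    by unfold_locales (use assms(1) scaled_lengths[OF assms(3)] assms(2) in auto)
  have U: "[0..<size_param (ps, ?ts)] = U" by (simp add: U_def size_param_def)
  let ?B = "best path_less (filter (\<lambda>P. finished m N P) (best_paths E Z RS))"
  have B: "best_complete_path U ?Q (ps, ?ts) = ?B"
    by (simp add: best_complete_path_def E_def V_def RS_def N_def Z_def length_scaled)
  have solve: "solve (ps, ?ts) = (case ?B of [] \<Rightarrow> Atom 0
     | P # _ \<Rightarrow> enc ((fst (bottleneck P), snd (bottleneck P) * ?Q), arcs_of_path ?Q RS P))"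
    by (simp only: solve_def Let_def U B fst_conv snd_conv RS_def)
  show ?thesis
  proof (cases ?B)
    case Nil
    then have "solve (ps, ?ts) = Atom 0" unfolding solve by simp
    moreover have "is_solution I \<gamma> None" if "realises I R \<gamma>" for R \<gamma>
      by (rule no_path_solution[OF Nil that])
    ultimately show ?thesis by (intro exI[of _ None]) (simp add: solution_code_def)
  next
    case (Cons P Ps)
    note path = optimal_path[OF Cons]
    have "solution_code (Some (path_val P / ?Q, path_cover P)) (solve (ps, ?ts))"
      using code_path_cover[OF path] unfolding solve Cons by simp
    then show ?thesis using optimal_path_solution[OF Cons] by blast
  qed
qed

text \<open>
  Only here the number of types is used: the parameter is polynomial in the largest robot count, with
  the number of types as the degree.
\<close>

lemma size_param_bound: "size_param (ps, ts) \<le> (max_atom (enc (ps, ts)) + 1) ^ length ts"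
proof -
  have "prod_list (map (\<lambda>p. Suc (fst p)) ts) \<le> (M + 1) ^ length ts" if "max_atom (enc ts) \<le> M" for M
    using that
  proof (induction ts)
    case (Cons p ts)
    then have "Suc (fst p) \<le> M + 1" "prod_list (map (\<lambda>p. Suc (fst p)) ts) \<le> (M + 1) ^ length ts" by auto
    from mult_le_mono[OF this] show ?case by (simp del: mult_Suc)
  qed simp
  from this[of "max_atom (enc (ps, ts))"] show ?thesis by (simp add: size_param_def)
qed

theorem mainTheorem3:
  fixes t :: nat
  shows "pseudo_polynomial_time_solvable (OPG_LR_inputs t) OPG_LR_output"
proof -
  obtain p q where run: "\<And>d. \<exists>c. runs p (enc d) (enc (solve d)) c \<and> c + sz (solve d) \<le> poly q (size_param d + sz d)"
    using pt_solve unfolding polytime_def by blast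
  let ?q = "pcompose q ([:1, 1:] ^ t + [:0, 1:])"
  have "\<exists>w c. runs p v w c \<and> OPG_LR_output v w \<and> c \<le> poly ?q (val_size v + max_atom v)"
    if "v \<in> OPG_LR_inputs t" for v
  proof -
    from that obtain I where I: "valid_instance I" "length (robot_types I) = t" "instance_code I v"
      unfolding OPG_LR_inputs_def by blast
    obtain ps :: "perimeter_data list" where ps: "v = enc (ps, robot_types I)" using decode_instance[OF I(3)] by blast
    let ?d = "(ps, robot_types I)" and ?n = "val_size v + max_atom v"
    obtain c where c: "runs p v (solve ?d) c" "c \<le> poly q (size_param ?d + sz ?d)"
      using run[of ?d] unfolding ps enc_val_def by auto
    have "size_param ?d \<le> (max_atom v + 1) ^ t"
      using size_param_bound[of ps "robot_types I"] unfolding ps I(2) .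
    also have "\<dots> \<le> (?n + 1) ^ t" by (intro power_mono) auto
    finally have "size_param ?d + sz ?d \<le> (?n + 1) ^ t + ?n" unfolding ps by simp
    from poly_nat_mono[OF this, of q] c(2)
    have "c \<le> poly ?q ?n" by (simp add: poly_pcompose poly_power add.commute)
    moreover have "OPG_LR_output v (solve ?d)"
      unfolding OPG_LR_output_def
    proof (intro allI impI)
      fix J assume J: "valid_instance J \<and> instance_code J v"
      then obtain qs :: "perimeter_data list" where qs: "v = enc (qs, robot_types J)" "perimeters J = map (map lengths_of) qs"
        "\<forall>xs \<in> set qs. \<forall>x \<in> set xs. proper x"
        using decode_instance[of J v] by blast
      have d: "?d = (qs, robot_types J)" by (rule enc_inj) (simp only: ps[symmetric] qs(1))
      show "\<exists>r. solution_code r (solve ?d) \<and> (\<forall>R \<gamma>. realises J R \<gamma> \<longrightarrow> is_solution J \<gamma> r)"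
        unfolding d by (rule solve_correct) (use J qs(2,3) in auto)
    qed
    ultimately show ?thesis using c(1) by blast
  qed
  then show ?thesis unfolding pseudo_polynomial_time_solvable_def by blast
qed

end
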